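(* Let $(\Pi_k)_{k\in\mathbb{N}}$ be a sequence of partitions of $[0,T]$ such that $\sum_k|\Pi_k|^\alpha<\infty$ for some $\alpha>0$. Then the sequence of processes $(B_{\Pi_k})_{k\in\mathbb{N}}$ converges to the Brownian motion $B$ pathwise on $[0,T]$ almost surely as $k\to\infty$; i.e. $\sup_{0\le t\le T}|B_{\Pi_k}(t)-B(t)|\to0$ almost surely.
   Context: Let $G\subset \mathrm{M}_N(\mathbb{C})$ be a matrix Lie group with Lie algebra $\mathfrak g\subset \mathrm{M}_N(\mathbb{C})$ (a real vector space), fix a real inner product on $\mathfrak g$ and an orthonormal basis $\beta$ of $\mathfrak g$. Let $\{W_\xi\}_{\xi\in\beta}$ be i.i.d. standard real Brownian motions, $W(t)=\sum_{\xi\in\beta}W_\xi(t)\,\xi$, and $\Xi=\sum_{\xi\in\beta}\xi^2$. The Brownian motion $B$ on $G$ is the strong solution of the It\^o SDE $dB(t)=B(t)\,dW(t)+\tfrac12 B(t)\,\Xi\,dt$, $B(0)=I$. For a partition $\Pi=\{0=t_0<t_1<\cdots<t_n=T\}$, put $|\Pi|=\max_j (t_j-t_{j-1})$ and, driven by the same $W$, define $$B_\Pi(t)=\prod_{j=1}^n\Big(I+W(t_j\wedge t)-W(t_{j-1}\wedge t)+\tfrac12\,\Xi\,(t_j\wedge t-t_{j-1}\wedge t)\Big),\qquad 0\le t\le T,$$ where the factors are ordered from left to right by increasing $j$. For $A\in \mathrm{M}_N(\mathbb{C})$, $|A|=\big(\tfrac1N\mathrm{Tr}(A^*A)\big)^{1/2}$.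 *)

theory Defs
  imports "HOL-Probability.Probability"
begin

type_synonym 'n cmat = "complex ^ 'n ^ 'n"

section \<open>Matrices\<close>

text \<open>The type carries componentwise operations, so powers and the exponential with respect
  to the matrix product \<open>**\<close> are defined here.\<close>

primrec mat_pow :: "'n::finite cmat \<Rightarrow> nat \<Rightarrow> 'n cmat" where
  "mat_pow A 0 = mat 1"
| "mat_pow A (Suc k) = A ** mat_pow A k"

definition mat_exp :: "'n::finite cmat \<Rightarrow> 'n cmat" where
  "mat_exp A = (\<Sum>k. (1 / fact k) *\<^sub>R mat_pow A k)"

definition conj_transpose :: "'n::finite cmat \<Rightarrow> 'n cmat" where
  "conj_transpose A = (\<chi> i j. cnj (A $ j $ i))"

text \<open>The trace of \<open>A\<^sup>* A\<close> is a nonnegative real number; \<open>Re\<close> only changes its type.\<close>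

definition normalized_norm :: "'n::finite cmat \<Rightarrow> real" where
  "normalized_norm A = sqrt (Re (trace (conj_transpose A ** A)) / real CARD('n))"

text \<open>\<open>ordered_prod n f = f 0 ** f 1 ** \<dots> ** f (n - 1)\<close>, from left to right.\<close>

primrec ordered_prod :: "nat \<Rightarrow> (nat \<Rightarrow> 'n::finite cmat) \<Rightarrow> 'n cmat" where
  "ordered_prod 0 f = mat 1"
| "ordered_prod (Suc n) f = ordered_prod n f ** f n"


section \<open>Matrix Lie groups\<close>

text \<open>A matrix Lie group is a subgroup of the general linear group that is closed in it.\<close>

definition matrix_lie_group :: "'n::finite cmat set \<Rightarrow> bool" where
  "matrix_lie_group G \<longleftrightarrow>
     G \<subseteq> {A. invertible A} \<and> mat 1 \<in> G \<and>
     (\<forall>A\<in>G. \<forall>B\<in>G. A ** B \<in> G) \<and> (\<forall>A\<in>G. matrix_inv A \<in> G) \<and>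
     closedin (top_of_set {A. invertible A}) G"

definition lie_algebra :: "'n::finite cmat set \<Rightarrow> 'n cmat set" where
  "lie_algebra G = {X. \<forall>t::real. mat_exp (t *\<^sub>R X) \<in> G}"

definition real_inner_product_on ::
  "'a::real_vector set \<Rightarrow> ('a \<Rightarrow> 'a \<Rightarrow> real) \<Rightarrow> bool" where
  "real_inner_product_on V ip \<longleftrightarrow>
     (\<forall>x\<in>V. \<forall>y\<in>V. ip x y = ip y x) \<and>
     (\<forall>x\<in>V. \<forall>y\<in>V. \<forall>z\<in>V. ip (x + y) z = ip x z + ip y z) \<and>
     (\<forall>c. \<forall>x\<in>V. \<forall>y\<in>V. ip (c *\<^sub>R x) y = c * ip x y) \<and>
     (\<forall>x\<in>V. x \<noteq> 0 \<longrightarrow> 0 < ip x x)"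

definition orthonormal_basis_of ::
  "'a::real_vector set \<Rightarrow> ('a \<Rightarrow> 'a \<Rightarrow> real) \<Rightarrow> 'a set \<Rightarrow> bool" where
  "orthonormal_basis_of V ip \<beta> \<longleftrightarrow>
     \<beta> \<subseteq> V \<and> span \<beta> = V \<and>
     (\<forall>\<xi>\<in>\<beta>. \<forall>\<eta>\<in>\<beta>. ip \<xi> \<eta> = (if \<xi> = \<eta> then 1 else 0))"


section \<open>Brownian motions and their filtration\<close>

text \<open>Processes are functions of time and sample point; only times \<open>t \<ge> 0\<close> matter.\<close>

definition standard_brownian_motion :: "'w measure \<Rightarrow> (real \<Rightarrow> 'w \<Rightarrow> real) \<Rightarrow> bool" where
  "standard_brownian_motion M X \<longleftrightarrow>
     (\<forall>t\<ge>0. X t \<in> borel_measurable M) \<and>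
     (AE \<omega> in M. X 0 \<omega> = 0) \<and>
     (AE \<omega> in M. continuous_on {0..} (\<lambda>t. X t \<omega>)) \<and>
     (\<forall>s t. 0 \<le> s \<and> s < t \<longrightarrow>
        distributed M lborel (\<lambda>\<omega>. X t \<omega> - X s \<omega>) (normal_density 0 (sqrt (t - s)))) \<and>
     (\<forall>(n::nat) \<tau>. 0 \<le> \<tau> 0 \<and> (\<forall>i<n. \<tau> i < \<tau> (Suc i)) \<longrightarrow>
        prob_space.indep_vars M (\<lambda>_. borel) (\<lambda>i \<omega>. X (\<tau> (Suc i)) \<omega> - X (\<tau> i) \<omega>) {..<n})"

text \<open>Independence of the family is independence of the path-valued random variables.\<close>

definition iid_brownian_motions ::
  "'w measure \<Rightarrow> 'i set \<Rightarrow> ('i \<Rightarrow> real \<Rightarrow> 'w \<Rightarrow> real) \<Rightarrow> bool" where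
  "iid_brownian_motions M I W \<longleftrightarrow>
     (\<forall>i\<in>I. standard_brownian_motion M (W i)) \<and>
     prob_space.indep_vars M (\<lambda>_. Pi\<^sub>M {0..} (\<lambda>_. borel))
       (\<lambda>i \<omega>. \<lambda>t\<in>{0..}. W i t \<omega>) I"

text \<open>The filtration generated by the driving Brownian motions, augmented by the null sets.\<close>

definition brownian_filtration ::
  "'w measure \<Rightarrow> 'i set \<Rightarrow> ('i \<Rightarrow> real \<Rightarrow> 'w \<Rightarrow> real) \<Rightarrow> real \<Rightarrow> 'w measure" where
  "brownian_filtration M I W t =
     sigma (space M)
       ({W i s -` A \<inter> space M | i s A. i \<in> I \<and> 0 \<le> s \<and> s \<le> t \<and> A \<in> sets borel} \<union> null_sets M)"

definition continuous_adapted ::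
  "'w measure \<Rightarrow> (real \<Rightarrow> 'w measure) \<Rightarrow> (real \<Rightarrow> 'w \<Rightarrow> 'a::topological_space) \<Rightarrow> bool" where
  "continuous_adapted M F X \<longleftrightarrow>
     (\<forall>t\<ge>0. X t \<in> borel_measurable (F t)) \<and>
     (AE \<omega> in M. continuous_on {0..} (\<lambda>t. X t \<omega>))"


section \<open>The It\^o integral\<close>

text \<open>Convergence to 0 in probability, formulated with outer probability: \<open>measure M\<close> is 0 on
  nonmeasurable sets, so it cannot be applied to \<open>{\<bar>Y k\<bar> > \<epsilon>}\<close> unless that set is known to be
  measurable.\<close>

definition null_in_probability :: "'w measure \<Rightarrow> (nat \<Rightarrow> 'w \<Rightarrow> real) \<Rightarrow> bool" where
  "null_in_probability M Y \<longleftrightarrow>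
     (\<forall>\<epsilon>>0. \<exists>E. (\<forall>k. E k \<in> sets M \<and> {\<omega> \<in> space M. \<bar>Y k \<omega>\<bar> > \<epsilon>} \<subseteq> E k) \<and>
                (\<lambda>k. measure M (E k)) \<longlonglongrightarrow> 0)"

text \<open>A triple \<open>(n, \<tau>, h)\<close> represents the simple process that equals \<open>h i\<close> on
  \<open>(\<tau> i, \<tau> (i + 1)]\<close> for \<open>i < n\<close>, and 0 elsewhere.\<close>

type_synonym ('w, 'n) simple_proc = "nat \<times> (nat \<Rightarrow> real) \<times> (nat \<Rightarrow> 'w \<Rightarrow> 'n cmat)"

definition simple_process ::
  "'w measure \<Rightarrow> (real \<Rightarrow> 'w measure) \<Rightarrow> ('w, 'n::finite) simple_proc \<Rightarrow> bool" where
  "simple_process M F = (\<lambda>(n, \<tau>, h).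
     0 \<le> \<tau> 0 \<and> (\<forall>i<n. \<tau> i < \<tau> (Suc i)) \<and>
     (\<forall>i<n. h i \<in> borel_measurable (F (\<tau> i)) \<and> bounded (h i ` space M)))"

definition simple_value ::
  "('w, 'n::finite) simple_proc \<Rightarrow> real \<Rightarrow> 'w \<Rightarrow> 'n cmat" where
  "simple_value = (\<lambda>(n, \<tau>, h) s \<omega>. \<Sum>i<n. indicator {\<tau> i<..\<tau> (Suc i)} s *\<^sub>R h i \<omega>)"

definition simple_integral ::
  "(real \<Rightarrow> 'w \<Rightarrow> 'n cmat) \<Rightarrow> ('w, 'n::finite) simple_proc \<Rightarrow> real \<Rightarrow> 'w \<Rightarrow> 'n cmat" where
  "simple_integral W = (\<lambda>(n, \<tau>, h) t \<omega>.
     \<Sum>i<n. h i \<omega> ** (W (min (\<tau> (Suc i)) t) \<omega> - W (min (\<tau> i) t) \<omega>))"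

text \<open>\<open>J\<close> is a continuous version of \<open>t \<mapsto> \<integral>\<^sub>0\<^sup>t X dW\<close>, for a continuous adapted integrand \<open>X\<close> and
  a matrix-valued driving process \<open>W\<close>: the limit in probability of integrals of simple processes
  that approximate \<open>X\<close> in \<open>L\<^sup>2[0,t]\<close> in probability, for every \<open>t\<close>.\<close>

definition ito_integral ::
  "'w measure \<Rightarrow> (real \<Rightarrow> 'w measure) \<Rightarrow> (real \<Rightarrow> 'w \<Rightarrow> 'n::finite cmat) \<Rightarrow>
   (real \<Rightarrow> 'w \<Rightarrow> 'n cmat) \<Rightarrow> (real \<Rightarrow> 'w \<Rightarrow> 'n cmat) \<Rightarrow> bool" where
  "ito_integral M F W X J \<longleftrightarrow>
     continuous_adapted M F X \<and> continuous_adapted M F J \<and>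
     (\<exists>H. (\<forall>k. simple_process M F (H k)) \<and>
        (\<forall>t\<ge>0.
           null_in_probability M
             (\<lambda>k \<omega>. LBINT s:{0..t}. (norm (simple_value (H k) s \<omega> - X s \<omega>))\<^sup>2) \<and>
           null_in_probability M
             (\<lambda>k \<omega>. norm (simple_integral W (H k) t \<omega> - J t \<omega>))))"


section \<open>Brownian motion on the group and its approximations\<close>

definition driving_process ::
  "'n::finite cmat set \<Rightarrow> ('n cmat \<Rightarrow> real \<Rightarrow> 'w \<Rightarrow> real) \<Rightarrow> real \<Rightarrow> 'w \<Rightarrow> 'n cmat" where
  "driving_process \<beta> W t \<omega> = (\<Sum>\<xi>\<in>\<beta>. W \<xi> t \<omega> *\<^sub>R \<xi>)"

definition Xi :: "'n::finite cmat set \<Rightarrow> 'n cmat" where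
  "Xi \<beta> = (\<Sum>\<xi>\<in>\<beta>. \<xi> ** \<xi>)"

text \<open>Strong solution of \<open>dB = B dW + (1/2) B \<Xi> dt\<close>, \<open>B 0 = I\<close>, in integrated form; a solution is
  strong because it is adapted to the filtration of the driving Brownian motions.\<close>

definition group_brownian_motion ::
  "'w measure \<Rightarrow> 'n::finite cmat set \<Rightarrow> ('n cmat \<Rightarrow> real \<Rightarrow> 'w \<Rightarrow> real) \<Rightarrow>
   (real \<Rightarrow> 'w \<Rightarrow> 'n cmat) \<Rightarrow> bool" where
  "group_brownian_motion M \<beta> W B \<longleftrightarrow>
     continuous_adapted M (brownian_filtration M \<beta> W) B \<and>
     (AE \<omega> in M. B 0 \<omega> = mat 1) \<and>
     (\<exists>J. ito_integral M (brownian_filtration M \<beta> W) (driving_process \<beta> W) B J \<and>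
        (AE \<omega> in M. \<forall>t\<ge>0.
           B t \<omega> = mat 1 + J t \<omega> + (LBINT s:{0..t}. (1/2) *\<^sub>R (B s \<omega> ** Xi \<beta>))))"

text \<open>A partition of \<open>[0,T]\<close> is the strictly increasing list of its points.\<close>

definition is_partition :: "real \<Rightarrow> real list \<Rightarrow> bool" where
  "is_partition T p \<longleftrightarrow> p \<noteq> [] \<and> hd p = 0 \<and> last p = T \<and> sorted_wrt (<) p"

definition mesh :: "real list \<Rightarrow> real" where
  "mesh p = Max ((\<lambda>j. p ! Suc j - p ! j) ` {..<length p - 1})"

definition B_approx ::
  "'n::finite cmat set \<Rightarrow> ('n cmat \<Rightarrow> real \<Rightarrow> 'w \<Rightarrow> real) \<Rightarrow> real list \<Rightarrow>
   real \<Rightarrow> 'w \<Rightarrow> 'n cmat" where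
  "B_approx \<beta> W p t \<omega> =
     ordered_prod (length p - 1)
       (\<lambda>j. mat 1
          + (driving_process \<beta> W (min (p ! Suc j) t) \<omega> - driving_process \<beta> W (min (p ! j) t) \<omega>)
          + ((min (p ! Suc j) t - min (p ! j) t) / 2) *\<^sub>R Xi \<beta>)"

end

(* B_Pi is the Euler scheme of the equation for B. On a fine grid s refining Pi, write Z_i for the
   increment of W(t) + t Xi / 2 over [s_i, s_(i+1)] and p_i for the last point of Pi before s_i. Then
   B_Pi(s_j) - B(s_j) = Y_j + rho_j, where Y_j = sum_(i<j) (B_Pi(p_i) - B(s_i)) Z_i, and
   rho_j = I + sum_(i<j) B(s_i) Z_i - B(s_j) is the defect of B in the Euler scheme of the fine grid.
   As the fine grid is refined, max_j |rho_j| tends to 0 in probability; this is all that is needed of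
   the Ito integral, so no moments of B are required. Since
   B_Pi(p_i) - B(s_i) = Y_i + rho_i + (B_Pi(p_i) - B_Pi(s_i)) and the last term has 2m-th moment of
   order mesh(Pi)^m, stopping Y when |rho| becomes large and a discrete Gronwall inequality for 2m-th
   moments give P(sup |B_Pi - B| > eps) <= C mesh(Pi)^m for every m. With m >= alpha these bounds are
   summable, and the Borel-Cantelli lemma applies. *)

theory Submission
  imports Defs
begin

text \<open>The order of choices shapes the proof. The constant of the final bound must not depend
  on Pi, yet nothing is known about the rate at which the defect rho tends to 0. So the constant is
  fixed first; Pi then determines how small rho has to be (at most sqrt(mesh(Pi))) and with what
  failure probability (mesh(Pi)^m); the fine grid comes last and is fine enough for both. The
  smallness of rho is itself delicate: the Ito integral is a limit of some simple processes that
  need not be built from B on the grid. On a common refinement the difference of the two integrals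
  is again an adapted sum, whose integrand is stopped once its square integral in time gets too
  large; the stopped maximal inequality \<open>ito_sum_maximal\<close> thus serves here with
  exponent 2 and for Y with exponent 2m. Even powers are used because |y + z|^(2m) has an explicit
  first-order term that averages to zero over a Brownian increment, a discrete substitute for the
  Ito formula: a step of length d then costs a factor 1 + O(d). The supremum over [0,T] is reached
  by putting the dyadic times of level N into the fine grid and letting N grow.\<close>

section \<open>Independence of Brownian increments from the past\<close>

text \<open>Grids are functions on \<open>{..n}\<close> with \<open>g i < g (Suc i)\<close>. A
  common refinement arises as a union of point sets, and this is how it becomes a grid
  again.\<close>

lemma finite_set_enumeration:
  fixes S :: "real set"
  assumes "finite S" "a \<in> S" "b \<in> S" "S \<subseteq> {a..b}"
  obtains g :: "nat \<Rightarrow> real" and n where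
    "g 0 = a" "g n = b" "\<And>i. i < n \<Longrightarrow> g i < g (Suc i)" "g ` {..n} = S"
proof -
  define l where "l = sorted_list_of_set S"
  have l: "set l = S" "sorted_wrt (<) l" "l \<noteq> []"
    using assms strict_sorted_list_of_set[of S] by (auto simp: l_def)
  define n where "n = length l - 1"
  have len: "length l = Suc n" using l(3) by (cases l) (auto simp: n_def)
  have mono: "l ! i < l ! j" if "i < j" "j \<le> n" for i j
    using sorted_wrt_nth_less[OF l(2) that(1)] that(2) len by simp
  have img: "(!) l ` {..n} = S"
    using l(1) len by (auto simp: set_conv_nth image_iff less_Suc_eq_le)
  obtain i where i: "i \<le> n" "l ! i = a" using img assms(2) by force
  obtain j where j: "j \<le> n" "l ! j = b" using img assms(3) by force
  have le: "a \<le> l ! k" "l ! k \<le> b" if "k \<le> n" for k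
    using img assms(4) that by (metis atLeastAtMost_iff atMost_iff image_eqI subsetD)+
  have "l ! 0 = a" using mono[of 0 i] le(1)[of 0] i by (cases "i = 0") auto
  moreover have "l ! n = b" using mono[of j n] le(2)[of n] j by (cases "j = n") auto
  ultimately show thesis using mono img by (intro that[of "(!) l" n]) auto
qed

lemma step_mono:
  fixes g :: "nat \<Rightarrow> real"
  assumes "\<And>i. i < n \<Longrightarrow> g i < g (Suc i)" "i < j" "j \<le> n"
  shows "g i < g j"
  using assms(2,3)
proof (induction j)
  case (Suc j)
  then show ?case using assms(1)[of j] by (cases "i = j") force+
qed simp

lemma measurable_Collect_mem:
  "f \<in> measurable M N \<Longrightarrow> A \<in> sets N \<Longrightarrow> {x\<in>space M. f x \<in> A} \<in> sets M"
  using measurable_sets[of f M N A] by (simp add: vimage_def Int_def conj_commute)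

context prob_space
begin

text \<open>The definition gives independence only for increments along a strictly increasing grid.
  With 0 and \<open>s\<close> inserted into \<open>R\<close> and \<open>t\<close> appended, each
  \<open>X r\<close> is a partial sum of the first \<open>k\<close> increments, because
  \<open>X 0 = 0\<close> almost surely, and the increment from \<open>s\<close> to \<open>t\<close>
  is the next one, number \<open>k\<close> counted from 0.\<close>

lemma brownian_increment_indep_finite:
  assumes X: "standard_brownian_motion M X" and st: "0 \<le> s" "s < t"
    and R: "finite R" "R \<subseteq> {0..s}"
    and A: "\<And>r. r \<in> R \<Longrightarrow> A r \<in> sets borel" and C: "C \<in> sets borel"
  shows "prob {w\<in>space M. (\<forall>r\<in>R. X r w \<in> A r) \<and> X t w - X s w \<in> C} =
    prob {w\<in>space M. \<forall>r\<in>R. X r w \<in> A r} * prob {w\<in>space M. X t w - X s w \<in> C}"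
proof -
  obtain g :: "nat \<Rightarrow> real" and k where g: "g 0 = 0" "g k = s"
    "\<And>i. i < k \<Longrightarrow> g i < g (Suc i)" "g ` {..k} = insert 0 (insert s R)"
    by (rule finite_set_enumeration[of "insert 0 (insert s R)" 0 s]) (use st R in auto)
  define \<tau> where "\<tau> i = (if i \<le> k then g i else t)" for i
  have \<tau>: "\<tau> 0 = 0" "\<tau> k = s" "\<tau> (Suc k) = t" "\<And>i. i < Suc k \<Longrightarrow> \<tau> i < \<tau> (Suc i)"
    using g st by (auto simp: \<tau>_def less_Suc_eq)
  have \<tau>pos: "0 \<le> \<tau> i" for i
  proof -
    have "g i \<in> insert 0 (insert s R)" if "i \<le> k" using g(4) that by blast
    then have "0 \<le> g i" if "i \<le> k" using R st that by fastforce
    then show ?thesis using st by (auto simp: \<tau>_def)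
  qed
  define D where "D i w = X (\<tau> (Suc i)) w - X (\<tau> i) w" for i w
  have mX[measurable]: "X r \<in> borel_measurable M" if "0 \<le> r" for r
    using X that by (auto simp: standard_brownian_motion_def)
  have mXt[measurable]: "X t \<in> borel_measurable M" "X s \<in> borel_measurable M" using st by auto
  have mD[measurable]: "D i \<in> borel_measurable M" for i
    unfolding D_def by (intro borel_measurable_diff mX \<tau>pos)
  have "0 \<le> \<tau> 0 \<and> (\<forall>i<Suc k. \<tau> i < \<tau> (Suc i))" using \<tau> by simp
  then have ind: "indep_vars (\<lambda>_. borel) D {..<Suc k}"
    using X unfolding standard_brownian_motion_def D_def by blast
  have iv: "indep_var (PiM {..<k} (\<lambda>_. borel)) (\<lambda>w. \<lambda>i\<in>{..<k}. D i w)
      (PiM {k} (\<lambda>_. borel)) (\<lambda>w. \<lambda>i\<in>{k}. D i w)"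
    by (rule indep_var_restrict[OF ind]) auto
  \<comment> \<open>The condition on the past, rewritten for the vector of increments. It matches
    the original event only where \<open>X 0 w = 0\<close>, so the final comparison of probabilities
    is up to null sets.\<close>
  define Q where "Q = {x \<in> space (PiM {..<k} (\<lambda>_. borel :: real measure)).
      \<forall>j\<in>{j. j \<le> k \<and> g j \<in> R}. (\<Sum>i<j. x i) \<in> A (g j)}"
  have Q: "Q \<in> sets (PiM {..<k} (\<lambda>_. borel))"
  proof -
    have "Measurable.pred (PiM {..<k} (\<lambda>_. borel)) (\<lambda>x. (\<Sum>i<j. x i) \<in> A (g j))"
      if "j \<le> k" "g j \<in> R" for j
    proof (rule pred_sets2[OF A[OF that(2)]])
      show "(\<lambda>x. \<Sum>i<j. x i) \<in> PiM {..<k} (\<lambda>_. borel) \<rightarrow>\<^sub>M (borel :: real measure)"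
        using that by (intro borel_measurable_sum measurable_component_singleton) auto
    qed
    then show ?thesis unfolding Q_def
      by (intro sets.sets_Collect_finite_All) (auto simp: pred_def)
  qed
  define K where "K = {x \<in> space (PiM {k} (\<lambda>_. borel :: real measure)). x k \<in> C}"
  have K: "K \<in> sets (PiM {k} (\<lambda>_. borel))"
    unfolding K_def by (rule measurable_Collect_mem[OF measurable_component_singleton]) (use C in auto)
  have *: "prob ((\<lambda>w. (\<lambda>i\<in>{..<k}. D i w, \<lambda>i\<in>{k}. D i w)) -` (Q \<times> K) \<inter> space M) =
     prob ((\<lambda>w. \<lambda>i\<in>{..<k}. D i w) -` Q \<inter> space M) * prob ((\<lambda>w. \<lambda>i\<in>{k}. D i w) -` K \<inter> space M)"
    by (rule indep_varD[OF iv Q K])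
  have sumD: "(\<Sum>i<j. D i w) = X (\<tau> j) w - X 0 w" for j w
    using sum_lessThan_telescope[of "\<lambda>i. X (\<tau> i) w" j] \<tau>(1) by (simp add: D_def)
  have Qeq: "(\<lambda>i\<in>{..<k}. D i w) \<in> Q \<longleftrightarrow> (\<forall>r\<in>R. X r w \<in> A r)" if "X 0 w = 0" for w
  proof -
    have "(\<Sum>i<j. (\<lambda>i\<in>{..<k}. D i w) i) = X (g j) w" if "j \<le> k" for j
    proof -
      have "(\<Sum>i<j. (\<lambda>i\<in>{..<k}. D i w) i) = (\<Sum>i<j. D i w)"
        using that by (intro sum.cong) auto
      then show ?thesis using \<open>X 0 w = 0\<close> that unfolding sumD by (simp add: \<tau>_def)
    qed
    then have "(\<lambda>i\<in>{..<k}. D i w) \<in> Q \<longleftrightarrow> (\<forall>j\<in>{j. j \<le> k \<and> g j \<in> R}. X (g j) w \<in> A (g j))"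
      by (auto simp: Q_def space_PiM)
    also have "\<dots> \<longleftrightarrow> (\<forall>r\<in>R. X r w \<in> A r)"
    proof -
      show ?thesis
      proof (intro iffI ballI)
        fix r assume *: "\<forall>j\<in>{j. j \<le> k \<and> g j \<in> R}. X (g j) w \<in> A (g j)" "r \<in> R"
        then obtain j where "j \<le> k" "r = g j" using g(4) by blast
        then show "X r w \<in> A r" using * by auto
      qed auto
    qed
    finally show ?thesis .
  qed
  have Keq: "(\<lambda>i\<in>{k}. D i w) \<in> K \<longleftrightarrow> X t w - X s w \<in> C" for w
    by (auto simp: K_def space_PiM D_def \<tau>)
  have X0: "AE w in M. X 0 w = 0" using X by (auto simp: standard_brownian_motion_def)
  have mR: "{w\<in>space M. \<forall>r\<in>R. X r w \<in> A r} \<in> sets M"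
    using R A by (intro sets.sets_Collect_finite_All measurable_Collect_mem[OF mX]) auto
  have mC: "{w\<in>space M. X t w - X s w \<in> C} \<in> sets M"
    using C by measurable
  have mRC: "{w\<in>space M. (\<forall>r\<in>R. X r w \<in> A r) \<and> X t w - X s w \<in> C} \<in> sets M"
    using sets.Int[OF mR mC] by (rule back_subst[of "\<lambda>x. x \<in> sets M"]) auto
  have mV: "(\<lambda>w. \<lambda>i\<in>{..<k}. D i w) \<in> M \<rightarrow>\<^sub>M PiM {..<k} (\<lambda>_. borel)"
    "(\<lambda>w. \<lambda>i\<in>{k}. D i w) \<in> M \<rightarrow>\<^sub>M PiM {k} (\<lambda>_. borel)"
    by (auto intro!: measurable_restrict)
  have "prob ((\<lambda>w. (\<lambda>i\<in>{..<k}. D i w, \<lambda>i\<in>{k}. D i w)) -` (Q \<times> K) \<inter> space M) =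
     prob {w\<in>space M. (\<forall>r\<in>R. X r w \<in> A r) \<and> X t w - X s w \<in> C}"
  proof (rule finite_measure_eq_AE)
    show "(\<lambda>w. (\<lambda>i\<in>{..<k}. D i w, \<lambda>i\<in>{k}. D i w)) -` (Q \<times> K) \<inter> space M \<in> sets M"
      by (rule measurable_sets[OF measurable_Pair[OF mV]]) (use Q K in auto)
  qed (use X0 mRC Qeq Keq in auto)
  moreover have "prob ((\<lambda>w. \<lambda>i\<in>{..<k}. D i w) -` Q \<inter> space M) = prob {w\<in>space M. \<forall>r\<in>R. X r w \<in> A r}"
    by (rule finite_measure_eq_AE) (use X0 mR Qeq measurable_sets[OF mV(1) Q] in auto)
  moreover have "(\<lambda>w. \<lambda>i\<in>{k}. D i w) -` K \<inter> space M = {w\<in>space M. X t w - X s w \<in> C}"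
    using Keq by auto
  ultimately show ?thesis using * by simp
qed

end

text \<open>Finiteness of \<beta> is isolated as an assumption;
  \<open>finite_orthonormal_basis\<close> supplies it for an orthonormal basis of the Lie
  algebra.\<close>

locale brownian_driver = prob_space M for M :: "'w measure" +
  fixes \<beta> :: "'n::finite cmat set" and W :: "'n cmat \<Rightarrow> real \<Rightarrow> 'w \<Rightarrow> real"
  assumes finite_basis: "finite \<beta>"
    and iid: "iid_brownian_motions M \<beta> W"
begin

abbreviation "F \<equiv> brownian_filtration M \<beta> W"

lemma brownian: "\<xi> \<in> \<beta> \<Longrightarrow> standard_brownian_motion M (W \<xi>)"
  using iid by (auto simp: iid_brownian_motions_def)

lemma measurable_W: "\<xi> \<in> \<beta> \<Longrightarrow> 0 \<le> t \<Longrightarrow> W \<xi> t \<in> borel_measurable M"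
  using brownian by (auto simp: standard_brownian_motion_def)

definition generator :: "real \<Rightarrow> 'w set set" where
  "generator t = {W i s -` A \<inter> space M | i s A. i \<in> \<beta> \<and> 0 \<le> s \<and> s \<le> t \<and> A \<in> sets borel} \<union> null_sets M"

lemma generator_sets: "generator t \<subseteq> sets M"
proof
  fix E assume "E \<in> generator t"
  then consider "E \<in> null_sets M" | i s A where "E = W i s -` A \<inter> space M" "i \<in> \<beta>" "0 \<le> s" "A \<in> sets borel"
    unfolding generator_def by blast
  then show "E \<in> sets M"
  proof cases
    case (2 i s A)
    then show ?thesis using measurable_sets[OF measurable_W] by blast
  qed auto
qed

lemma generator_mono: "s \<le> t \<Longrightarrow> generator s \<subseteq> generator t"
  unfolding generator_def by (rule Un_mono; fastforce)

lemma F_eq: "F t = sigma (space M) (generator t)"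
  by (simp add: brownian_filtration_def generator_def)

lemma space_F [simp]: "space (F t) = space M"
  unfolding F_eq by (rule space_measure_of[OF order_trans[OF generator_sets sets.space_closed]])

lemma sets_F: "sets (F t) = sigma_sets (space M) (generator t)"
  unfolding F_eq by (rule sets_measure_of[OF order_trans[OF generator_sets sets.space_closed]])

lemma sets_F_subset: "sets (F t) \<subseteq> sets M"
  unfolding sets_F by (rule sets.sigma_sets_subset[OF generator_sets])

lemma sets_F_mono: "s \<le> t \<Longrightarrow> sets (F s) \<subseteq> sets (F t)"
  unfolding sets_F by (rule sigma_sets_mono'[OF generator_mono])

lemma measurable_F_mono: "f \<in> measurable (F s) N \<Longrightarrow> s \<le> t \<Longrightarrow> f \<in> measurable (F t) N"
  using sets_F_mono[of s t] by (auto simp: measurable_def)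

lemma measurable_F: "f \<in> measurable (F s) N \<Longrightarrow> f \<in> measurable M N"
  using sets_F_subset[of s] by (auto simp: measurable_def)

lemma W_adapted:
  assumes "\<xi> \<in> \<beta>" "0 \<le> s" "s \<le> t"
  shows "W \<xi> s \<in> borel_measurable (F t)"
proof (rule measurableI)
  fix A :: "real set" assume "A \<in> sets borel"
  then have "W \<xi> s -` A \<inter> space M \<in> generator t"
    using assms by (auto simp: generator_def)
  then show "W \<xi> s -` A \<inter> space (F t) \<in> sets (F t)"
    by (simp add: sets_F sigma_sets.Basic)
qed simp

text \<open>Independence of the paths splits the event into a product over the coordinates. The
  increment concerns coordinate \<xi> alone, where \<open>brownian_increment_indep_finite\<close>
  splits it off; the remaining product is then reassembled.\<close>

lemma prob_cylinder_increment:
  assumes st: "0 \<le> s" "s < t" and \<xi>: "\<xi> \<in> \<beta>"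
    and R: "finite R" "R \<subseteq> {0..s}"
    and A: "\<And>i r. A i r \<in> sets borel" and C: "C \<in> sets borel"
  shows "prob ({w\<in>space M. \<forall>i\<in>\<beta>. \<forall>r\<in>R. W i r w \<in> A i r} \<inter> {w\<in>space M. W \<xi> t w - W \<xi> s w \<in> C}) =
    prob {w\<in>space M. \<forall>i\<in>\<beta>. \<forall>r\<in>R. W i r w \<in> A i r} * prob {w\<in>space M. W \<xi> t w - W \<xi> s w \<in> C}"
proof -
  let ?N = "Pi\<^sub>M {0..} (\<lambda>_. borel :: real measure)"
  let ?X = "\<lambda>i w. \<lambda>t\<in>{0..}. W i t w"
  have iv: "indep_vars (\<lambda>_. ?N) ?X \<beta>"
    using iid by (auto simp: iid_brownian_motions_def)
  define Q where "Q i = {x\<in>space ?N. \<forall>r\<in>R. x r \<in> A i r}" for i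
  define K where "K = {x\<in>space ?N. x t - x s \<in> C}"
  have c: "(\<lambda>x. x r) \<in> ?N \<rightarrow>\<^sub>M borel" if "0 \<le> r" for r
    by (rule measurable_component_singleton) (use that in auto)
  have Q: "Q i \<in> sets ?N" for i
    unfolding Q_def
  proof (intro sets.sets_Collect_finite_All R)
    fix r assume "r \<in> R"
    then show "{x\<in>space ?N. x r \<in> A i r} \<in> sets ?N"
      using R by (intro measurable_Collect_mem[OF c A]) auto
  qed
  have K: "K \<in> sets ?N"
    unfolding K_def by (rule measurable_Collect_mem[OF borel_measurable_diff[OF c c] C]) (use st in auto)
  have Qv: "?X i -` Q i \<inter> space M = {w\<in>space M. \<forall>r\<in>R. W i r w \<in> A i r}" for i
    using R by (fastforce simp: Q_def space_PiM)
  have Kv: "?X i -` K \<inter> space M = {w\<in>space M. W i t w - W i s w \<in> C}" for i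
    using st by (auto simp: K_def space_PiM)
  have ne: "\<beta> \<noteq> {}" using \<xi> by auto
  define Q' where "Q' i = (if i = \<xi> then Q i \<inter> K else Q i)" for i
  have Q': "Q' i \<in> sets ?N" for i using Q K by (auto simp: Q'_def)
  have "{w\<in>space M. \<forall>i\<in>\<beta>. \<forall>r\<in>R. W i r w \<in> A i r} \<inter> {w\<in>space M. W \<xi> t w - W \<xi> s w \<in> C}
      = (\<Inter>i\<in>\<beta>. ?X i -` Q' i \<inter> space M)"
  proof -
    have "(\<Inter>i\<in>\<beta>. ?X i -` Q' i \<inter> space M) = (\<Inter>i\<in>\<beta>. ?X i -` Q i \<inter> space M) \<inter> (?X \<xi> -` K \<inter> space M)"
      using \<xi> by (auto simp: Q'_def split: if_splits)
    also have "(\<Inter>i\<in>\<beta>. ?X i -` Q i \<inter> space M) = {w\<in>space M. \<forall>i\<in>\<beta>. \<forall>r\<in>R. W i r w \<in> A i r}"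
      unfolding Qv using ne by auto
    finally show ?thesis unfolding Kv by (rule sym)
  qed
  then have "prob ({w\<in>space M. \<forall>i\<in>\<beta>. \<forall>r\<in>R. W i r w \<in> A i r} \<inter> {w\<in>space M. W \<xi> t w - W \<xi> s w \<in> C})
      = (\<Prod>i\<in>\<beta>. prob (?X i -` Q' i \<inter> space M))"
    using indep_varsD_finite[OF iv ne finite_basis, of Q', OF Q'] by (simp only:)
  also have "\<dots> = prob (?X \<xi> -` (Q \<xi> \<inter> K) \<inter> space M) * (\<Prod>i\<in>\<beta> - {\<xi>}. prob (?X i -` Q i \<inter> space M))"
    using finite_basis \<xi> by (subst prod.remove[of _ \<xi>]) (auto simp: Q'_def intro!: prod.cong)
  also have "?X \<xi> -` (Q \<xi> \<inter> K) \<inter> space M =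
      {w\<in>space M. (\<forall>r\<in>R. W \<xi> r w \<in> A \<xi> r) \<and> W \<xi> t w - W \<xi> s w \<in> C}"
    using Qv[of \<xi>] Kv[of \<xi>] by blast
  also have "prob \<dots> = prob {w\<in>space M. \<forall>r\<in>R. W \<xi> r w \<in> A \<xi> r} * prob {w\<in>space M. W \<xi> t w - W \<xi> s w \<in> C}"
    by (rule brownian_increment_indep_finite[OF brownian[OF \<xi>] st R A C])
  also have "prob {w\<in>space M. \<forall>r\<in>R. W \<xi> r w \<in> A \<xi> r} * prob {w\<in>space M. W \<xi> t w - W \<xi> s w \<in> C} *
      (\<Prod>i\<in>\<beta> - {\<xi>}. prob (?X i -` Q i \<inter> space M)) =
      (\<Prod>i\<in>\<beta>. prob (?X i -` Q i \<inter> space M)) * prob {w\<in>space M. W \<xi> t w - W \<xi> s w \<in> C}"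
    using finite_basis \<xi> by (subst (2) prod.remove[of _ \<xi>]) (auto simp: Qv)
  also have "(\<Prod>i\<in>\<beta>. prob (?X i -` Q i \<inter> space M)) = prob (\<Inter>i\<in>\<beta>. ?X i -` Q i \<inter> space M)"
    by (rule indep_varsD_finite[OF iv ne finite_basis, of Q, OF Q, symmetric])
  also have "(\<Inter>i\<in>\<beta>. ?X i -` Q i \<inter> space M) = {w\<in>space M. \<forall>i\<in>\<beta>. \<forall>r\<in>R. W i r w \<in> A i r}"
    unfolding Qv using ne by auto
  finally show ?thesis .
qed

text \<open>A pi-system argument. Since the filtration contains all null sets, the pi-system cannot
  consist of cylinders alone: \<open>\<P>\<close> collects the events that agree almost surely with
  a cylinder. They are stable under intersection, contain the generators of \<open>F s\<close>, and
  are independent of the increment by \<open>prob_cylinder_increment\<close>.\<close>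

lemma indep_var_increment:
  assumes st: "0 \<le> s" "s < t" and \<xi>: "\<xi> \<in> \<beta>" and f: "f \<in> borel_measurable (F s)"
  shows "indep_var borel f borel (\<lambda>w. W \<xi> t w - W \<xi> s w)"
proof -
  define cyl where "cyl = {{w\<in>space M. \<forall>i\<in>\<beta>. \<forall>r\<in>R. W i r w \<in> A i r} | R A.
    finite R \<and> R \<subseteq> {0..s} \<and> (\<forall>i r. A i r \<in> sets (borel :: real measure))}"
  have cylE: thesis if "E0 \<in> cyl" "\<And>R A. \<lbrakk>E0 = {w\<in>space M. \<forall>i\<in>\<beta>. \<forall>r\<in>R. W i r w \<in> A i r};
      finite R; R \<subseteq> {0..s}; \<forall>i r. A i r \<in> sets borel\<rbrakk> \<Longrightarrow> thesis" for E0 thesis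
  proof -
    have "\<exists>R A. E0 = {w\<in>space M. \<forall>i\<in>\<beta>. \<forall>r\<in>R. W i r w \<in> A i r} \<and>
        finite R \<and> R \<subseteq> {0..s} \<and> (\<forall>i r. A i r \<in> sets (borel :: real measure))"
      using that(1) unfolding cyl_def by (rule CollectD)
    then show thesis by (elim exE conjE) (rule that(2), assumption+)
  qed
  define \<P> where "\<P> = {E \<in> sets M. \<exists>E0\<in>cyl. AE w in M. w \<in> E \<longleftrightarrow> w \<in> E0}"
  define \<I> where "\<I> = {(\<lambda>w. W \<xi> t w - W \<xi> s w) -` C \<inter> space M | C. C \<in> sets borel}"
  have mI[measurable]: "(\<lambda>w. W \<xi> t w - W \<xi> s w) \<in> borel_measurable M"
    by (rule borel_measurable_diff[OF measurable_W measurable_W]) (use st \<xi> in auto)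
  have cyl_sets: "E0 \<in> sets M" if E0: "E0 \<in> cyl" for E0
  proof -
    obtain R A where RA: "E0 = {w\<in>space M. \<forall>i\<in>\<beta>. \<forall>r\<in>R. W i r w \<in> A i r}" "finite R"
      "R \<subseteq> {0..s}" "\<forall>i r. A i r \<in> sets borel"
      using E0 by (rule cylE) blast
    have "{w\<in>space M. W i r w \<in> A i r} \<in> sets M" if "i \<in> \<beta>" "r \<in> R" for i r
      by (rule measurable_Collect_mem[OF measurable_W RA(4)[rule_format]]) (use that RA(3) in auto)
    then show ?thesis
      unfolding RA(1) by (intro sets.sets_Collect_finite_All finite_basis RA(2))
  qed
  have cyl_Int: "E \<inter> E' \<in> cyl" if "E \<in> cyl" "E' \<in> cyl" for E E'
  proof -
    obtain R A where 1: "E = {w\<in>space M. \<forall>i\<in>\<beta>. \<forall>r\<in>R. W i r w \<in> A i r}" "finite R" "R \<subseteq> {0..s}" "\<forall>i r. A i r \<in> sets borel"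
      using \<open>E \<in> cyl\<close> by (rule cylE) blast
    obtain R' A' where 2: "E' = {w\<in>space M. \<forall>i\<in>\<beta>. \<forall>r\<in>R'. W i r w \<in> A' i r}" "finite R'" "R' \<subseteq> {0..s}" "\<forall>i r. A' i r \<in> sets borel"
      using \<open>E' \<in> cyl\<close> by (rule cylE) blast
    note * = 1(1) 2(1) 1(2) 2(2) 1(3) 2(3) 1(4) 2(4)
    \<comment> \<open>One set of times serves both cylinders; a time absent from one of them gets
      the condition \<open>UNIV\<close> from it.\<close>
    define A'' where "A'' i r = (if r \<in> R then A i r else UNIV) \<inter> (if r \<in> R' then A' i r else UNIV)" for i r
    have "E \<inter> E' = {w\<in>space M. \<forall>i\<in>\<beta>. \<forall>r\<in>R \<union> R'. W i r w \<in> A'' i r}"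
      unfolding *(1,2) A''_def by auto
    moreover have "A'' i r \<in> sets borel" for i r using *(7,8) by (auto simp: A''_def)
    ultimately show ?thesis using *(3-6) unfolding cyl_def
      by (intro CollectI exI[of _ "R \<union> R'"] exI[of _ A''] conjI allI) simp_all
  qed
  have "indep_set \<P> \<I>"
    unfolding indep_sets2_eq
  proof (intro conjI ballI)
    show "\<P> \<subseteq> events" by (auto simp: \<P>_def)
    show "\<I> \<subseteq> events" by (auto simp: \<I>_def)
    fix E I assume E: "E \<in> \<P>" and "I \<in> \<I>"
    then obtain C where C: "I = {w\<in>space M. W \<xi> t w - W \<xi> s w \<in> C}" "C \<in> sets borel"
      by (auto simp: \<I>_def)
    have mIC: "I \<in> sets M" unfolding C(1) by (rule measurable_Collect_mem[OF mI C(2)])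
    obtain E0 where E0: "E0 \<in> cyl" "AE w in M. w \<in> E \<longleftrightarrow> w \<in> E0" "E \<in> sets M"
      using E by (auto simp: \<P>_def)
    obtain R A where RA: "E0 = {w\<in>space M. \<forall>i\<in>\<beta>. \<forall>r\<in>R. W i r w \<in> A i r}" "finite R"
      "R \<subseteq> {0..s}" "\<forall>i r. A i r \<in> sets borel"
      using E0(1) by (rule cylE) blast
    have "prob (E \<inter> I) = prob (E0 \<inter> I)"
      by (rule finite_measure_eq_AE) (use E0 cyl_sets mIC in auto)
    also have "\<dots> = prob E0 * prob I"
      unfolding RA(1) C(1) by (rule prob_cylinder_increment[OF st \<xi> RA(2,3) RA(4)[rule_format] C(2)])
    also have "prob E0 = prob E"
      by (rule finite_measure_eq_AE) (use E0 cyl_sets in auto)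
    finally show "prob (E \<inter> I) = prob E * prob I" .
  qed
  moreover have "Int_stable \<P>"
  proof (rule Int_stableI)
    fix E E' assume "E \<in> \<P>" "E' \<in> \<P>"
    then obtain E0 E0' where *: "E0 \<in> cyl" "AE w in M. w \<in> E \<longleftrightarrow> w \<in> E0" "E \<in> sets M"
       "E0' \<in> cyl" "AE w in M. w \<in> E' \<longleftrightarrow> w \<in> E0'" "E' \<in> sets M"
      by (auto simp: \<P>_def)
    have "AE w in M. w \<in> E \<inter> E' \<longleftrightarrow> w \<in> E0 \<inter> E0'" using *(2,5) by auto
    moreover have "E0 \<inter> E0' \<in> cyl" by (rule cyl_Int[OF *(1,4)])
    ultimately show "E \<inter> E' \<in> \<P>" using *(3,6) unfolding \<P>_def by blast
  qed
  moreover have "Int_stable \<I>"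
  proof (rule Int_stableI)
    fix E E' assume "E \<in> \<I>" "E' \<in> \<I>"
    then obtain C C' where "E = (\<lambda>w. W \<xi> t w - W \<xi> s w) -` C \<inter> space M"
      "E' = (\<lambda>w. W \<xi> t w - W \<xi> s w) -` C' \<inter> space M" "C \<in> sets borel" "C' \<in> sets borel"
      by (auto simp: \<I>_def)
    then have "E \<inter> E' = (\<lambda>w. W \<xi> t w - W \<xi> s w) -` (C \<inter> C') \<inter> space M" "C \<inter> C' \<in> sets borel"
      by auto
    then show "E \<inter> E' \<in> \<I>" unfolding \<I>_def by blast
  qed
  ultimately have ind: "indep_set (sigma_sets (space M) \<P>) (sigma_sets (space M) \<I>)"
    by (rule indep_set_sigma_sets)
  have "generator s \<subseteq> \<P>"
  proof
    fix E assume E: "E \<in> generator s"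
    have EM: "E \<in> sets M" using E generator_sets by blast
    show "E \<in> \<P>"
    proof (cases "E \<in> null_sets M")
      case True
      \<comment> \<open>A null set agrees almost surely with the empty cylinder. Some coordinate has
        to carry the impossible condition, and \<xi> provides it.\<close>
      have "{w\<in>space M. \<forall>i\<in>\<beta>. \<forall>r\<in>{0}. W i r w \<in> {}} \<in> cyl"
        unfolding cyl_def using st by (intro CollectI exI[of _ "{0}"] exI[of _ "\<lambda>_ _. {}"]) auto
      then have "{} \<in> cyl" by (rule back_subst[of "\<lambda>E. E \<in> cyl"]) (use \<xi> in auto)
      moreover have "AE w in M. w \<in> E \<longleftrightarrow> w \<in> {}" using AE_not_in[OF True] by auto
      ultimately show ?thesis
        using EM unfolding \<P>_def by (intro CollectI conjI bexI[of _ "{}"]) auto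
    next
      case False
      then obtain i r A where *: "E = W i r -` A \<inter> space M" "i \<in> \<beta>" "0 \<le> r" "r \<le> s" "A \<in> sets borel"
        using E by (auto simp: generator_def)
      have "E = {w\<in>space M. \<forall>j\<in>\<beta>. \<forall>u\<in>{r}. W j u w \<in> (if j = i then A else UNIV)}"
        using * by auto
      then have "E \<in> cyl"
        unfolding cyl_def using *
        by (intro CollectI exI[of _ "{r}"] exI[of _ "\<lambda>j u. if j = i then A else UNIV"]) auto
      then show ?thesis using EM unfolding \<P>_def by (intro CollectI conjI bexI[of _ E]) auto
    qed
  qed
  then have FP: "sets (F s) \<subseteq> sigma_sets (space M) \<P>"
    unfolding sets_F by (intro sigma_sets_mono')
  have "indep_set {f -` A \<inter> space M |A. A \<in> sets borel} \<I>"
    unfolding indep_sets2_eq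
  proof (intro conjI ballI)
    show "{f -` A \<inter> space M |A. A \<in> sets borel} \<subseteq> events"
      using measurable_F[OF f] by auto
    show "\<I> \<subseteq> events" by (auto simp: \<I>_def)
    fix E I assume "E \<in> {f -` A \<inter> space M |A. A \<in> sets borel}" and I: "I \<in> \<I>"
    then have "E \<in> sets (F s)" using measurable_sets[OF f] by auto
    then have "E \<in> sigma_sets (space M) \<P>" using FP by blast
    moreover have "I \<in> sigma_sets (space M) \<I>" using I by (rule sigma_sets.Basic)
    ultimately show "prob (E \<inter> I) = prob E * prob I"
      using ind unfolding indep_sets2_eq by blast
  qed
  then have "indep_set (sigma_sets (space M) {f -` A \<inter> space M |A. A \<in> sets borel}) (sigma_sets (space M) \<I>)"
  proof (rule indep_set_sigma_sets)
    show "Int_stable {f -` A \<inter> space M |A. A \<in> sets borel}"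
    proof (rule Int_stableI)
      fix E E' assume "E \<in> {f -` A \<inter> space M |A. A \<in> sets borel}" "E' \<in> {f -` A \<inter> space M |A. A \<in> sets borel}"
      then obtain C C' where "E = f -` C \<inter> space M" "E' = f -` C' \<inter> space M" "C \<in> sets borel" "C' \<in> sets borel"
        by auto
      then have "E \<inter> E' = f -` (C \<inter> C') \<inter> space M" "C \<inter> C' \<in> sets borel" by auto
      then show "E \<inter> E' \<in> {f -` A \<inter> space M |A. A \<in> sets borel}" by blast
    qed
  qed fact
  then show ?thesis
    unfolding indep_var_eq \<I>_def using measurable_F[OF f] by simp
qed

end

section \<open>Moment inequalities\<close>

lemma norm_cmat_power2:
  fixes A :: "'n::finite cmat"
  shows "(norm A)\<^sup>2 = (\<Sum>i\<in>UNIV. \<Sum>j\<in>UNIV. (norm (A $ i $ j))\<^sup>2)"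
  by (simp add: norm_vec_def L2_set_def sum_nonneg)

text \<open>The norm of this type is the Frobenius norm, for which Cauchy-Schwarz applied to each
  entry of the product gives submultiplicativity.\<close>

lemma norm_cmat_mult:
  fixes A B :: "'n::finite cmat"
  shows "norm (A ** B) \<le> norm A * norm B"
proof -
  have entry: "(norm ((A ** B) $ i $ j))\<^sup>2 \<le> (\<Sum>k\<in>UNIV. (norm (A $ i $ k))\<^sup>2) * (\<Sum>k\<in>UNIV. (norm (B $ k $ j))\<^sup>2)"
    for i j
  proof -
    have "norm ((A ** B) $ i $ j) \<le> (\<Sum>k\<in>UNIV. norm (A $ i $ k) * norm (B $ k $ j))"
      by (auto simp: matrix_matrix_mult_def norm_mult intro: order_trans[OF norm_sum])
    also have "\<dots> \<le> L2_set (\<lambda>k. norm (A $ i $ k)) UNIV * L2_set (\<lambda>k. norm (B $ k $ j)) UNIV"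
      using L2_set_mult_ineq[of "\<lambda>k. norm (A $ i $ k)" "\<lambda>k. norm (B $ k $ j)" UNIV] by simp
    finally have "(norm ((A ** B) $ i $ j))\<^sup>2
        \<le> (L2_set (\<lambda>k. norm (A $ i $ k)) UNIV * L2_set (\<lambda>k. norm (B $ k $ j)) UNIV)\<^sup>2"
      by (rule power_mono) simp
    then show ?thesis by (simp add: power_mult_distrib L2_set_def sum_nonneg)
  qed
  have "(norm (A ** B))\<^sup>2 \<le> (\<Sum>i\<in>UNIV. \<Sum>j\<in>UNIV.
      (\<Sum>k\<in>UNIV. (norm (A $ i $ k))\<^sup>2) * (\<Sum>k\<in>UNIV. (norm (B $ k $ j))\<^sup>2))"
    unfolding norm_cmat_power2 by (intro sum_mono entry)
  also have "\<dots> = (norm A)\<^sup>2 * (\<Sum>j\<in>UNIV. \<Sum>k\<in>UNIV. (norm (B $ k $ j))\<^sup>2)"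
    unfolding norm_cmat_power2 by (simp add: sum_product)
  also have "\<dots> = (norm A * norm B)\<^sup>2"
    unfolding power_mult_distrib norm_cmat_power2[of B]
    by (rule arg_cong[where f="\<lambda>x. (norm A)\<^sup>2 * x"]) (rule sum.swap)
  finally show ?thesis by (rule power2_le_imp_le) simp
qed

lemma bounded_bilinear_cmat_mult: "bounded_bilinear ((**) :: 'n::finite cmat \<Rightarrow> 'n cmat \<Rightarrow> 'n cmat)"
proof
  show "\<exists>K. \<forall>A B. norm (A ** B) \<le> norm (A :: 'n cmat) * norm (B :: 'n cmat) * K"
    by (intro exI[of _ 1] allI) (simp add: norm_cmat_mult)
qed (simp_all add: matrix_matrix_mult_def vec_eq_iff sum.distrib algebra_simps scaleR_sum_right)

interpretation cmat_mult: bounded_bilinear "(**) :: 'n::finite cmat \<Rightarrow> 'n cmat \<Rightarrow> 'n cmat"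
  by (rule bounded_bilinear_cmat_mult)

lemma borel_measurable_cmat_mult [measurable (raw)]:
  fixes f g :: "'a \<Rightarrow> 'n::finite cmat"
  assumes "f \<in> borel_measurable M" "g \<in> borel_measurable M"
  shows "(\<lambda>x. f x ** g x) \<in> borel_measurable M"
  using assms
  by (rule borel_measurable_continuous_Pair)
    (rule cmat_mult.continuous_on[OF continuous_on_fst[OF continuous_on_id] continuous_on_snd[OF continuous_on_id]])

lemma integrable_nonneg_bound:
  fixes f g :: "'a \<Rightarrow> real"
  assumes "integrable M g" "f \<in> borel_measurable M"
    and "\<And>x. x \<in> space M \<Longrightarrow> 0 \<le> f x" "\<And>x. x \<in> space M \<Longrightarrow> f x \<le> g x"
  shows "integrable M f"
proof (rule Bochner_Integration.integrable_bound[OF assms(1,2)], rule AE_I2)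
  fix x assume "x \<in> space M"
  then show "norm (f x) \<le> norm (g x)" using assms(3,4)[of x] by simp
qed

text \<open>The sum is at most \<open>card I\<close> times its largest summand, whose p-th power
  occurs on the right. The last term accounts for \<open>0 ^ 0 = 1\<close> when \<open>I\<close> is
  empty.\<close>

lemma sum_power_le:
  fixes f :: "'a \<Rightarrow> real"
  assumes "finite I" "\<And>i. i \<in> I \<Longrightarrow> 0 \<le> f i"
  shows "(\<Sum>i\<in>I. f i) ^ p \<le> real (card I) ^ p * (\<Sum>i\<in>I. f i ^ p) + (if p = 0 then 1 else 0)"
proof (cases "I = {}")
  case False
  define m where "m = Max (f ` I)"
  have m: "f i \<le> m" if "i \<in> I" for i using assms that by (simp add: m_def)
  have "m \<in> f ` I" using assms False by (auto simp: m_def intro!: Max_in)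
  then obtain j where j: "j \<in> I" "m = f j" by auto
  have "(\<Sum>i\<in>I. f i) ^ p \<le> (real (card I) * m) ^ p"
    using sum_bounded_above[of I f m] m assms by (intro power_mono sum_nonneg) auto
  also have "\<dots> \<le> real (card I) ^ p * (\<Sum>i\<in>I. f i ^ p)"
    unfolding power_mult_distrib j(2) using assms j
    by (intro mult_left_mono member_le_sum) auto
  finally show ?thesis by simp
qed (simp add: power_0_left)

lemma add_power_le:
  fixes x y :: real
  assumes "0 \<le> x" "0 \<le> y"
  shows "(x + y) ^ p \<le> 2 ^ p * (x ^ p + y ^ p)"
proof -
  have "(x + y) ^ p \<le> (2 * max x y) ^ p" using assms by (intro power_mono) auto
  also have "\<dots> \<le> 2 ^ p * (x ^ p + y ^ p)"
    unfolding power_mult_distrib using assms by (intro mult_left_mono) (auto simp: max_def)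
  finally show ?thesis .
qed

lemma power_mult_power_le:
  fixes x y :: real
  assumes "0 \<le> x" "0 \<le> y"
  shows "x ^ p * y ^ q \<le> x ^ (p + q) + y ^ (p + q)"
proof -
  have "x ^ p * y ^ q \<le> max x y ^ p * max x y ^ q"
    using assms by (intro mult_mono power_mono) auto
  also have "\<dots> \<le> x ^ (p + q) + y ^ (p + q)"
    unfolding power_add[symmetric] using assms by (auto simp: max_def)
  finally show ?thesis .
qed

text \<open>A second-order Taylor bound. The interval contains the values of (|y + z|^2 - |y|^2) /
  |y|^2 for |z| \<le> |y|, which is where the bound is applied.\<close>

lemma one_plus_power_le:
  "\<exists>K\<ge>0. \<forall>x::real. -1 \<le> x \<longrightarrow> x \<le> 3 \<longrightarrow> (1 + x) ^ m \<le> 1 + real m * x + K * x\<^sup>2"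
proof (induction m)
  case (Suc m)
  then obtain K where K: "0 \<le> K" "\<And>x::real. -1 \<le> x \<Longrightarrow> x \<le> 3 \<Longrightarrow> (1 + x) ^ m \<le> 1 + real m * x + K * x\<^sup>2"
    by blast
  have "(1 + x) ^ Suc m \<le> 1 + real (Suc m) * x + (real m + 4 * K) * x\<^sup>2" if "-1 \<le> x" "x \<le> 3" for x :: real
  proof -
    have "(1 + x) ^ Suc m \<le> (1 + x) * (1 + real m * x + K * x\<^sup>2)"
      using K(2)[OF that] that by (simp add: mult_left_mono)
    also have "\<dots> = 1 + real (Suc m) * x + (real m + K) * x\<^sup>2 + K * x\<^sup>2 * x"
      by (simp add: algebra_simps power2_eq_square)
    also have "K * x\<^sup>2 * x \<le> K * x\<^sup>2 * 3"
      using that K by (intro mult_left_mono) auto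
    finally show ?thesis by (simp add: algebra_simps)
  qed
  then show ?case using K(1) by (intro exI[of _ "real m + 4 * K"]) auto
qed auto

text \<open>A discrete substitute for the Ito formula: the linear term is kept exactly, so that it
  can average to zero, and everything else is quadratic in z or of order |z|^(2m). For |z| \<le> |y|
  this is a Taylor bound for |y|^(2m) (1 + x)^m; otherwise every term is dominated by a multiple of
  |z|^(2m).\<close>

lemma norm_add_power_expansion:
  assumes m: "1 \<le> m"
  shows "\<exists>C\<ge>0. \<forall>y z :: 'a::real_inner. norm (y + z) ^ (2 * m) \<le> norm y ^ (2 * m)
     + 2 * real m * (norm y ^ (2 * m - 2) * (y \<bullet> z))
     + C * (norm y ^ (2 * m - 2) * norm z ^ 2 + norm z ^ (2 * m))"
proof -
  obtain K where K: "0 \<le> K" "\<And>x::real. -1 \<le> x \<Longrightarrow> x \<le> 3 \<Longrightarrow> (1 + x) ^ m \<le> 1 + real m * x + K * x\<^sup>2"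
    using one_plus_power_le by blast
  \<comment> \<open>\<open>real m + 9 * K\<close> serves the case of small z; \<open>4 ^ m\<close>
    bounds the left side and \<open>2 * real m\<close> the linear term when z dominates.\<close>
  define C where "C = real m + 9 * K + 4 ^ m + 2 * real m"
  have m2: "2 * m = (2 * m - 2) + 2" using m by simp
  have "norm (y + z) ^ (2 * m) \<le> norm y ^ (2 * m)
     + 2 * real m * (norm y ^ (2 * m - 2) * (y \<bullet> z))
     + C * (norm y ^ (2 * m - 2) * norm z ^ 2 + norm z ^ (2 * m))" for y z :: 'a
  proof (cases "norm z \<le> norm y \<and> y \<noteq> 0")
    case True
    \<comment> \<open>\<open>b\<close> is the increment of the squared norm. The bound |b| \<le> 3
      |y| |z| yields both x \<le> 3 and x^2 |y|^2 \<le> 9 |z|^2 for the relative increment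
      x.\<close>
    define b where "b = 2 * (y \<bullet> z) + (norm z)\<^sup>2"
    have ypos: "0 < norm y" using True by simp
    have CS: "\<bar>y \<bullet> z\<bar> \<le> norm y * norm z" by (rule Cauchy_Schwarz_ineq2)
    have zz: "(norm z)\<^sup>2 \<le> norm y * norm z"
      using True by (simp add: power2_eq_square mult_right_mono)
    have b: "\<bar>b\<bar> \<le> 3 * (norm y * norm z)"
      using CS zz zero_le_power2[of "norm z"] unfolding b_def by linarith
    have yz: "norm y * norm z \<le> (norm y)\<^sup>2"
      using True by (simp add: power2_eq_square mult_left_mono)
    have sq: "(norm (y + z))\<^sup>2 = (norm y)\<^sup>2 + b"
      by (simp add: b_def power2_norm_eq_inner inner_add inner_commute)
    define x where "x = b / (norm y)\<^sup>2"
    have bx: "b = (norm y)\<^sup>2 * x" using ypos by (simp add: x_def)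
    have x1: "-1 \<le> x"
    proof -
      have "0 \<le> (norm y)\<^sup>2 + b" using sq by (metis zero_le_power2)
      then show ?thesis using ypos unfolding x_def by (simp add: le_divide_eq)
    qed
    have x3: "x \<le> 3" using b yz ypos unfolding x_def by (simp add: divide_le_eq)
    have x2: "x\<^sup>2 * (norm y)\<^sup>2 \<le> 9 * (norm z)\<^sup>2"
    proof -
      have "\<bar>b\<bar>\<^sup>2 \<le> (3 * (norm y * norm z))\<^sup>2" using b by (rule power_mono) simp
      then have "(x\<^sup>2 * (norm y)\<^sup>2) * (norm y)\<^sup>2 \<le> (9 * (norm z)\<^sup>2) * (norm y)\<^sup>2"
        unfolding bx power2_abs by (simp add: power2_eq_square mult_ac)
      then show ?thesis using ypos by (simp add: mult_le_cancel_right)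
    qed
    let ?Y = "norm y ^ (2 * m - 2)"
    have Y2: "norm y ^ (2 * m) = ?Y * (norm y)\<^sup>2" by (subst m2) (simp only: power_add)
    have "norm (y + z) ^ (2 * m) = ((norm y)\<^sup>2 * (1 + x)) ^ m"
      unfolding power_mult sq bx by (simp add: algebra_simps)
    also have "\<dots> = norm y ^ (2 * m) * (1 + x) ^ m" by (simp add: power_mult_distrib power_mult)
    also have "\<dots> \<le> norm y ^ (2 * m) * (1 + real m * x + K * x\<^sup>2)"
      by (intro mult_left_mono K x1 x3) simp
    also have "\<dots> = norm y ^ (2 * m) + real m * ?Y * b + K * ?Y * (x\<^sup>2 * (norm y)\<^sup>2)"
      unfolding Y2 bx by (simp add: algebra_simps)
    also have "K * ?Y * (x\<^sup>2 * (norm y)\<^sup>2) \<le> K * ?Y * (9 * (norm z)\<^sup>2)"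
      using x2 K by (intro mult_left_mono) auto
    also have "real m * ?Y * b = 2 * real m * (?Y * (y \<bullet> z)) + real m * (?Y * (norm z)\<^sup>2)"
      unfolding b_def by (simp add: algebra_simps)
    finally have "norm (y + z) ^ (2 * m) \<le> norm y ^ (2 * m) + 2 * real m * (?Y * (y \<bullet> z))
        + (real m + 9 * K) * (?Y * (norm z)\<^sup>2)" by (simp add: algebra_simps)
    also have "(real m + 9 * K) * (?Y * (norm z)\<^sup>2) \<le> C * (?Y * (norm z)\<^sup>2 + norm z ^ (2 * m))"
      unfolding C_def using K by (intro mult_mono) auto
    finally show ?thesis by simp
  next
    case False
    then have yz: "norm y \<le> norm z" by auto
    let ?Y = "norm y ^ (2 * m - 2)"
    have "norm (y + z) ^ (2 * m) \<le> (2 * norm z) ^ (2 * m)"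
      using norm_triangle_ineq[of y z] yz by (intro power_mono) auto
    also have "\<dots> = 4 ^ m * norm z ^ (2 * m)" by (simp add: power_mult_distrib power_mult)
    finally have 1: "norm (y + z) ^ (2 * m) \<le> 4 ^ m * norm z ^ (2 * m)" .
    have "\<bar>y \<bullet> z\<bar> \<le> norm z * norm z"
      using Cauchy_Schwarz_ineq2[of y z] yz by (meson mult_right_mono norm_ge_zero order_trans)
    then have "?Y * \<bar>y \<bullet> z\<bar> \<le> norm z ^ (2 * m - 2) * (norm z * norm z)"
      using yz by (intro mult_mono power_mono) auto
    also have "\<dots> = norm z ^ (2 * m)"
      using power_add[of "norm z" "2 * m - 2" 2, symmetric] by (simp only: m2[symmetric] power2_eq_square)
    finally have "\<bar>?Y * (y \<bullet> z)\<bar> \<le> norm z ^ (2 * m)" by (simp add: abs_mult)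
    then have "2 * real m * - (?Y * (y \<bullet> z)) \<le> 2 * real m * norm z ^ (2 * m)"
      by (intro mult_left_mono) auto
    then have 2: "0 \<le> 2 * real m * (?Y * (y \<bullet> z)) + 2 * real m * norm z ^ (2 * m)"
      unfolding mult_minus_right by linarith
    have "(4 ^ m + 2 * real m) * norm z ^ (2 * m) \<le> C * (?Y * (norm z)\<^sup>2 + norm z ^ (2 * m))"
      unfolding C_def using K by (intro mult_mono) auto
    moreover have "0 \<le> norm y ^ (2 * m)" by simp
    ultimately show ?thesis using 1 2 unfolding distrib_right[of "4 ^ m"] by linarith
  qed
  moreover have "0 \<le> C" using K by (simp add: C_def)
  ultimately show ?thesis by blast
qed

section \<open>Moments of Brownian increments and of adapted sums\<close>

context brownian_driver
begin

lemma increment_moment_even: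
  assumes "\<xi> \<in> \<beta>" "0 \<le> s" "s < t"
  shows "integrable M (\<lambda>w. (W \<xi> t w - W \<xi> s w) ^ (2 * m))"
    "expectation (\<lambda>w. (W \<xi> t w - W \<xi> s w) ^ (2 * m)) = fact (2 * m) / (2 ^ m * fact m) * (t - s) ^ m"
proof -
  have D: "distributed M lborel (\<lambda>w. W \<xi> t w - W \<xi> s w) (normal_density 0 (sqrt (t - s)))"
    using brownian[OF assms(1)] assms by (auto simp: standard_brownian_motion_def)
  have pos: "0 < sqrt (t - s)" using assms by simp
  note * = normal_moment_even[OF pos, of 0 m]
  show "integrable M (\<lambda>w. (W \<xi> t w - W \<xi> s w) ^ (2 * m))"
    using distributed_integrable[OF D, of "\<lambda>x. x ^ (2 * m)"] has_bochner_integral_iff[THEN iffD1, OF *]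
      normal_density_nonneg by simp
  show "expectation (\<lambda>w. (W \<xi> t w - W \<xi> s w) ^ (2 * m)) = fact (2 * m) / (2 ^ m * fact m) * (t - s) ^ m"
    using distributed_integral[OF D, of "\<lambda>x. x ^ (2 * m)"] has_bochner_integral_iff[THEN iffD1, OF *]
      normal_density_nonneg assms by (simp add: power_divide)
qed

lemma increment_mean_zero:
  assumes "\<xi> \<in> \<beta>" "0 \<le> s" "s < t"
  shows "integrable M (\<lambda>w. W \<xi> t w - W \<xi> s w)" "expectation (\<lambda>w. W \<xi> t w - W \<xi> s w) = 0"
proof -
  have D: "distributed M lborel (\<lambda>w. W \<xi> t w - W \<xi> s w) (normal_density 0 (sqrt (t - s)))"
    using brownian[OF assms(1)] assms by (auto simp: standard_brownian_motion_def)
  have pos: "0 < sqrt (t - s)" using assms by simp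
  note * = normal_moment_odd[OF pos, of 0 0]
  show "integrable M (\<lambda>w. W \<xi> t w - W \<xi> s w)"
    using distributed_integrable[OF D, of "\<lambda>x. x"] has_bochner_integral_iff[THEN iffD1, OF *]
      normal_density_nonneg by simp
  show "expectation (\<lambda>w. W \<xi> t w - W \<xi> s w) = 0"
    using distributed_integral[OF D, of "\<lambda>x. x"] has_bochner_integral_iff[THEN iffD1, OF *]
      normal_density_nonneg by simp
qed

text \<open>Independence of the increment from \<open>F s\<close> takes the place of conditional
  expectation: f is an arbitrary integrable factor known at time s.\<close>

lemma mult_increment:
  assumes \<xi>: "\<xi> \<in> \<beta>" "0 \<le> s" "s < t" and f: "f \<in> borel_measurable (F s)" "integrable M f"
  shows "integrable M (\<lambda>w. f w * (W \<xi> t w - W \<xi> s w))"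
    "expectation (\<lambda>w. f w * (W \<xi> t w - W \<xi> s w)) = 0"
    "integrable M (\<lambda>w. f w * (W \<xi> t w - W \<xi> s w) ^ (2 * m))"
    "expectation (\<lambda>w. f w * (W \<xi> t w - W \<xi> s w) ^ (2 * m)) =
      fact (2 * m) / (2 ^ m * fact m) * (t - s) ^ m * expectation f"
proof -
  have i: "indep_var borel f borel (\<lambda>w. W \<xi> t w - W \<xi> s w)"
    by (rule indep_var_increment[OF \<xi>(2,3,1) f(1)])
  have "indep_var borel ((\<lambda>x. x) \<circ> f) borel ((\<lambda>x. x ^ (2 * m)) \<circ> (\<lambda>w. W \<xi> t w - W \<xi> s w))"
    by (rule indep_var_compose[OF i]) auto
  then have i2: "indep_var borel f borel (\<lambda>w. (W \<xi> t w - W \<xi> s w) ^ (2 * m))"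
    by (simp add: comp_def)
  show "integrable M (\<lambda>w. f w * (W \<xi> t w - W \<xi> s w))"
    by (rule indep_var_integrable[OF i f(2) increment_mean_zero(1)[OF \<xi>]])
  show "expectation (\<lambda>w. f w * (W \<xi> t w - W \<xi> s w)) = 0"
    using indep_var_lebesgue_integral[OF i f(2) increment_mean_zero(1)[OF \<xi>]] increment_mean_zero(2)[OF \<xi>]
    by simp
  show "integrable M (\<lambda>w. f w * (W \<xi> t w - W \<xi> s w) ^ (2 * m))"
    by (rule indep_var_integrable[OF i2 f(2) increment_moment_even(1)[OF \<xi>]])
  show "expectation (\<lambda>w. f w * (W \<xi> t w - W \<xi> s w) ^ (2 * m)) =
      fact (2 * m) / (2 ^ m * fact m) * (t - s) ^ m * expectation f"
    using indep_var_lebesgue_integral[OF i2 f(2) increment_moment_even(1)[OF \<xi>]]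
      increment_moment_even(2)[OF \<xi>] by simp
qed

lemma driving_process_adapted:
  assumes "0 \<le> s" "s \<le> t"
  shows "driving_process \<beta> W s \<in> borel_measurable (F t)"
proof -
  have "(\<lambda>w. \<Sum>\<xi>\<in>\<beta>. W \<xi> s w *\<^sub>R \<xi>) \<in> borel_measurable (F t)"
    using W_adapted[OF _ assms] by (intro borel_measurable_sum borel_measurable_scaleR) auto
  then show ?thesis by (simp add: driving_process_def[abs_def])
qed

text \<open>With the drift matrix as a parameter, one set of moment bounds serves the Euler scheme,
  where \<open>A = half_Xi\<close>, and the plain Ito sums, where \<open>A = 0\<close>.\<close>

definition drift_increment :: "'n cmat \<Rightarrow> real \<Rightarrow> real \<Rightarrow> 'w \<Rightarrow> 'n cmat" where
  "drift_increment A s t w = driving_process \<beta> W t w - driving_process \<beta> W s w + (t - s) *\<^sub>R A"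

lemma drift_increment_eq:
  "drift_increment A s t w = (\<Sum>\<xi>\<in>\<beta>. (W \<xi> t w - W \<xi> s w) *\<^sub>R \<xi>) + (t - s) *\<^sub>R A"
  by (simp add: drift_increment_def driving_process_def sum_subtractf scaleR_left_diff_distrib)

lemma drift_increment_adapted:
  assumes "0 \<le> s" "0 \<le> t" "s \<le> r" "t \<le> r"
  shows "drift_increment A s t \<in> borel_measurable (F r)"
proof -
  have "(\<lambda>w. driving_process \<beta> W t w - driving_process \<beta> W s w + (t - s) *\<^sub>R A) \<in> borel_measurable (F r)"
    using assms by (intro borel_measurable_add borel_measurable_diff driving_process_adapted) auto
  then show ?thesis by (simp add: drift_increment_def[abs_def])
qed

text \<open>Gaussian moments give (t - s)^m, and the drift adds (t - s)^(2m), which is no worse on a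
  bounded time interval. The weight f, known at time s, replaces conditioning on
  \<open>F s\<close>.\<close>

lemma drift_increment_moment:
  "\<exists>C\<ge>0. \<forall>s t f. 0 \<le> s \<longrightarrow> s < t \<longrightarrow> t \<le> T \<longrightarrow> f \<in> borel_measurable (F s) \<longrightarrow> integrable M f \<longrightarrow>
     (\<forall>w\<in>space M. 0 \<le> f w) \<longrightarrow>
     integrable M (\<lambda>w. f w * norm (drift_increment A s t w) ^ (2 * m)) \<and>
     expectation (\<lambda>w. f w * norm (drift_increment A s t w) ^ (2 * m)) \<le> C * (t - s) ^ m * expectation f"
proof -
  define p where "p = 2 * m"
  \<comment> \<open>\<open>a\<close> is the correction of \<open>sum_power_le\<close> for m = 0, and
    \<open>c\<close> is the 2m-th moment of the standard normal law. In \<open>C\<close> the drift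
    enters through (t - s)^(2m) \<le> |T|^m (t - s)^m.\<close>
  define a where "a = (if p = 0 then 1 else 0 :: real)"
  define k where "k = real (card \<beta>) ^ p"
  define c where "c = fact (2 * m) / (2 ^ m * fact m :: real)"
  define C where "C = 2 ^ p * (k * (\<Sum>\<xi>\<in>\<beta>. norm \<xi> ^ p * c) + a + \<bar>T\<bar> ^ m * norm A ^ p)"
  have c: "0 \<le> c" by (simp add: c_def)
  have k: "0 \<le> k" "0 \<le> a" by (auto simp: k_def a_def)
  have "integrable M (\<lambda>w. f w * norm (drift_increment A s t w) ^ (2 * m)) \<and>
     expectation (\<lambda>w. f w * norm (drift_increment A s t w) ^ (2 * m)) \<le> C * (t - s) ^ m * expectation f"
    if st: "0 \<le> s" "s < t" "t \<le> T" and f: "f \<in> borel_measurable (F s)" "integrable M f" "\<forall>w\<in>space M. 0 \<le> f w"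
    for s t f
  proof -
    let ?D = "\<lambda>\<xi> w. W \<xi> t w - W \<xi> s w"
    define g where "g w = 2 ^ p * (k * (\<Sum>\<xi>\<in>\<beta>. norm \<xi> ^ p * (f w * ?D \<xi> w ^ p)) + a * f w
        + ((t - s) ^ p * norm A ^ p) * f w)" for w
    have le: "norm (drift_increment A s t w) ^ p \<le>
        2 ^ p * (k * (\<Sum>\<xi>\<in>\<beta>. norm \<xi> ^ p * ?D \<xi> w ^ p) + a + (t - s) ^ p * norm A ^ p)" for w
    proof -
      have "norm (drift_increment A s t w) \<le> (\<Sum>\<xi>\<in>\<beta>. \<bar>?D \<xi> w\<bar> * norm \<xi>) + (t - s) * norm A"
        unfolding drift_increment_eq using st
        by (intro order_trans[OF norm_triangle_ineq] add_mono order_trans[OF norm_sum] sum_mono) auto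
      then have "norm (drift_increment A s t w) ^ p \<le> ((\<Sum>\<xi>\<in>\<beta>. \<bar>?D \<xi> w\<bar> * norm \<xi>) + (t - s) * norm A) ^ p"
        by (rule power_mono) simp
      also have "\<dots> \<le> 2 ^ p * ((\<Sum>\<xi>\<in>\<beta>. \<bar>?D \<xi> w\<bar> * norm \<xi>) ^ p + ((t - s) * norm A) ^ p)"
        using st by (intro add_power_le sum_nonneg) auto
      also have "(\<Sum>\<xi>\<in>\<beta>. \<bar>?D \<xi> w\<bar> * norm \<xi>) ^ p \<le> k * (\<Sum>\<xi>\<in>\<beta>. (\<bar>?D \<xi> w\<bar> * norm \<xi>) ^ p) + a"
        unfolding k_def a_def by (intro sum_power_le finite_basis) auto
      also have "(\<Sum>\<xi>\<in>\<beta>. (\<bar>?D \<xi> w\<bar> * norm \<xi>) ^ p) = (\<Sum>\<xi>\<in>\<beta>. norm \<xi> ^ p * ?D \<xi> w ^ p)"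
        by (intro sum.cong) (simp_all add: power_mult_distrib p_def power_even_abs mult.commute)
      finally show ?thesis by (simp add: power_mult_distrib)
    qed
    have fg: "f w * norm (drift_increment A s t w) ^ p \<le> g w" if "w \<in> space M" for w
    proof -
      have "f w * norm (drift_increment A s t w) ^ p \<le>
         f w * (2 ^ p * (k * (\<Sum>\<xi>\<in>\<beta>. norm \<xi> ^ p * ?D \<xi> w ^ p) + a + (t - s) ^ p * norm A ^ p))"
        using f(3) that by (intro mult_left_mono le) auto
      also have "\<dots> = g w" unfolding g_def by (simp add: algebra_simps sum_distrib_left)
      finally show ?thesis .
    qed
    have int: "integrable M (\<lambda>w. f w * ?D \<xi> w ^ p)"
      and ex: "expectation (\<lambda>w. f w * ?D \<xi> w ^ p) = c * (t - s) ^ m * expectation f" if "\<xi> \<in> \<beta>" for \<xi>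
      using mult_increment(3,4)[OF that st(1,2) f(1,2), of m] by (auto simp: p_def c_def)
    have ig: "integrable M g" unfolding g_def[abs_def]
      using int f(2) by (intro integrable_mult_right Bochner_Integration.integrable_add
        Bochner_Integration.integrable_sum) auto
    have mg: "(\<lambda>w. f w * norm (drift_increment A s t w) ^ p) \<in> borel_measurable M"
    proof -
      have [measurable]: "drift_increment A s t \<in> borel_measurable M"
        by (rule measurable_F[OF drift_increment_adapted[of s t t A]]) (use st in auto)
      show ?thesis using measurable_F[OF f(1)] by measurable
    qed
    have i: "integrable M (\<lambda>w. f w * norm (drift_increment A s t w) ^ p)"
      by (rule integrable_nonneg_bound[OF ig mg _ fg]) (use f(3) in auto)
    have "expectation (\<lambda>w. f w * norm (drift_increment A s t w) ^ p) \<le> expectation g"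
      by (rule integral_mono[OF i ig fg])
    also have "expectation g = 2 ^ p * (k * (\<Sum>\<xi>\<in>\<beta>. norm \<xi> ^ p * (c * (t - s) ^ m * expectation f)) + a * expectation f
        + ((t - s) ^ p * norm A ^ p) * expectation f)"
      unfolding g_def[abs_def] using int f(2) ex by (simp add: Bochner_Integration.integral_sum)
    also have "\<dots> \<le> C * (t - s) ^ m * expectation f"
    proof -
      have e0: "0 \<le> expectation f" using f(3) by (intro integral_nonneg_AE AE_I2) auto
      have "(t - s) ^ p \<le> \<bar>T\<bar> ^ m * (t - s) ^ m"
        unfolding p_def mult_2 power_add using st by (intro mult_right_mono power_mono) auto
      then have "(t - s) ^ p * norm A ^ p * expectation f \<le> \<bar>T\<bar> ^ m * (t - s) ^ m * norm A ^ p * expectation f"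
        using e0 by (intro mult_right_mono) auto
      moreover have "a * expectation f = a * (t - s) ^ m * expectation f" by (simp add: a_def p_def)
      ultimately have "2 ^ p * (k * (\<Sum>\<xi>\<in>\<beta>. norm \<xi> ^ p * (c * (t - s) ^ m * expectation f)) + a * expectation f
          + ((t - s) ^ p * norm A ^ p) * expectation f) \<le>
        2 ^ p * (k * (\<Sum>\<xi>\<in>\<beta>. norm \<xi> ^ p * (c * (t - s) ^ m * expectation f)) + a * (t - s) ^ m * expectation f
          + \<bar>T\<bar> ^ m * (t - s) ^ m * norm A ^ p * expectation f)"
        by (intro mult_left_mono add_mono order_refl) (use k in auto)
      also have "\<dots> = C * (t - s) ^ m * expectation f"
        unfolding C_def by (simp add: algebra_simps sum_distrib_left)
      finally show ?thesis .
    qed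
    finally show ?thesis using i by (simp add: p_def)
  qed
  moreover have "0 \<le> C" unfolding C_def using c k by (intro mult_nonneg_nonneg add_nonneg_nonneg sum_nonneg) auto
  ultimately show ?thesis by blast
qed

text \<open>The expansion \<open>norm_add_power_expansion\<close> is applied with z = u Z, Z being
  the increment. The Brownian part of the linear term has mean zero, since y and u are known at time
  s. Without this cancellation the error would be of order sqrt(t - s) and could not be summed over
  a grid.\<close>

lemma one_step_moment:
  assumes m: "1 \<le> m"
  shows "\<exists>C\<ge>0. \<forall>s t (y :: 'w \<Rightarrow> 'n cmat) (u :: 'w \<Rightarrow> 'n cmat). 0 \<le> s \<longrightarrow> s < t \<longrightarrow> t \<le> T \<longrightarrow>
     y \<in> borel_measurable (F s) \<longrightarrow> u \<in> borel_measurable (F s) \<longrightarrow>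
     integrable M (\<lambda>w. norm (y w) ^ (2 * m)) \<longrightarrow> integrable M (\<lambda>w. norm (u w) ^ (2 * m)) \<longrightarrow>
     integrable M (\<lambda>w. norm (y w + u w ** drift_increment A s t w) ^ (2 * m)) \<and>
     expectation (\<lambda>w. norm (y w + u w ** drift_increment A s t w) ^ (2 * m)) \<le>
       (1 + C * (t - s)) * expectation (\<lambda>w. norm (y w) ^ (2 * m))
       + C * (t - s) * expectation (\<lambda>w. norm (u w) ^ (2 * m))"
proof -
  obtain K where K: "0 \<le> K" "\<And>y z :: 'n cmat. norm (y + z) ^ (2 * m) \<le> norm y ^ (2 * m)
     + 2 * real m * (norm y ^ (2 * m - 2) * (y \<bullet> z))
     + K * (norm y ^ (2 * m - 2) * norm z ^ 2 + norm z ^ (2 * m))"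
    using norm_add_power_expansion[OF m, where 'a = "'n cmat"] by blast
  obtain C1 where C1: "0 \<le> C1" "\<And>s t f. 0 \<le> s \<Longrightarrow> s < t \<Longrightarrow> t \<le> T \<Longrightarrow> f \<in> borel_measurable (F s) \<Longrightarrow>
      integrable M f \<Longrightarrow> (\<forall>w\<in>space M. 0 \<le> f w) \<Longrightarrow>
     integrable M (\<lambda>w. f w * norm (drift_increment A s t w) ^ (2 * 1)) \<and>
     expectation (\<lambda>w. f w * norm (drift_increment A s t w) ^ (2 * 1)) \<le> C1 * (t - s) ^ 1 * expectation f"
    using drift_increment_moment[of T A 1] by blast
  obtain C2 where C2: "0 \<le> C2" "\<And>s t f. 0 \<le> s \<Longrightarrow> s < t \<Longrightarrow> t \<le> T \<Longrightarrow> f \<in> borel_measurable (F s) \<Longrightarrow>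
      integrable M f \<Longrightarrow> (\<forall>w\<in>space M. 0 \<le> f w) \<Longrightarrow>
     integrable M (\<lambda>w. f w * norm (drift_increment A s t w) ^ (2 * m)) \<and>
     expectation (\<lambda>w. f w * norm (drift_increment A s t w) ^ (2 * m)) \<le> C2 * (t - s) ^ m * expectation f"
    using drift_increment_moment[of T A m] by blast
  \<comment> \<open>\<open>2 * real m * norm A\<close> is the drift part of the linear term; the
    rest is the remainder of the expansion, where (t - s)^m \<le> |T|^(m - 1) (t - s).\<close>
  define C where "C = 2 * real m * norm A + K * (C1 + C2 * \<bar>T\<bar> ^ (m - 1))"
  have "integrable M (\<lambda>w. norm (y w + u w ** drift_increment A s t w) ^ (2 * m)) \<and>
     expectation (\<lambda>w. norm (y w + u w ** drift_increment A s t w) ^ (2 * m)) \<le>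
       (1 + C * (t - s)) * expectation (\<lambda>w. norm (y w) ^ (2 * m))
       + C * (t - s) * expectation (\<lambda>w. norm (u w) ^ (2 * m))"
    if st: "0 \<le> s" "s < t" "t \<le> T" and m_y: "y \<in> borel_measurable (F s)" and m_u: "u \<in> borel_measurable (F s)"
      and i_y: "integrable M (\<lambda>w. norm (y w) ^ (2 * m))" and i_u: "integrable M (\<lambda>w. norm (u w) ^ (2 * m))"
    for s t and y u :: "'w \<Rightarrow> 'n cmat"
  proof -
    let ?Z = "drift_increment A s t" and ?E = "expectation (\<lambda>w. norm (y w) ^ (2 * m))"
      and ?U = "expectation (\<lambda>w. norm (u w) ^ (2 * m))"
    \<comment> \<open>A single weight, known at time s, that dominates both mixed products |y|^(2m -
      2) |u|^2 and |y|^(2m - 1) |u|.\<close>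
    define S where "S w = norm (y w) ^ (2 * m) + norm (u w) ^ (2 * m)" for w
    have mZ [measurable]: "?Z \<in> borel_measurable M"
      by (rule measurable_F[OF drift_increment_adapted[of s t t A]]) (use st in auto)
    have mM [measurable]: "y \<in> borel_measurable M" "u \<in> borel_measurable M"
      using measurable_F m_y m_u by blast+
    have S: "integrable M S" "expectation S = ?E + ?U" "S \<in> borel_measurable (F s)" "\<forall>w\<in>space M. 0 \<le> S w"
      using i_y i_u m_y m_u unfolding S_def[abs_def] by (simp_all, measurable)
    have m_un: "(\<lambda>w. norm (u w) ^ (2 * m)) \<in> borel_measurable (F s)" using m_u by measurable
    note SZ = C1(2)[OF st S(3,1,4), unfolded power_one_right mult_1_right]
    note UZ = C2(2)[OF st m_un i_u]
    have UZ: "integrable M (\<lambda>w. norm (u w) ^ (2 * m) * norm (?Z w) ^ (2 * m))"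
      "expectation (\<lambda>w. norm (u w) ^ (2 * m) * norm (?Z w) ^ (2 * m)) \<le> C2 * (t - s) ^ m * ?U"
      using UZ by auto
    have Ynn: "norm (y w) ^ (2 * m - 2) * norm (u w) ^ 2 \<le> S w" for w
    proof -
      have "2 * m - 2 + 2 = 2 * m" using m by simp
      then show ?thesis
        using power_mult_power_le[of "norm (y w)" "norm (u w)" "2 * m - 2" 2] unfolding S_def by simp
    qed
    have Y1: "norm (y w) ^ (2 * m - 2) * (norm (y w) * norm (u w)) \<le> S w" for w
    proof -
      have "norm (y w) ^ (2 * m - 2) * (norm (y w) * norm (u w)) = norm (y w) ^ (2 * m - 1) * norm (u w) ^ 1"
        using m power_Suc2[of "norm (y w)" "2 * m - 2"] by (simp add: Suc_diff_Suc numeral_2_eq_2)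
      also have "\<dots> \<le> S w"
      proof -
        have "2 * m - 1 + 1 = 2 * m" using m by simp
        then show ?thesis
          using power_mult_power_le[of "norm (y w)" "norm (u w)" "2 * m - 1" 1] unfolding S_def by (simp only:) simp
      qed
      finally show ?thesis .
    qed
    \<comment> \<open>The first-order term is linear in the increment, so it splits along the basis
      elements and along A; the values of \<open>G\<close> are its coefficients, all known at time
      s.\<close>
    define G where "G \<eta> w = norm (y w) ^ (2 * m - 2) * (y w \<bullet> (u w ** \<eta>))" for \<eta> w
    have G_le: "\<bar>G \<eta> w\<bar> \<le> norm \<eta> * S w" for \<eta> w
    proof -
      have "\<bar>y w \<bullet> (u w ** \<eta>)\<bar> \<le> norm (y w) * (norm (u w) * norm \<eta>)"
        by (rule order_trans[OF Cauchy_Schwarz_ineq2]) (intro mult_left_mono norm_cmat_mult norm_ge_zero)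
      then have "\<bar>G \<eta> w\<bar> \<le> norm (y w) ^ (2 * m - 2) * (norm (y w) * (norm (u w) * norm \<eta>))"
        unfolding G_def abs_mult by (simp add: mult_left_mono)
      also have "\<dots> = norm \<eta> * (norm (y w) ^ (2 * m - 2) * (norm (y w) * norm (u w)))" by (simp add: mult_ac)
      also have "\<dots> \<le> norm \<eta> * S w" by (intro mult_left_mono Y1) simp
      finally show ?thesis .
    qed
    have mG: "G \<eta> \<in> borel_measurable (F s)" for \<eta>
      unfolding G_def[abs_def] using m_y m_u by measurable
    have iG: "integrable M (G \<eta>)" for \<eta>
    proof (rule Bochner_Integration.integrable_bound)
      show "integrable M (\<lambda>w. norm \<eta> * S w)" using S(1) by simp
      show "AE w in M. norm (G \<eta> w) \<le> norm (norm \<eta> * S w)"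
        using G_le by (auto intro!: AE_I2 order_trans[OF G_le])
    qed (rule measurable_F[OF mG])
    have GZ: "norm (y w) ^ (2 * m - 2) * (y w \<bullet> (u w ** ?Z w)) =
        (\<Sum>\<xi>\<in>\<beta>. G \<xi> w * (W \<xi> t w - W \<xi> s w)) + (t - s) * G A w" for w
      unfolding G_def drift_increment_eq
      by (simp add: cmat_mult.add_right cmat_mult.sum_right cmat_mult.scaleR_right inner_add_right
          inner_sum_right distrib_left sum_distrib_left mult_ac)
    define H where "H w = norm (y w) ^ (2 * m)
       + 2 * real m * ((\<Sum>\<xi>\<in>\<beta>. G \<xi> w * (W \<xi> t w - W \<xi> s w)) + (t - s) * G A w)
       + K * (S w * norm (?Z w) ^ 2 + norm (u w) ^ (2 * m) * norm (?Z w) ^ (2 * m))" for w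
    have le: "norm (y w + u w ** ?Z w) ^ (2 * m) \<le> H w" for w
    proof -
      let ?z = "u w ** ?Z w"
      have z: "norm ?z \<le> norm (u w) * norm (?Z w)" by (rule norm_cmat_mult)
      have "norm (y w) ^ (2 * m - 2) * norm ?z ^ 2 \<le> norm (y w) ^ (2 * m - 2) * (norm (u w) * norm (?Z w)) ^ 2"
        by (intro mult_left_mono power_mono z) auto
      also have "\<dots> = (norm (y w) ^ (2 * m - 2) * norm (u w) ^ 2) * norm (?Z w) ^ 2"
        by (simp add: power_mult_distrib)
      also have "\<dots> \<le> S w * norm (?Z w) ^ 2" by (intro mult_right_mono Ynn) simp
      finally have 1: "norm (y w) ^ (2 * m - 2) * norm ?z ^ 2 \<le> S w * norm (?Z w) ^ 2" .
      have 2: "norm ?z ^ (2 * m) \<le> norm (u w) ^ (2 * m) * norm (?Z w) ^ (2 * m)"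
        unfolding power_mult_distrib[symmetric] by (intro power_mono z) auto
      have "K * (norm (y w) ^ (2 * m - 2) * norm ?z ^ 2 + norm ?z ^ (2 * m))
         \<le> K * (S w * norm (?Z w) ^ 2 + norm (u w) ^ (2 * m) * norm (?Z w) ^ (2 * m))"
        by (intro mult_left_mono add_mono 1 2 K)
      with K(2)[of "y w" ?z] show ?thesis unfolding H_def GZ by linarith
    qed
    have iW: "integrable M (\<lambda>w. G \<xi> w * (W \<xi> t w - W \<xi> s w))"
      "expectation (\<lambda>w. G \<xi> w * (W \<xi> t w - W \<xi> s w)) = 0" if "\<xi> \<in> \<beta>" for \<xi>
      using mult_increment(1,2)[OF that st(1,2) mG iG] by auto
    have iWs: "integrable M (\<lambda>w. \<Sum>\<xi>\<in>\<beta>. G \<xi> w * (W \<xi> t w - W \<xi> s w))"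
      using iW by (intro Bochner_Integration.integrable_sum) auto
    have iSZ: "integrable M (\<lambda>w. S w * norm (?Z w) ^ 2)"
       "expectation (\<lambda>w. S w * norm (?Z w) ^ 2) \<le> C1 * (t - s) * expectation S"
      using SZ by auto
    have iH: "integrable M H" unfolding H_def[abs_def]
      by (intro integrable_mult_right Bochner_Integration.integrable_add i_y iWs iG iSZ UZ)
    have i: "integrable M (\<lambda>w. norm (y w + u w ** ?Z w) ^ (2 * m))"
    proof (rule integrable_nonneg_bound[OF iH _ _ le])
      show "(\<lambda>w. norm (y w + u w ** ?Z w) ^ (2 * m)) \<in> borel_measurable M" by measurable
    qed auto
    have "expectation (\<lambda>w. norm (y w + u w ** ?Z w) ^ (2 * m)) \<le> expectation H"
      by (rule integral_mono[OF i iH le])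
    also have "expectation H = ?E + 2 * real m * (0 + (t - s) * expectation (G A))
       + K * (expectation (\<lambda>w. S w * norm (?Z w) ^ 2)
          + expectation (\<lambda>w. norm (u w) ^ (2 * m) * norm (?Z w) ^ (2 * m)))"
      unfolding H_def[abs_def] using i_y iWs iG iSZ(1) UZ(1) iW
      by (simp add: Bochner_Integration.integral_sum)
    also have "\<dots> \<le> ?E + 2 * real m * (0 + (t - s) * (norm A * (?E + ?U)))
       + K * (C1 * (t - s) * (?E + ?U) + C2 * \<bar>T\<bar> ^ (m - 1) * (t - s) * (?E + ?U))"
    proof (intro add_mono mult_left_mono order_refl)
      have "expectation (G A) \<le> expectation (\<lambda>w. norm A * S w)"
        using S(1) G_le[of A] by (intro integral_mono iG) (auto dest: abs_le_D1)
      then show "expectation (G A) \<le> norm A * (?E + ?U)" using S(2) by simp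
      show "expectation (\<lambda>w. S w * norm (?Z w) ^ 2) \<le> C1 * (t - s) * (?E + ?U)"
        using iSZ(2) S(2) by simp
      have "(t - s) ^ m = (t - s) ^ (m - 1) * (t - s)"
        using m power_Suc2[of "t - s" "m - 1"] by simp
      also have "\<dots> \<le> \<bar>T\<bar> ^ (m - 1) * (t - s)"
        using st by (intro mult_right_mono power_mono) auto
      finally have "C2 * (t - s) ^ m * ?U \<le> C2 * (\<bar>T\<bar> ^ (m - 1) * (t - s)) * (?E + ?U)"
        using C2(1) st by (intro mult_mono mult_left_mono) (auto intro!: integral_nonneg_AE)
      with UZ(2) show "expectation (\<lambda>w. norm (u w) ^ (2 * m) * norm (?Z w) ^ (2 * m))
          \<le> C2 * \<bar>T\<bar> ^ (m - 1) * (t - s) * (?E + ?U)" by (simp add: mult.assoc)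
    qed (use K st in auto)
    also have "\<dots> = (1 + C * (t - s)) * ?E + C * (t - s) * ?U"
      unfolding C_def by (simp add: algebra_simps)
    finally show ?thesis using i by blast
  qed
  moreover have "0 \<le> C" unfolding C_def using K C1 C2 by auto
  ultimately show ?thesis by blast
qed

lemma ito_sum_adapted:
  fixes u :: "nat \<Rightarrow> 'w \<Rightarrow> 'n cmat"
  assumes g: "0 \<le> g 0" "\<And>i. i < n \<Longrightarrow> g i < g (Suc i)"
    and u: "\<And>i. i < n \<Longrightarrow> u i \<in> borel_measurable (F (g i))" and i: "i \<le> n"
  shows "(\<lambda>w. \<Sum>j<i. u j w ** drift_increment A (g j) (g (Suc j)) w) \<in> borel_measurable (F (g i))"
proof (rule borel_measurable_sum)
  fix j assume j: "j \<in> {..<i}"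
  have pos: "0 \<le> g k" if "k \<le> n" for k
    using g(1) step_mono[of n g 0 k, OF g(2)] that by (cases "k = 0") auto
  have le: "g k \<le> g i" if "k \<le> i" for k
    using step_mono[of n g k i, OF g(2)] that i by (cases "k = i") auto
  have "u j \<in> borel_measurable (F (g i))"
    using measurable_F_mono[OF u le] j i by auto
  moreover have "drift_increment A (g j) (g (Suc j)) \<in> borel_measurable (F (g i))"
    using pos le j i by (intro drift_increment_adapted) auto
  ultimately show "(\<lambda>w. u j w ** drift_increment A (g j) (g (Suc j)) w) \<in> borel_measurable (F (g i))"
    by (rule borel_measurable_cmat_mult)
qed

text \<open>The constant does not depend on the grid; the term with \<open>c\<close> is absorbed by a discrete
  Gronwall argument.\<close>

lemma ito_sum_moment:
  assumes m: "1 \<le> m" and c: "0 \<le> c"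
  shows "\<exists>C\<ge>0. \<forall>g n (u :: nat \<Rightarrow> 'w \<Rightarrow> 'n cmat) \<phi>. 0 \<le> g 0 \<longrightarrow> g n \<le> T \<longrightarrow> (\<forall>i<n. g i < g (Suc i)) \<longrightarrow>
     (\<forall>i<n. u i \<in> borel_measurable (F (g i))) \<longrightarrow> (\<forall>i<n. integrable M (\<phi> i)) \<longrightarrow>
     (\<forall>i<n. \<forall>w\<in>space M. 0 \<le> \<phi> i w \<and> norm (u i w) ^ (2 * m) \<le>
        c * norm (\<Sum>j<i. u j w ** drift_increment A (g j) (g (Suc j)) w) ^ (2 * m) + \<phi> i w) \<longrightarrow>
     integrable M (\<lambda>w. norm (\<Sum>j<n. u j w ** drift_increment A (g j) (g (Suc j)) w) ^ (2 * m)) \<and>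
     expectation (\<lambda>w. norm (\<Sum>j<n. u j w ** drift_increment A (g j) (g (Suc j)) w) ^ (2 * m))
       \<le> C * (\<Sum>j<n. (g (Suc j) - g j) * expectation (\<phi> j))"
proof -
  obtain C where C: "0 \<le> C" "\<And>s t (y :: 'w \<Rightarrow> 'n cmat) (u :: 'w \<Rightarrow> 'n cmat). 0 \<le> s \<Longrightarrow> s < t \<Longrightarrow> t \<le> T \<Longrightarrow>
     y \<in> borel_measurable (F s) \<Longrightarrow> u \<in> borel_measurable (F s) \<Longrightarrow>
     integrable M (\<lambda>w. norm (y w) ^ (2 * m)) \<Longrightarrow> integrable M (\<lambda>w. norm (u w) ^ (2 * m)) \<Longrightarrow>
     integrable M (\<lambda>w. norm (y w + u w ** drift_increment A s t w) ^ (2 * m)) \<and>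
     expectation (\<lambda>w. norm (y w + u w ** drift_increment A s t w) ^ (2 * m)) \<le>
       (1 + C * (t - s)) * expectation (\<lambda>w. norm (y w) ^ (2 * m))
       + C * (t - s) * expectation (\<lambda>w. norm (u w) ^ (2 * m))"
    using one_step_moment[OF m, of T A] by blast
  \<comment> \<open>Inserting E|u|^(2m) \<le> c E|Y|^(2m) + E \<phi> into the one-step bound turns
    the growth factor 1 + C d into 1 + C (1 + c) d.\<close>
  define C' where "C' = C * (1 + c)"
  have C': "0 \<le> C'" using C c by (simp add: C'_def)
  have "integrable M (\<lambda>w. norm (\<Sum>j<n. u j w ** drift_increment A (g j) (g (Suc j)) w) ^ (2 * m)) \<and>
     expectation (\<lambda>w. norm (\<Sum>j<n. u j w ** drift_increment A (g j) (g (Suc j)) w) ^ (2 * m))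
       \<le> exp (C' * \<bar>T\<bar>) * C * (\<Sum>j<n. (g (Suc j) - g j) * expectation (\<phi> j))"
    if g: "0 \<le> g 0" "g n \<le> T" "\<And>i. i < n \<Longrightarrow> g i < g (Suc i)"
      and u: "\<And>i. i < n \<Longrightarrow> u i \<in> borel_measurable (F (g i))"
      and \<phi>: "\<And>i. i < n \<Longrightarrow> integrable M (\<phi> i)" "\<And>i w. i < n \<Longrightarrow> w \<in> space M \<Longrightarrow> 0 \<le> \<phi> i w"
      and le: "\<And>i w. i < n \<Longrightarrow> w \<in> space M \<Longrightarrow> norm (u i w) ^ (2 * m) \<le>
        c * norm (\<Sum>j<i. u j w ** drift_increment A (g j) (g (Suc j)) w) ^ (2 * m) + \<phi> i w"
    for g :: "nat \<Rightarrow> real" and n \<phi> and u :: "nat \<Rightarrow> 'w \<Rightarrow> 'n cmat"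
  proof -
    define Y where "Y i w = (\<Sum>j<i. u j w ** drift_increment A (g j) (g (Suc j)) w)" for i w
    define e where "e i = expectation (\<lambda>w. norm (Y i w) ^ (2 * m))" for i
    define f where "f i = (\<Sum>j<i. (g (Suc j) - g j) * expectation (\<phi> j))" for i
    have e0: "0 \<le> e i" for i unfolding e_def by (intro integral_nonneg_AE) auto
    have E\<phi>: "0 \<le> expectation (\<phi> i)" if "i < n" for i
      using \<phi>(2)[OF that] by (intro integral_nonneg_AE AE_I2) auto
    have f0: "0 \<le> f i" if "i \<le> n" for i
      unfolding f_def using that g(3) E\<phi> by (intro sum_nonneg mult_nonneg_nonneg) (auto simp: less_imp_le)
    have gpos: "0 \<le> g i" if "i \<le> n" for i
      using g(1) step_mono[of n g 0 i, OF g(3)] that by (cases "i = 0") auto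
    have gT: "g i \<le> T" if "i \<le> n" for i
      using g(2) step_mono[of n g i n, OF g(3)] that by (cases "i = n") force+
    \<comment> \<open>The factor exp(C' g i) follows the grid time, so a step of length d multiplies
      it by exactly exp(C' d), which dominates 1 + C' d.\<close>
    have "i \<le> n \<longrightarrow> integrable M (\<lambda>w. norm (Y i w) ^ (2 * m)) \<and> e i \<le> exp (C' * g i) * C * f i" for i
    proof (induction i)
      case 0
      show ?case using m by (simp add: Y_def e_def f_def power_0_left)
    next
      case (Suc i)
      show ?case
      proof
        assume i: "Suc i \<le> n"
        define d where "d = g (Suc i) - g i"
        have d: "0 < d" using g(3)[of i] i by (simp add: d_def)
        have iY: "integrable M (\<lambda>w. norm (Y i w) ^ (2 * m))" and ei: "e i \<le> exp (C' * g i) * C * f i"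
          using Suc i by auto
        have mY: "Y i \<in> borel_measurable (F (g i))"
          unfolding Y_def[abs_def] by (rule ito_sum_adapted[where n=n]) (use g u i in auto)
        have mu: "u i \<in> borel_measurable (F (g i))" using u i by auto
        have ib: "integrable M (\<lambda>w. c * norm (Y i w) ^ (2 * m) + \<phi> i w)" using iY \<phi>(1)[of i] i by simp
        have ule: "norm (u i w) ^ (2 * m) \<le> c * norm (Y i w) ^ (2 * m) + \<phi> i w" if "w \<in> space M" for w
          using le[of i w] i that by (simp add: Y_def)
        have iu: "integrable M (\<lambda>w. norm (u i w) ^ (2 * m))"
        proof (rule integrable_nonneg_bound[OF ib _ _ ule])
          show "(\<lambda>w. norm (u i w) ^ (2 * m)) \<in> borel_measurable M"
            using measurable_F[OF mu] by measurable
        qed auto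
        have "expectation (\<lambda>w. norm (u i w) ^ (2 * m)) \<le> expectation (\<lambda>w. c * norm (Y i w) ^ (2 * m) + \<phi> i w)"
          by (rule integral_mono[OF iu ib ule])
        also have "\<dots> = c * e i + expectation (\<phi> i)" using iY \<phi>(1)[of i] i by (simp add: e_def)
        finally have Eu: "expectation (\<lambda>w. norm (u i w) ^ (2 * m)) \<le> c * e i + expectation (\<phi> i)" .
        have Ys: "Y (Suc i) = (\<lambda>w. Y i w + u i w ** drift_increment A (g i) (g (Suc i)) w)"
          by (simp add: Y_def fun_eq_iff)
        note step = C(2)[OF gpos[of i] g(3)[of i] gT[of "Suc i"] mY mu iY iu]
        have "e (Suc i) \<le> (1 + C * d) * e i + C * d * expectation (\<lambda>w. norm (u i w) ^ (2 * m))"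
          using step i unfolding e_def d_def Ys by simp
        also have "\<dots> \<le> (1 + C * d) * e i + C * d * (c * e i + expectation (\<phi> i))"
          using Eu C d by (intro add_left_mono mult_left_mono) auto
        also have "\<dots> = (1 + C' * d) * e i + C * (d * expectation (\<phi> i))"
          by (simp add: C'_def algebra_simps)
        also have "\<dots> \<le> exp (C' * d) * (exp (C' * g i) * C * f i) + (exp (C' * g (Suc i)) * C) * (d * expectation (\<phi> i))"
        proof (intro add_mono mult_mono ei)
          show "1 + C' * d \<le> exp (C' * d)" by (rule exp_ge_add_one_self)
          have "1 \<le> exp (C' * g (Suc i))" using C' gpos[OF i] by simp
          then show "C \<le> exp (C' * g (Suc i)) * C" using C mult_right_mono[of 1 _ C] by simp
        qed (use C d e0 E\<phi>[of i] i in auto)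
        also have "exp (C' * d) * (exp (C' * g i) * C * f i) = exp (C' * g (Suc i)) * C * f i"
          unfolding d_def by (simp add: exp_add[symmetric] algebra_simps mult_exp_exp flip: mult.assoc)
        also have "exp (C' * g (Suc i)) * C * f i + (exp (C' * g (Suc i)) * C) * (d * expectation (\<phi> i)) =
            exp (C' * g (Suc i)) * C * f (Suc i)"
          by (simp add: f_def d_def algebra_simps)
        finally show "integrable M (\<lambda>w. norm (Y (Suc i) w) ^ (2 * m)) \<and> e (Suc i) \<le> exp (C' * g (Suc i)) * C * f (Suc i)"
          using step i unfolding Ys by auto
      qed
    qed
    from this[of n] have "integrable M (\<lambda>w. norm (Y n w) ^ (2 * m))" "e n \<le> exp (C' * g n) * C * f n" by auto
    moreover have "exp (C' * g n) * C * f n \<le> exp (C' * \<bar>T\<bar>) * C * f n"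
      using C' g(2) C f0[of n] by (intro mult_right_mono) (auto intro!: mult_left_mono)
    ultimately show ?thesis by (auto simp: Y_def e_def f_def)
  qed
  moreover have "0 \<le> exp (C' * \<bar>T\<bar>) * C" using C by simp
  ultimately show ?thesis by (intro exI[of _ "exp (C' * \<bar>T\<bar>) * C"]) blast
qed

end

text \<open>Events about suprema over uncountably many times are not known to be measurable, since the
  paths are continuous only almost everywhere; hence an upper bound on the outer probability.\<close>

definition outer_prob_le :: "'w measure \<Rightarrow> ('w \<Rightarrow> bool) \<Rightarrow> real \<Rightarrow> bool" where
  "outer_prob_le M P p \<longleftrightarrow> (\<exists>E\<in>sets M. {w\<in>space M. P w} \<subseteq> E \<and> measure M E \<le> p)"

lemma outer_prob_leI:
  assumes "E \<in> sets M" "\<And>w. w \<in> space M \<Longrightarrow> P w \<Longrightarrow> w \<in> E" "measure M E \<le> p"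
  shows "outer_prob_le M P p"
  using assms unfolding outer_prob_le_def by blast

lemma outer_prob_le_mono:
  assumes "outer_prob_le M P p" "\<And>w. w \<in> space M \<Longrightarrow> Q w \<Longrightarrow> P w" "p \<le> q"
  shows "outer_prob_le M Q q"
proof -
  obtain E where "E \<in> sets M" "{w\<in>space M. P w} \<subseteq> E" "measure M E \<le> p"
    using assms(1) unfolding outer_prob_le_def by blast
  then show ?thesis using assms(2,3) by (intro outer_prob_leI[of E]) auto
qed

context prob_space
begin

lemma outer_prob_le_disj:
  assumes "outer_prob_le M P p" "outer_prob_le M Q q"
  shows "outer_prob_le M (\<lambda>w. P w \<or> Q w) (p + q)"
proof -
  obtain E where E: "E \<in> sets M" "{w\<in>space M. P w} \<subseteq> E" "prob E \<le> p"
    using assms(1) unfolding outer_prob_le_def by blast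
  obtain E' where E': "E' \<in> sets M" "{w\<in>space M. Q w} \<subseteq> E'" "prob E' \<le> q"
    using assms(2) unfolding outer_prob_le_def by blast
  have "prob (E \<union> E') \<le> p + q"
    using measure_Un_le[OF E(1) E'(1)] E(3) E'(3) by linarith
  then show ?thesis using E E' by (intro outer_prob_leI[of "E \<union> E'"]) auto
qed

lemma outer_prob_le_AE:
  assumes "AE w in M. \<not> P w" "0 \<le> p"
  shows "outer_prob_le M P p"
proof -
  obtain N where "{w\<in>space M. \<not> \<not> P w} \<subseteq> N" "N \<in> null_sets M"
    using assms(1) unfolding eventually_ae_filter by blast
  then show ?thesis using assms(2) by (intro outer_prob_leI[of N]) (auto simp: measure_eq_0_null_sets)
qed

lemma outer_prob_le_Bex:
  assumes "finite I" "\<And>i. i \<in> I \<Longrightarrow> outer_prob_le M (P i) p"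
  shows "outer_prob_le M (\<lambda>w. \<exists>i\<in>I. P i w) (real (card I) * p)"
  using assms
proof (induction I)
  case empty
  then show ?case by (intro outer_prob_le_AE) auto
next
  case (insert i I)
  have "outer_prob_le M (\<lambda>w. P i w \<or> (\<exists>i\<in>I. P i w)) (p + real (card I) * p)"
    using insert by (intro outer_prob_le_disj) auto
  then show ?case
    by (rule outer_prob_le_mono) (use insert in \<open>auto simp: algebra_simps\<close>)
qed

text \<open>Continuity from below needs increasing measurable sets, but the covers
  \<open>E n\<close> need not increase. Their tail intersections \<open>A n\<close> do; they still
  contain the n-th event because the events increase, and they are no larger than
  \<open>E n\<close>.\<close>

lemma outer_prob_le_Ex_incseq:
  assumes P: "\<And>n. outer_prob_le M (P n) p" and mono: "\<And>n w. w \<in> space M \<Longrightarrow> P n w \<Longrightarrow> P (Suc n) w"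
  shows "outer_prob_le M (\<lambda>w. \<exists>n. P n w) p"
proof -
  obtain E where E: "\<And>n. E n \<in> sets M" "\<And>n. {w\<in>space M. P n w} \<subseteq> E n" "\<And>n. prob (E n) \<le> p"
    using P unfolding outer_prob_le_def by metis
  define A where "A n = (\<Inter>k. E (n + k))" for n
  have A: "A n \<in> sets M" for n unfolding A_def using E(1) by auto
  have PA: "w \<in> A n" if "w \<in> space M" "P n w" for n w
  proof -
    have "P (n + k) w" for k by (induction k) (use that mono in auto)
    then show ?thesis using E(2) that(1) by (auto simp: A_def)
  qed
  have inc: "incseq A"
  proof (rule incseq_SucI)
    fix n show "A n \<le> A (Suc n)"
      unfolding A_def by (auto simp: le_fun_def) (metis add_Suc_right)
  qed
  have "prob (A n) \<le> p" for n
  proof -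
    have "A n \<subseteq> E n" unfolding A_def using INT_lower[of 0 UNIV "\<lambda>k. E (n + k)"] by simp
    then have "prob (A n) \<le> prob (E n)" using E(1) by (intro finite_measure_mono) auto
    then show ?thesis using E(3)[of n] by linarith
  qed
  moreover have "(\<lambda>n. prob (A n)) \<longlonglongrightarrow> prob (\<Union>n. A n)"
    using A inc by (intro finite_Lim_measure_incseq) auto
  ultimately have "prob (\<Union>n. A n) \<le> p" by (intro LIMSEQ_le_const2) auto
  then show ?thesis using A PA by (intro outer_prob_leI[of "\<Union>n. A n"]) auto
qed

end

context brownian_driver
begin

text \<open>Setting the integrand to 0 from the first time at which \<open>Y\<close> exceeds \<open>\<epsilon>\<close> or some \<open>a i\<close> fails
  freezes the sum there, so on the event in question the final value of the stopped sum exceeds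
  \<open>\<epsilon>\<close>, and the moment bound at the final time suffices.\<close>

lemma ito_sum_maximal:
  assumes m: "1 \<le> m" and c: "0 \<le> c"
  shows "\<exists>C\<ge>0. \<forall>g n (u :: nat \<Rightarrow> 'w \<Rightarrow> 'n cmat) \<phi> a \<epsilon>. 0 \<le> g 0 \<longrightarrow> g n \<le> T \<longrightarrow> (\<forall>i<n. g i < g (Suc i)) \<longrightarrow>
     (\<forall>i<n. u i \<in> borel_measurable (F (g i))) \<longrightarrow> (\<forall>i<n. integrable M (\<phi> i)) \<longrightarrow>
     (\<forall>i<n. {w\<in>space M. a i w} \<in> sets (F (g i))) \<longrightarrow> 0 < \<epsilon> \<longrightarrow>
     (\<forall>i<n. \<forall>w\<in>space M. 0 \<le> \<phi> i w \<and> ((\<forall>j\<le>i. a j w) \<longrightarrow> norm (u i w) ^ (2 * m) \<le>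
        c * norm (\<Sum>j<i. u j w ** drift_increment A (g j) (g (Suc j)) w) ^ (2 * m) + \<phi> i w)) \<longrightarrow>
     outer_prob_le M (\<lambda>w. (\<forall>i<n. a i w) \<and>
         (\<exists>i\<le>n. \<epsilon> < norm (\<Sum>j<i. u j w ** drift_increment A (g j) (g (Suc j)) w)))
       (C * (\<Sum>j<n. (g (Suc j) - g j) * expectation (\<phi> j)) / \<epsilon> ^ (2 * m))"
proof -
  obtain C where C: "0 \<le> C" "\<And>g n (u :: nat \<Rightarrow> 'w \<Rightarrow> 'n cmat) \<phi>. 0 \<le> g 0 \<Longrightarrow> g n \<le> T \<Longrightarrow> (\<forall>i<n. g i < g (Suc i)) \<Longrightarrow>
     (\<forall>i<n. u i \<in> borel_measurable (F (g i))) \<Longrightarrow> (\<forall>i<n. integrable M (\<phi> i)) \<Longrightarrow>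
     (\<forall>i<n. \<forall>w\<in>space M. 0 \<le> \<phi> i w \<and> norm (u i w) ^ (2 * m) \<le>
        c * norm (\<Sum>j<i. u j w ** drift_increment A (g j) (g (Suc j)) w) ^ (2 * m) + \<phi> i w) \<Longrightarrow>
     integrable M (\<lambda>w. norm (\<Sum>j<n. u j w ** drift_increment A (g j) (g (Suc j)) w) ^ (2 * m)) \<and>
     expectation (\<lambda>w. norm (\<Sum>j<n. u j w ** drift_increment A (g j) (g (Suc j)) w) ^ (2 * m))
       \<le> C * (\<Sum>j<n. (g (Suc j) - g j) * expectation (\<phi> j))"
    using ito_sum_moment[OF m c, of T A] by blast
  have "outer_prob_le M (\<lambda>w. (\<forall>i<n. a i w) \<and>
         (\<exists>i\<le>n. \<epsilon> < norm (\<Sum>j<i. u j w ** drift_increment A (g j) (g (Suc j)) w)))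
       (C * (\<Sum>j<n. (g (Suc j) - g j) * expectation (\<phi> j)) / \<epsilon> ^ (2 * m))"
    if g: "0 \<le> g 0" "g n \<le> T" "\<And>i. i < n \<Longrightarrow> g i < g (Suc i)"
      and u: "\<And>i. i < n \<Longrightarrow> u i \<in> borel_measurable (F (g i))"
      and \<phi>: "\<And>i. i < n \<Longrightarrow> integrable M (\<phi> i)"
      and a: "\<And>i. i < n \<Longrightarrow> {w\<in>space M. a i w} \<in> sets (F (g i))" and \<epsilon>: "0 < \<epsilon>"
      and \<phi>0: "\<And>i w. i < n \<Longrightarrow> w \<in> space M \<Longrightarrow> 0 \<le> \<phi> i w"
      and le: "\<And>i w. i < n \<Longrightarrow> w \<in> space M \<Longrightarrow> (\<And>j. j \<le> i \<Longrightarrow> a j w) \<Longrightarrow> norm (u i w) ^ (2 * m) \<le>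
        c * norm (\<Sum>j<i. u j w ** drift_increment A (g j) (g (Suc j)) w) ^ (2 * m) + \<phi> i w"
    for g :: "nat \<Rightarrow> real" and n \<phi> a \<epsilon> and u :: "nat \<Rightarrow> 'w \<Rightarrow> 'n cmat"
  proof -
    define Y where "Y i w = (\<Sum>j<i. u j w ** drift_increment A (g j) (g (Suc j)) w)" for i w
    \<comment> \<open>Whether i is alive is known at time \<open>g i\<close>, so the modified
      integrand \<open>v\<close> stays adapted.\<close>
    define alive where "alive i w \<longleftrightarrow> (\<forall>j\<in>{..i}. a j w \<and> norm (Y j w) \<le> \<epsilon>)" for i w
    define v where "v i w = (if alive i w then u i w else 0)" for i w
    define Y' where "Y' i w = (\<Sum>j<i. v j w ** drift_increment A (g j) (g (Suc j)) w)" for i w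
    have gle: "g j \<le> g i" if "j \<le> i" "i \<le> n" for i j
      using step_mono[of n g j i, OF g(3)] that by (cases "j = i") force+
    have mY: "Y i \<in> borel_measurable (F (g i))" if "i \<le> n" for i
      unfolding Y_def[abs_def] by (rule ito_sum_adapted[where n=n]) (use g u that in auto)
    have m_alive: "{w\<in>space M. alive i w} \<in> sets (F (g i))" if i: "i < n" for i
    proof -
      have "{w\<in>space (F (g i)). a j w \<and> norm (Y j w) \<le> \<epsilon>} \<in> sets (F (g i))" if "j \<in> {..i}" for j
      proof (rule sets.sets_Collect_conj)
        show "{w\<in>space (F (g i)). a j w} \<in> sets (F (g i))"
          using a[of j] sets_F_mono[OF gle[of j i]] that i by auto
        have [measurable]: "Y j \<in> borel_measurable (F (g i))"
          by (rule measurable_F_mono[OF mY gle]) (use that i in auto)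
        show "{w\<in>space (F (g i)). norm (Y j w) \<le> \<epsilon>} \<in> sets (F (g i))" by measurable
      qed
      then have "{w\<in>space (F (g i)). \<forall>j\<in>{..i}. a j w \<and> norm (Y j w) \<le> \<epsilon>} \<in> sets (F (g i))"
        by (intro sets.sets_Collect_finite_All) auto
      then show ?thesis by (simp add: alive_def)
    qed
    have mv: "v i \<in> borel_measurable (F (g i))" if "i < n" for i
      unfolding v_def[abs_def] using m_alive[OF that] u[OF that]
      by (intro measurable_If) auto
    have Y'Y: "Y' i w = Y i w" if "\<And>j. j < i \<Longrightarrow> alive j w" for i w
      unfolding Y_def Y'_def v_def using that by (intro sum.cong) auto
    have bound: "0 \<le> \<phi> i w \<and> norm (v i w) ^ (2 * m) \<le> c * norm (Y' i w) ^ (2 * m) + \<phi> i w"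
      if i: "i < n" and w: "w \<in> space M" for i w
    proof (cases "alive i w")
      case True
      then have "alive j w" if "j \<le> i" for j using that by (auto simp: alive_def)
      then have "Y' i w = Y i w" by (intro Y'Y) auto
      moreover have "norm (u i w) ^ (2 * m) \<le> c * norm (Y i w) ^ (2 * m) + \<phi> i w"
        unfolding Y_def by (rule le[OF i w]) (use True in \<open>auto simp: alive_def\<close>)
      ultimately show ?thesis using True \<phi>0[OF i w] by (simp add: v_def)
    next
      case False
      then show ?thesis using \<phi>0[OF i w] c m by (simp add: v_def power_0_left)
    qed
    have MM: "integrable M (\<lambda>w. norm (Y' n w) ^ (2 * m))"
      "expectation (\<lambda>w. norm (Y' n w) ^ (2 * m)) \<le> C * (\<Sum>j<n. (g (Suc j) - g j) * expectation (\<phi> j))"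
      using C(2)[of g n v \<phi>] g mv \<phi> bound unfolding Y'_def by auto
    show ?thesis
    proof (rule outer_prob_leI)
      let ?E = "{w\<in>space M. \<epsilon> ^ (2 * m) \<le> norm (Y' n w) ^ (2 * m)}"
      have "(\<lambda>w. norm (Y' n w) ^ (2 * m)) \<in> borel_measurable M" using MM(1) by auto
      then show "?E \<in> sets M" by measurable
      have "prob ?E \<le> expectation (\<lambda>w. norm (Y' n w) ^ (2 * m)) / \<epsilon> ^ (2 * m)"
        using \<epsilon> by (intro integral_Markov_inequality_measure[OF MM(1), where A="{}"]) auto
      also have "\<dots> \<le> C * (\<Sum>j<n. (g (Suc j) - g j) * expectation (\<phi> j)) / \<epsilon> ^ (2 * m)"
        using MM(2) \<epsilon> by (intro divide_right_mono) auto
      finally show "prob ?E \<le> C * (\<Sum>j<n. (g (Suc j) - g j) * expectation (\<phi> j)) / \<epsilon> ^ (2 * m)" .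
      fix w assume w: "w \<in> space M" and ev: "(\<forall>i<n. a i w) \<and>
         (\<exists>i\<le>n. \<epsilon> < norm (\<Sum>j<i. u j w ** drift_increment A (g j) (g (Suc j)) w))"
      define i where "i = (LEAST i. \<epsilon> < norm (Y i w))"
      obtain k where k: "k \<le> n" "\<epsilon> < norm (Y k w)" using ev by (auto simp: Y_def)
      have i: "\<epsilon> < norm (Y i w)" "i \<le> k" and min: "\<And>j. j < i \<Longrightarrow> norm (Y j w) \<le> \<epsilon>"
        unfolding i_def using k(2) by (auto intro: LeastI Least_le dest: not_less_Least)
      have "Y' i w = Y i w"
      proof (rule Y'Y)
        fix j assume "j < i"
        then show "alive j w" using ev min i(2) k(1) by (auto simp: alive_def)
      qed
      moreover have "Y' n w = Y' i w"
      proof -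
        have "\<not> alive j w" if "i \<le> j" for j
        proof
          assume "alive j w"
          then have "norm (Y i w) \<le> \<epsilon>" using that by (auto simp: alive_def)
          then show False using i(1) by simp
        qed
        then have "v j w = 0" if "i \<le> j" for j using that by (simp add: v_def)
        then have "(\<Sum>j\<in>{i..<n}. v j w ** drift_increment A (g j) (g (Suc j)) w) = 0"
          by (intro sum.neutral) (auto simp: cmat_mult.zero_left)
        moreover have "{..<n} = {..<i} \<union> {i..<n}" using i(2) k(1) by auto
        ultimately show ?thesis
          unfolding Y'_def by (simp add: sum.union_disjoint ivl_disj_int)
      qed
      ultimately have "\<epsilon> < norm (Y' n w)" using i(1) by simp
      then have "\<epsilon> ^ (2 * m) \<le> norm (Y' n w) ^ (2 * m)" using \<epsilon> by (intro power_mono) auto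
      then show "w \<in> ?E" using w by simp
    qed
  qed
  then show ?thesis using C(1) by (intro exI[of _ C]) blast
qed

end

section \<open>Riemann sums and the Ito integral\<close>

text \<open>Nested finite sets of times with dense union. Nesting makes suprema over them limits of
  increasing events, and including level N in a grid forces its mesh below
  \<open>T / 2 ^ N\<close>.\<close>

definition dyadics :: "real \<Rightarrow> nat \<Rightarrow> real set" where
  "dyadics T N = (\<lambda>j. T * real j / 2 ^ N) ` {..2 ^ N}"

lemma dyadics:
  assumes "0 < T"
  shows "finite (dyadics T N)" "0 \<in> dyadics T N" "T \<in> dyadics T N" "dyadics T N \<subseteq> {0..T}"
    "dyadics T N \<subseteq> dyadics T (Suc N)"
proof -
  show "finite (dyadics T N)" by (simp add: dyadics_def)
  show "0 \<in> dyadics T N" unfolding dyadics_def by (rule image_eqI[of _ _ 0]) auto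
  show "T \<in> dyadics T N" unfolding dyadics_def by (rule image_eqI[of _ _ "2 ^ N"]) auto
  show "dyadics T N \<subseteq> {0..T}"
    unfolding dyadics_def using assms
    by (auto simp: field_simps of_nat_le_iff[symmetric] simp del: of_nat_le_iff)
  show "dyadics T N \<subseteq> dyadics T (Suc N)"
  proof
    fix x assume "x \<in> dyadics T N"
    then obtain j where "j \<le> 2 ^ N" "x = T * real j / 2 ^ N" by (auto simp: dyadics_def)
    then show "x \<in> dyadics T (Suc N)"
      unfolding dyadics_def by (intro image_eqI[of _ _ "2 * j"]) auto
  qed
qed

lemma dyadic_near:
  fixes s T e :: real
  assumes "0 < T" "0 \<le> s" "s \<le> T" "0 < e"
  obtains N q where "q \<in> dyadics T N" "\<bar>q - s\<bar> < e"
proof -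
  obtain N where N: "T / e < 2 ^ N" using real_arch_pow[of 2 "T / e"] by auto
  define j where "j = nat \<lfloor>s * 2 ^ N / T\<rfloor>"
  have x: "0 \<le> s * 2 ^ N / T" using assms by simp
  have j: "real j \<le> s * 2 ^ N / T" "s * 2 ^ N / T < real j + 1"
    unfolding j_def using x by linarith+
  have "real j \<le> 2 ^ N"
  proof -
    have "s * 2 ^ N / T \<le> 2 ^ N" using assms by (simp add: divide_le_eq mult.commute)
    then show ?thesis using j(1) by linarith
  qed
  then have "j \<le> 2 ^ N" by (metis of_nat_le_iff of_nat_numeral of_nat_power)
  then have "T * real j / 2 ^ N \<in> dyadics T N" by (auto simp: dyadics_def)
  moreover have "T * real j / 2 ^ N \<le> s" using j(1) assms by (simp add: field_simps)
  moreover have "s < T * real j / 2 ^ N + T / 2 ^ N" using j(2) assms by (simp add: field_simps)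
  moreover have "T / 2 ^ N < e" using N assms by (simp add: field_simps)
  ultimately show thesis by (intro that[of "T * real j / 2 ^ N" N]) auto
qed

lemma step_fun_cases:
  fixes g :: "nat \<Rightarrow> real"
  assumes "g 0 < x" "x \<le> g n"
  obtains j where "j < n" "g j < x" "x \<le> g (Suc j)"
proof -
  define k where "k = (LEAST k. x \<le> g k)"
  have k: "x \<le> g k" "k \<le> n" and min: "\<And>j. j < k \<Longrightarrow> \<not> x \<le> g j"
    unfolding k_def using assms(2) by (auto intro: LeastI Least_le dest: not_less_Least)
  obtain j where "k = Suc j" using k assms(1) by (cases k) auto
  then show thesis using k min[of j] by (intro that[of j]) auto
qed

section \<open>Simple processes on refined grids\<close>

context
  fixes N :: nat and \<tau> :: "nat \<Rightarrow> real" and h :: "nat \<Rightarrow> 'w \<Rightarrow> 'n::finite cmat"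
    and n :: nat and g :: "nat \<Rightarrow> real"
  assumes \<tau>: "0 \<le> \<tau> 0" "\<And>i. i < N \<Longrightarrow> \<tau> i < \<tau> (Suc i)"
    and g: "g 0 = 0" "\<And>i. i < n \<Longrightarrow> g i < g (Suc i)"
    and refines: "\<And>l j. l \<le> N \<Longrightarrow> j < n \<Longrightarrow> \<tau> l \<le> g j \<or> g (Suc j) \<le> \<tau> l"
begin

text \<open>No break point of the simple process lies inside a cell of \<open>g\<close>. As the
  intervals are open on the left, the constant value on a cell is the one at its right end point,
  not at its left one.\<close>

lemma simple_value_refinement:
  assumes "j < n" "g j < x" "x \<le> g (Suc j)"
  shows "simple_value (N, \<tau>, h) x w = simple_value (N, \<tau>, h) (g (Suc j)) w"
  unfolding simple_value_def prod.case
proof (intro sum.cong refl arg_cong2[where f="(*\<^sub>R)"])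
  fix l assume "l \<in> {..<N}"
  then have "\<tau> l \<le> g j \<or> g (Suc j) \<le> \<tau> l" "\<tau> (Suc l) \<le> g j \<or> g (Suc j) \<le> \<tau> (Suc l)"
    using refines[of l j] refines[of "Suc l" j] assms(1) by auto
  then show "indicator {\<tau> l<..\<tau> (Suc l)} x = (indicator {\<tau> l<..\<tau> (Suc l)} (g (Suc j)) :: real)"
    using assms by (auto simp: indicator_def)
qed

text \<open>For each l, the increment of \<open>L\<close> over the part of the l-th interval up to
  \<open>g i\<close> telescopes over the cells of \<open>g\<close> inside it; exchanging the two
  sums collects the simple process on each cell.\<close>

lemma simple_integral_refinement:
  assumes "i \<le> n"
  shows "simple_integral L (N, \<tau>, h) (g i) w =
    (\<Sum>j<i. simple_value (N, \<tau>, h) (g (Suc j)) w ** (L (g (Suc j)) w - L (g j) w))"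
proof -
  have tel: "(\<Sum>j<i. indicator {\<tau> l<..\<tau> (Suc l)} (g (Suc j)) *\<^sub>R (L (g (Suc j)) w - L (g j) w))
      = L (min (\<tau> (Suc l)) (g i)) w - L (min (\<tau> l) (g i)) w" if l: "l < N" for l
  proof -
    define f where "f j = L (min (\<tau> (Suc l)) (g j)) w - L (min (\<tau> l) (g j)) w" for j
    have pos: "0 \<le> \<tau> k" if "k \<le> N" for k
      using \<tau>(1) step_mono[of N \<tau> 0 k, OF \<tau>(2)] that by (cases "k = 0") force+
    have lt: "\<tau> l < \<tau> (Suc l)" using \<tau>(2) l by simp
    have "f (Suc j) - f j = indicator {\<tau> l<..\<tau> (Suc l)} (g (Suc j)) *\<^sub>R (L (g (Suc j)) w - L (g j) w)"
      if j: "j < i" for j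
    proof -
      have gg: "g j < g (Suc j)" using g(2) j assms by simp
      \<comment> \<open>By the refinement property a cell lies before, after or inside the l-th
        interval.\<close>
      consider "g (Suc j) \<le> \<tau> l" | "\<tau> l \<le> g j" "\<tau> (Suc l) \<le> g j" | "\<tau> l \<le> g j" "g (Suc j) \<le> \<tau> (Suc l)"
        using refines[of l j] refines[of "Suc l" j] l j assms by fastforce
      then show ?thesis
        using gg lt by cases (simp_all add: f_def min_def)
    qed
    then have "(\<Sum>j<i. indicator {\<tau> l<..\<tau> (Suc l)} (g (Suc j)) *\<^sub>R (L (g (Suc j)) w - L (g j) w))
      = (\<Sum>j<i. f (Suc j) - f j)" by simp
    also have "\<dots> = f i - f 0" by (rule sum_lessThan_telescope)
    also have "f 0 = 0" using pos[of l] pos[of "Suc l"] l by (simp add: f_def g(1) min_def)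
    finally show ?thesis by (simp add: f_def)
  qed
  have "simple_integral L (N, \<tau>, h) (g i) w =
     (\<Sum>l<N. h l w ** (\<Sum>j<i. indicator {\<tau> l<..\<tau> (Suc l)} (g (Suc j)) *\<^sub>R (L (g (Suc j)) w - L (g j) w)))"
    unfolding simple_integral_def prod.case by (rule sum.cong[OF refl]) (simp only: lessThan_iff tel)
  also have "\<dots> = (\<Sum>l<N. \<Sum>j<i. indicator {\<tau> l<..\<tau> (Suc l)} (g (Suc j)) *\<^sub>R h l w ** (L (g (Suc j)) w - L (g j) w))"
    by (simp add: cmat_mult.sum_right cmat_mult.scaleR_right cmat_mult.scaleR_left)
  also have "\<dots> = (\<Sum>j<i. \<Sum>l<N. indicator {\<tau> l<..\<tau> (Suc l)} (g (Suc j)) *\<^sub>R h l w ** (L (g (Suc j)) w - L (g j) w))"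
    by (rule sum.swap)
  finally show ?thesis
    unfolding simple_value_def prod.case by (simp only: cmat_mult.sum_left)
qed

end

lemma indicator_grid:
  fixes g :: "nat \<Rightarrow> real"
  assumes g: "\<And>i. i < n \<Longrightarrow> g i < g (Suc i)" and j: "j < n" "g j < x" "x \<le> g (Suc j)" and i: "i < n"
  shows "indicator {g i<..g (Suc i)} x = (if i = j then 1 else 0 :: real)"
proof (cases i j rule: linorder_cases)
  case less
  then have "g (Suc i) \<le> g j"
    using step_mono[of n g "Suc i" j, OF g] j by (cases "Suc i = j") force+
  then show ?thesis using less j by (simp add: indicator_def)
next
  case greater
  then have "g (Suc j) \<le> g i"
    using step_mono[of n g "Suc j" i, OF g] i by (cases "Suc j = i") force+
  then show ?thesis using greater j by (simp add: indicator_def)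
qed (use j in \<open>simp add: indicator_def\<close>)

lemma simple_value_grid:
  assumes g: "\<And>i. i < n \<Longrightarrow> g i < g (Suc i)" and j: "j < n" "g j < x" "x \<le> g (Suc j)"
  shows "simple_value (n, g, h) x w = h j w"
proof -
  have "simple_value (n, g, h) x w = (\<Sum>i<n. (if i = j then 1 else 0) *\<^sub>R h i w)"
    unfolding simple_value_def prod.case
    by (intro sum.cong refl arg_cong2[where f="(*\<^sub>R)"] indicator_grid[OF g j]) auto
  also have "\<dots> = (\<Sum>i<n. if i = j then h i w else 0)" by (intro sum.cong) auto
  finally show ?thesis using j by simp
qed

lemma integral_step_function:
  fixes c :: "nat \<Rightarrow> real"
  assumes g: "0 \<le> g 0" "\<And>i. i < n \<Longrightarrow> g i < g (Suc i)"
    and f: "set_integrable lborel {0..g n} f"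
    and le: "\<And>j x. j < n \<Longrightarrow> g j < x \<Longrightarrow> x \<le> g (Suc j) \<Longrightarrow> c j \<le> f x" and f0: "\<And>x. 0 \<le> f x"
  shows "(\<Sum>j<n. (g (Suc j) - g j) * c j) \<le> (LBINT x:{0..g n}. f x)"
proof -
  have gn: "0 \<le> g j \<and> g j \<le> g n" if "j \<le> n" for j
    using g(1) step_mono[of n g j n, OF g(2)] step_mono[of n g 0 j, OF g(2)] that
    by (cases "j = 0"; cases "j = n") force+
  have i: "integrable lborel (\<lambda>x. indicator {g j<..g (Suc j)} x * c j)" if "j < n" for j
    using g(2)[OF that]
    by (intro integrable_mult_left integrable_real_indicator) (auto simp: emeasure_lborel_Ioc)
  have "(\<Sum>j<n. (g (Suc j) - g j) * c j) = (\<Sum>j<n. LINT x|lborel. indicator {g j<..g (Suc j)} x * c j)"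
    using g(2) by (intro sum.cong) (auto simp: less_imp_le)
  also have "\<dots> = (LINT x|lborel. (\<Sum>j<n. indicator {g j<..g (Suc j)} x * c j))"
    using i by (intro Bochner_Integration.integral_sum[symmetric]) auto
  also have "\<dots> \<le> (LINT x|lborel. indicator {0..g n} x *\<^sub>R f x)"
  proof (rule integral_mono)
    show "integrable lborel (\<lambda>x. \<Sum>j<n. indicator {g j<..g (Suc j)} x * c j)"
      using i by (intro Bochner_Integration.integrable_sum) auto
    show "integrable lborel (\<lambda>x. indicator {0..g n} x *\<^sub>R f x)"
      using f by (simp add: set_integrable_def)
    fix x
    show "(\<Sum>j<n. indicator {g j<..g (Suc j)} x * c j) \<le> indicator {0..g n} x *\<^sub>R f x"
    proof (cases "g 0 < x \<and> x \<le> g n")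
      case True
      then obtain j where j: "j < n" "g j < x" "x \<le> g (Suc j)" by (auto elim: step_fun_cases)
      have "(\<Sum>j<n. indicator {g j<..g (Suc j)} x * c j) = c j"
      proof -
        have "(\<Sum>i<n. indicator {g i<..g (Suc i)} x * c i) = (\<Sum>i<n. if i = j then c i else 0)"
          by (intro sum.cong refl) (simp only: lessThan_iff indicator_grid[OF g(2) j], simp)
        then show ?thesis using j by simp
      qed
      then show ?thesis using le[OF j] True g(1) by simp
    next
      case False
      then have "indicator {g j<..g (Suc j)} x * c j = 0" if "j < n" for j
        using gn[of "Suc j"] that step_mono[of n g 0 j, OF g(2)] by (cases "j = 0") (auto simp: indicator_def)
      then have "(\<Sum>j<n. indicator {g j<..g (Suc j)} x * c j) = 0" by (intro sum.neutral ballI) blast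
      then show ?thesis using f0 by (simp only:) simp
    qed
  qed
  finally show ?thesis by (simp add: set_lebesgue_integral_def)
qed

lemma riemann_sum_integral:
  fixes f :: "real \<Rightarrow> 'a::euclidean_space"
  assumes f: "continuous_on {0..g n} f"
    and g: "g 0 = 0" "\<And>i. i < n \<Longrightarrow> g i < g (Suc i)"
    and \<kappa>: "\<And>i x. i < n \<Longrightarrow> g i \<le> x \<Longrightarrow> x \<le> g (Suc i) \<Longrightarrow> norm (f x - f (g i)) \<le> \<kappa>"
    and k: "k \<le> n"
  shows "norm ((\<Sum>i<k. (g (Suc i) - g i) *\<^sub>R f (g i)) - (LBINT x:{0..g k}. f x)) \<le> \<kappa> * g k"
proof -
  have lb: "(LBINT x:{0..g j}. f x) = integral {0..g j} f" if "g j \<le> g n" for j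
    by (intro set_borel_integral_eq_integral(2) borel_integrable_atLeastAtMost'
      continuous_on_subset[OF f]) (use that in auto)
  show ?thesis
  using k
proof (induction k)
  case 0
  have "g 0 \<le> g n" using step_mono[of n g 0 n, OF g(2)] by (cases "n = 0") (auto simp: less_imp_le)
  then show ?case using lb[of 0] by (simp add: g(1))
next
  case (Suc k)
  have gk: "0 \<le> g k" "g k < g (Suc k)" "g (Suc k) \<le> g n"
    using Suc.prems g(2)[of k] step_mono[of n g 0 k, OF g(2)] step_mono[of n g "Suc k" n, OF g(2)] g(1)
    by (cases "k = 0"; cases "Suc k = n"; force)+
  have int: "f integrable_on {0..g (Suc k)}"
    by (intro integrable_continuous_interval continuous_on_subset[OF f]) (use gk in auto)
  have comb: "integral {0..g k} f + integral {g k..g (Suc k)} f = integral {0..g (Suc k)} f"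
    by (rule Henstock_Kurzweil_Integration.integral_combine[OF _ _ int]) (use gk in auto)
  have int2: "f integrable_on {g k..g (Suc k)}"
    by (intro integrable_continuous_interval continuous_on_subset[OF f]) (use gk in auto)
  have "norm (integral {g k..g (Suc k)} (\<lambda>x. f x - f (g k))) \<le> \<kappa> * (g (Suc k) - g k)"
    using gk \<kappa>[of k] Suc.prems
    by (intro integral_bound continuous_intros continuous_on_subset[OF f]) auto
  also have "integral {g k..g (Suc k)} (\<lambda>x. f x - f (g k)) =
      integral {g k..g (Suc k)} f - (g (Suc k) - g k) *\<^sub>R f (g k)"
    using gk by (subst Henstock_Kurzweil_Integration.integral_diff[OF int2]) auto
  finally have 1: "norm ((g (Suc k) - g k) *\<^sub>R f (g k) - integral {g k..g (Suc k)} f) \<le> \<kappa> * (g (Suc k) - g k)"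
    by (simp add: norm_minus_commute)
  have "(\<Sum>i<Suc k. (g (Suc i) - g i) *\<^sub>R f (g i)) - (LBINT x:{0..g (Suc k)}. f x) =
    ((\<Sum>i<k. (g (Suc i) - g i) *\<^sub>R f (g i)) - (LBINT x:{0..g k}. f x)) +
    ((g (Suc k) - g k) *\<^sub>R f (g k) - integral {g k..g (Suc k)} f)"
    using lb[of k] lb[of "Suc k"] gk comb by (simp add: algebra_simps)
  also have "norm \<dots> \<le> \<kappa> * g k + \<kappa> * (g (Suc k) - g k)"
    using 1 Suc by (intro norm_triangle_le add_mono) auto
  finally show ?case by (simp add: algebra_simps)
qed
qed

section \<open>Oscillation of continuous paths\<close>

context prob_space
begin

text \<open>Almost every path is uniformly continuous on [0,T]. Over the countable set
  \<open>Q\<close> of dyadic times the events \<open>A n\<close> are measurable, increase and fill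
  the space up to a null set, so some \<open>A n\<close> has probability above 1 - \<eta>;
  continuity carries the bound from \<open>Q\<close> to all times.\<close>

lemma continuous_process_oscillation:
  fixes X :: "real \<Rightarrow> 'a \<Rightarrow> 'b::{real_normed_vector, second_countable_topology}"
  assumes meas: "\<And>t. 0 \<le> t \<Longrightarrow> X t \<in> borel_measurable M"
    and cont: "AE w in M. continuous_on {0..} (\<lambda>t. X t w)"
    and "0 < T" "0 < \<kappa>" "0 < \<eta>"
  obtains \<mu> where "0 < \<mu>"
    "outer_prob_le M (\<lambda>w. \<exists>s\<in>{0..T}. \<exists>r\<in>{0..T}. \<bar>s - r\<bar> \<le> \<mu> \<and> \<kappa> < norm (X s w - X r w)) \<eta>"
proof -
  define Q where "Q = (\<Union>N. dyadics T N)"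
  have cQ: "countable Q"
    unfolding Q_def dyadics_def by auto
  have QT: "Q \<subseteq> {0..T}" unfolding Q_def using dyadics(4)[OF \<open>0 < T\<close>] by blast
  define A where "A n = {w\<in>space M. \<forall>s\<in>Q. \<forall>r\<in>Q. \<bar>s - r\<bar> < 1 / real (Suc n) \<longrightarrow> norm (X s w - X r w) \<le> \<kappa>}" for n
  have A: "A n \<in> sets M" for n
    unfolding A_def
  proof (intro sets.sets_Collect_countable_All' cQ)
    fix s r assume "s \<in> Q" "r \<in> Q"
    then have [measurable]: "X s \<in> borel_measurable M" "X r \<in> borel_measurable M" using QT meas by auto
    show "{w\<in>space M. \<bar>s - r\<bar> < 1 / real (Suc n) \<longrightarrow> norm (X s w - X r w) \<le> \<kappa>} \<in> sets M" by measurable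
  qed
  have inc: "incseq A"
  proof (rule incseq_SucI)
    fix n
    have "1 / real (Suc (Suc n)) \<le> 1 / real (Suc n)" by (simp add: frac_le)
    then show "A n \<le> A (Suc n)" unfolding A_def by fastforce
  qed
  have "AE w in M. w \<in> (\<Union>n. A n)"
    using cont AE_space
  proof eventually_elim
    case (elim w)
    have "uniformly_continuous_on {0..T} (\<lambda>t. X t w)"
      by (intro compact_uniformly_continuous continuous_on_subset[OF elim(1)]) auto
    then obtain d where d: "0 < d" "\<And>s r. s \<in> {0..T} \<Longrightarrow> r \<in> {0..T} \<Longrightarrow> dist r s < d \<Longrightarrow> dist (X r w) (X s w) < \<kappa>"
      unfolding uniformly_continuous_on_def using \<open>0 < \<kappa>\<close> by metis
    obtain n where n: "1 / real (Suc n) < d" using nat_approx_posE[OF d(1)] by blast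
    have "norm (X s w - X r w) \<le> \<kappa>" if "s \<in> Q" "r \<in> Q" "\<bar>s - r\<bar> < 1 / real (Suc n)" for s r
    proof -
      have "dist s r < d" using that(3) n by (simp add: dist_real_def)
      moreover have "s \<in> {0..T}" "r \<in> {0..T}" using that QT by blast+
      ultimately have "dist (X s w) (X r w) < \<kappa>" by (intro d(2))
      then show ?thesis by (simp add: dist_norm)
    qed
    then have "w \<in> A n" using elim(2) by (simp add: A_def)
    then show ?case by blast
  qed
  then have "prob (\<Union>n. A n) = 1" using A by (intro prob_eq_1[THEN iffD2]) auto
  moreover have "(\<lambda>n. prob (A n)) \<longlonglongrightarrow> prob (\<Union>n. A n)"
    using A inc by (intro finite_Lim_measure_incseq) auto
  ultimately have "\<forall>\<^sub>F n in sequentially. 1 - \<eta> < prob (A n)"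
    using \<open>0 < \<eta>\<close> by (intro order_tendstoD(1)[where y=1]) auto
  then obtain n where n: "1 - \<eta> < prob (A n)" by (auto simp: eventually_sequentially)
  \<comment> \<open>Half of the threshold for dyadic times: replacing s and r by dyadic times moves
    each of them by less than \<mu> / 2.\<close>
  define \<mu> where "\<mu> = 1 / (2 * real (Suc n))"
  have \<mu>: "0 < \<mu>" "2 * \<mu> = 1 / real (Suc n)" by (auto simp: \<mu>_def field_simps)
  have "outer_prob_le M (\<lambda>w. w \<notin> A n) \<eta>"
    using A n prob_compl[OF A[of n]] by (intro outer_prob_leI[of "space M - A n"]) auto
  moreover have "outer_prob_le M (\<lambda>w. \<not> continuous_on {0..} (\<lambda>t. X t w)) 0"
    using cont by (intro outer_prob_le_AE) auto
  ultimately have "outer_prob_le M (\<lambda>w. w \<notin> A n \<or> \<not> continuous_on {0..} (\<lambda>t. X t w)) (\<eta> + 0)"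
    by (rule outer_prob_le_disj)
  then have "outer_prob_le M (\<lambda>w. \<exists>s\<in>{0..T}. \<exists>r\<in>{0..T}. \<bar>s - r\<bar> \<le> \<mu> \<and> \<kappa> < norm (X s w - X r w)) \<eta>"
  proof (rule outer_prob_le_mono)
    fix w assume "\<exists>s\<in>{0..T}. \<exists>r\<in>{0..T}. \<bar>s - r\<bar> \<le> \<mu> \<and> \<kappa> < norm (X s w - X r w)"
    then obtain s r where sr: "s \<in> {0..T}" "r \<in> {0..T}" "\<bar>s - r\<bar> \<le> \<mu>" "\<kappa> < norm (X s w - X r w)" by blast
    show "w \<notin> A n \<or> \<not> continuous_on {0..} (\<lambda>t. X t w)"
    proof (rule ccontr)
      assume "\<not> (w \<notin> A n \<or> \<not> continuous_on {0..} (\<lambda>t. X t w))"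
      then have w: "w \<in> A n" and c: "continuous_on {0..} (\<lambda>t. X t w)" by auto
      \<comment> \<open>Half of the excess over \<kappa>, so that two approximation errors below e
        cannot use it up.\<close>
      define e where "e = (norm (X s w - X r w) - \<kappa>) / 2"
      have e: "0 < e" using sr by (simp add: e_def)
      obtain d1 where d1: "0 < d1" "\<And>x. x \<in> {0..} \<Longrightarrow> dist x s < d1 \<Longrightarrow> dist (X x w) (X s w) < e"
        using c sr(1) e unfolding continuous_on_iff by force
      obtain d2 where d2: "0 < d2" "\<And>x. x \<in> {0..} \<Longrightarrow> dist x r < d2 \<Longrightarrow> dist (X x w) (X r w) < e"
        using c sr(2) e unfolding continuous_on_iff by force
      obtain N s' where s': "s' \<in> dyadics T N" "\<bar>s' - s\<bar> < min d1 (\<mu> / 2)"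
        by (rule dyadic_near[of T s "min d1 (\<mu> / 2)"]) (use \<open>0 < T\<close> sr d1 \<mu> in auto)
      obtain N' r' where r': "r' \<in> dyadics T N'" "\<bar>r' - r\<bar> < min d2 (\<mu> / 2)"
        by (rule dyadic_near[of T r "min d2 (\<mu> / 2)"]) (use \<open>0 < T\<close> sr d2 \<mu> in auto)
      have Q: "s' \<in> Q" "r' \<in> Q" using s'(1) r'(1) by (auto simp: Q_def)
      have "\<bar>s' - r'\<bar> < 1 / real (Suc n)"
        using s'(2) r'(2) sr(3) unfolding \<mu>(2)[symmetric] by linarith
      then have "norm (X s' w - X r' w) \<le> \<kappa>" using w Q by (auto simp: A_def)
      moreover have "dist (X s' w) (X s w) < e" using d1(2)[of s'] Q QT s'(2) by (auto simp: dist_real_def)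
      moreover have "dist (X r' w) (X r w) < e" using d2(2)[of r'] Q QT r'(2) by (auto simp: dist_real_def)
      moreover have "dist (X s w) (X r w) \<le> dist (X s' w) (X s w) + dist (X s' w) (X r' w) + dist (X r' w) (X r w)"
        using dist_triangle[of "X s w" "X r w" "X s' w"] dist_triangle[of "X s' w" "X r w" "X r' w"]
          dist_commute[of "X s w" "X s' w"] by linarith
      moreover have "dist (X s w) (X r w) = 2 * e + \<kappa>" by (simp add: e_def dist_norm field_simps)
      ultimately show False unfolding dist_norm[of "X s' w" "X r' w"] by linarith
    qed
  qed simp
  then show thesis using \<mu>(1) that by blast
qed

end

lemma set_integrable_simple_value_diff:
  fixes X :: "real \<Rightarrow> 'n::finite cmat"
  assumes X: "continuous_on {0..T} X"
  shows "set_integrable lborel {0..T} (\<lambda>x. (norm (simple_value H x w - X x))\<^sup>2)"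
proof -
  obtain N \<tau> h where H: "H = (N, \<tau>, h)" by (cases H)
  define f where "f x = indicator {0..T} x *\<^sub>R (simple_value H x w - X x)" for x
  have "(\<lambda>x. simple_value H x w) \<in> borel_measurable borel"
    unfolding H simple_value_def prod.case by measurable
  moreover have "(\<lambda>x. indicator {0..T} x *\<^sub>R X x) \<in> borel_measurable borel"
    by (rule borel_measurable_continuous_on_indicator[OF _ X]) simp
  ultimately have "(\<lambda>x. indicator {0..T} x *\<^sub>R simple_value H x w - indicator {0..T} x *\<^sub>R X x) \<in> borel_measurable borel"
    by measurable
  then have m: "f \<in> borel_measurable borel" by (simp add: f_def[abs_def] scaleR_diff_right)
  have "bounded (X ` {0..T})" by (intro compact_imp_bounded compact_continuous_image X) simp
  then obtain b where b: "\<And>x. x \<in> {0..T} \<Longrightarrow> norm (X x) \<le> b" unfolding bounded_iff by blast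
  define c where "c = (\<Sum>i<N. norm (h i w)) + b"
  have "norm (f x) \<le> c * indicator {0..T} x" for x
  proof (cases "x \<in> {0..T}")
    case True
    have "norm (simple_value H x w) \<le> (\<Sum>i<N. norm (h i w))"
      unfolding H simple_value_def prod.case
      by (intro order_trans[OF norm_sum] sum_mono) (simp add: indicator_def)
    then show ?thesis
      using b[OF True] True norm_triangle_ineq4[of "simple_value H x w" "X x"] by (simp add: f_def c_def)
  qed (simp add: f_def)
  then have le: "(norm (f x))\<^sup>2 \<le> (c * indicator {0..T} x)\<^sup>2" for x by (intro power_mono) auto
  have "integrable lborel (\<lambda>x. (norm (f x))\<^sup>2)"
  proof (rule integrable_nonneg_bound[OF _ _ _ le])
    have "integrable lborel (\<lambda>x. indicator {0..T} x * c\<^sup>2)"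
      by (intro integrable_mult_left integrable_real_indicator) (auto simp: emeasure_lborel_Icc_eq)
    then show "integrable lborel (\<lambda>x. (c * indicator {0..T} x)\<^sup>2)"
      by (rule back_subst[of "integrable lborel"]) (auto simp: indicator_def fun_eq_iff)
    show "(\<lambda>x. (norm (f x))\<^sup>2) \<in> borel_measurable lborel" using m by measurable
  qed simp
  moreover have "(\<lambda>x. (norm (f x))\<^sup>2) = (\<lambda>x. indicator {0..T} x *\<^sub>R (norm (simple_value H x w - X x))\<^sup>2)"
    by (auto simp: f_def indicator_def fun_eq_iff)
  ultimately show ?thesis by (simp add: set_integrable_def)
qed

lemma stopped_sum_le:
  fixes f d :: "nat \<Rightarrow> real"
  assumes "\<And>i. 0 \<le> f i" "\<And>i. i < n \<Longrightarrow> 0 \<le> d i" "0 \<le> \<delta>"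
  shows "(\<Sum>i<n. d i * (if (\<Sum>j\<le>i. d j * f j) \<le> \<delta> then f i else 0)) \<le> \<delta>"
  using assms(2)
proof (induction n)
  case (Suc n)
  let ?g = "\<lambda>i. if (\<Sum>j\<le>i. d j * f j) \<le> \<delta> then f i else 0"
  show ?case
  proof (cases "(\<Sum>j\<le>n. d j * f j) \<le> \<delta>")
    case True
    have "(\<Sum>i<Suc n. d i * ?g i) \<le> (\<Sum>i<Suc n. d i * f i)"
      using assms(1) Suc.prems by (intro sum_mono mult_left_mono) auto
    also have "\<dots> \<le> \<delta>" using True by (simp only: lessThan_Suc_atMost)
    finally show ?thesis .
  next
    case False
    then show ?thesis using Suc by simp
  qed
qed (use assms(3) in simp)

section \<open>Riemann sums converge to the Ito integral\<close>

context brownian_driver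
begin

text \<open>An interval that contributes at \<open>r'\<close> starts before \<open>r'\<close>, hence
  not after \<open>r\<close>, as no break point lies strictly between them. So the value at the
  right end of a cell is already known at its left end.\<close>

lemma simple_value_adapted:
  assumes \<tau>: "0 \<le> \<tau> 0" "\<And>i. i < N \<Longrightarrow> \<tau> i < \<tau> (Suc i)"
    and refines: "\<And>l. l \<le> N \<Longrightarrow> \<tau> l \<le> r \<or> r' \<le> \<tau> l"
    and h: "\<And>i. i < N \<Longrightarrow> h i \<in> borel_measurable (F (\<tau> i))"
  shows "simple_value (N, \<tau>, h) r' \<in> borel_measurable (F r)"
proof -
  have "(\<lambda>w. \<Sum>l<N. indicator {\<tau> l<..\<tau> (Suc l)} r' *\<^sub>R h l w) \<in> borel_measurable (F r)"
  proof (rule borel_measurable_sum)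
    fix l assume l: "l \<in> {..<N}"
    show "(\<lambda>w. indicator {\<tau> l<..\<tau> (Suc l)} r' *\<^sub>R h l w) \<in> borel_measurable (F r)"
    proof (cases "\<tau> l \<le> r")
      case True
      then have "h l \<in> borel_measurable (F r)" using l measurable_F_mono[OF h[of l]] by auto
      then show ?thesis by measurable
    next
      case False
      then have "\<not> \<tau> l < r'" using refines[of l] l by auto
      then show ?thesis by simp
    qed
  qed
  then show ?thesis by (simp add: simple_value_def[abs_def])
qed

lemma null_in_probability_outer:
  assumes "null_in_probability M Y" "0 < \<epsilon>" "0 < \<eta>"
  shows "\<forall>\<^sub>F k in sequentially. outer_prob_le M (\<lambda>w. \<epsilon> < \<bar>Y k w\<bar>) \<eta>"
proof -
  obtain E where E: "\<And>k. E k \<in> sets M \<and> {w\<in>space M. \<bar>Y k w\<bar> > \<epsilon>} \<subseteq> E k" "(\<lambda>k. prob (E k)) \<longlonglongrightarrow> 0"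
    using assms unfolding null_in_probability_def by blast
  have "\<forall>\<^sub>F k in sequentially. prob (E k) < \<eta>" using order_tendstoD(2)[OF E(2) assms(3)] .
  then show ?thesis
  proof eventually_elim
    case (elim k)
    then show ?case using E(1)[of k] by (intro outer_prob_leI[of "E k"]) auto
  qed
qed

text \<open>\<open>ito_integral\<close> asserts only that some simple processes \<open>H k\<close>
  work, so the Riemann sums of B have to be tied to them. On a common refinement both integrals
  become sums over the same cells, and their difference is an adapted sum with integrand
  \<open>u\<close>, small in L^2[0,T] on a likely event; \<open>ito_sum_maximal\<close> with m = 1
  and c = 0 then controls it at all grid times at once. The bound \<mu> is fixed by the oscillation
  of B before the grid is given, the index k only afterwards.\<close>

lemma riemann_sum_ito_integral:
  fixes B J :: "real \<Rightarrow> 'w \<Rightarrow> 'n cmat"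
  assumes ito: "ito_integral M F (driving_process \<beta> W) B J" and T: "0 < T" and \<epsilon>: "0 < \<epsilon>" and \<eta>: "0 < \<eta>"
  obtains \<mu> where "0 < \<mu>"
    "\<And>s n. s 0 = 0 \<Longrightarrow> s n = T \<Longrightarrow> (\<And>i. i < n \<Longrightarrow> s i < s (Suc i)) \<Longrightarrow>
      (\<And>i. i < n \<Longrightarrow> s (Suc i) - s i \<le> \<mu>) \<Longrightarrow>
      outer_prob_le M (\<lambda>w. \<exists>k\<le>n. \<epsilon> < norm ((\<Sum>i<k. B (s i) w **
        (driving_process \<beta> W (s (Suc i)) w - driving_process \<beta> W (s i) w)) - J (s k) w)) \<eta>"
proof -
  let ?L = "driving_process \<beta> W"
  have B: "\<And>t. 0 \<le> t \<Longrightarrow> B t \<in> borel_measurable (F t)" "AE w in M. continuous_on {0..} (\<lambda>t. B t w)"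
    using ito by (auto simp: ito_integral_def continuous_adapted_def)
  obtain H where H: "\<And>k. simple_process M F (H k)"
    "\<And>t. 0 \<le> t \<Longrightarrow> null_in_probability M (\<lambda>k w. LBINT x:{0..t}. (norm (simple_value (H k) x w - B x w))\<^sup>2)"
    "\<And>t. 0 \<le> t \<Longrightarrow> null_in_probability M (\<lambda>k w. norm (simple_integral ?L (H k) t w - J t w))"
    using ito unfolding ito_integral_def by blast
  obtain C where C: "0 \<le> C" "\<And>g n (u :: nat \<Rightarrow> 'w \<Rightarrow> 'n cmat) \<phi> a \<epsilon>. 0 \<le> g 0 \<Longrightarrow> g n \<le> T \<Longrightarrow> (\<forall>i<n. g i < g (Suc i)) \<Longrightarrow>
     (\<forall>i<n. u i \<in> borel_measurable (F (g i))) \<Longrightarrow> (\<forall>i<n. integrable M (\<phi> i)) \<Longrightarrow>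
     (\<forall>i<n. {w\<in>space M. a i w} \<in> sets (F (g i))) \<Longrightarrow> 0 < \<epsilon> \<Longrightarrow>
     (\<forall>i<n. \<forall>w\<in>space M. 0 \<le> \<phi> i w \<and> ((\<forall>j\<le>i. a j w) \<longrightarrow> norm (u i w) ^ (2 * 1) \<le>
        0 * norm (\<Sum>j<i. u j w ** drift_increment 0 (g j) (g (Suc j)) w) ^ (2 * 1) + \<phi> i w)) \<Longrightarrow>
     outer_prob_le M (\<lambda>w. (\<forall>i<n. a i w) \<and>
         (\<exists>i\<le>n. \<epsilon> < norm (\<Sum>j<i. u j w ** drift_increment 0 (g j) (g (Suc j)) w)))
       (C * (\<Sum>j<n. (g (Suc j) - g j) * expectation (\<phi> j)) / \<epsilon> ^ (2 * 1))"
    using ito_sum_maximal[of 1 0 T 0] by (simp only: order_refl simp_thms) blast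
  \<comment> \<open>Chosen so that the second-moment bound for a sum with L^2 budget \<delta> and
    threshold \<epsilon> / 2 is at most \<eta> / 4; the \<open>C + 1\<close> avoids a division by
    zero.\<close>
  define \<delta> where "\<delta> = (\<eta> / 4) * (\<epsilon> / 2)\<^sup>2 / (C + 1)"
  have \<delta>: "0 < \<delta>" using C \<epsilon> \<eta> by (simp add: \<delta>_def)
  have C\<delta>: "C * \<delta> / (\<epsilon> / 2)\<^sup>2 \<le> \<eta> / 4"
  proof -
    have "C * \<delta> / (\<epsilon> / 2)\<^sup>2 = (\<eta> / 4) * (C / (C + 1))" using \<epsilon> by (simp add: \<delta>_def)
    also have "\<dots> \<le> (\<eta> / 4) * 1" using C \<eta> by (intro mult_left_mono) auto
    finally show ?thesis by simp
  qed
  \<comment> \<open>On the good event |u|^2 is at most 2 |H k - B|^2 + 2 \<kappa>^2, whose time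
    integral is at most 2 (\<delta> / 4) + 2 \<kappa>^2 T = \<delta>.\<close>
  define \<kappa> where "\<kappa> = sqrt (\<delta> / (4 * T))"
  have \<kappa>: "0 < \<kappa>" "2 * \<kappa>\<^sup>2 * T = \<delta> / 2" using \<delta> T by (auto simp: \<kappa>_def)
  obtain \<mu> where \<mu>: "0 < \<mu>"
    "outer_prob_le M (\<lambda>w. \<exists>s\<in>{0..T}. \<exists>r\<in>{0..T}. \<bar>s - r\<bar> \<le> \<mu> \<and> \<kappa> < norm (B s w - B r w)) (\<eta> / 4)"
    by (rule continuous_process_oscillation[of B T \<kappa> "\<eta> / 4"])
      (use measurable_F[OF B(1)] B(2) T \<kappa> \<eta> in auto)
  have "outer_prob_le M (\<lambda>w. \<exists>k\<le>n. \<epsilon> < norm ((\<Sum>i<k. B (s i) w ** (?L (s (Suc i)) w - ?L (s i) w)) - J (s k) w)) \<eta>"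
    if s: "s 0 = 0" "s n = T" "\<And>i. i < n \<Longrightarrow> s i < s (Suc i)" and mesh: "\<And>i. i < n \<Longrightarrow> s (Suc i) - s i \<le> \<mu>"
    for s :: "nat \<Rightarrow> real" and n
  proof -
    have s00: "0 \<le> s 0" using s(1) by simp
    have s0: "0 \<le> s i" "s i \<le> T" if "i \<le> n" for i
      using step_mono[of n s 0 i, OF s(3)] step_mono[of n s i n, OF s(3)] that s(1,2)
      by (cases "i = 0"; cases "i = n"; force)+
    have "\<forall>\<^sub>F k in sequentially. outer_prob_le M (\<lambda>w. \<delta> / 4 < \<bar>LBINT x:{0..T}. (norm (simple_value (H k) x w - B x w))\<^sup>2\<bar>) (\<eta> / 4)"
      using T \<delta> \<eta> by (intro null_in_probability_outer H(2)) auto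
    \<comment> \<open>The approximation of J is known for each fixed time only. The grid is given by
      now, so some k is good at all its n + 1 times, which share the probability \<eta> / 4.\<close>
    moreover have "\<forall>\<^sub>F k in sequentially. \<forall>i\<in>{..n}. outer_prob_le M
        (\<lambda>w. \<epsilon> / 2 < \<bar>norm (simple_integral ?L (H k) (s i) w - J (s i) w)\<bar>) (\<eta> / 4 / real (Suc n))"
    proof (rule eventually_ball_finite[rule_format])
      fix i assume "i \<in> {..n}"
      then show "\<forall>\<^sub>F k in sequentially. outer_prob_le M
        (\<lambda>w. \<epsilon> / 2 < \<bar>norm (simple_integral ?L (H k) (s i) w - J (s i) w)\<bar>) (\<eta> / 4 / real (Suc n))"
        using s0 \<epsilon> \<eta> by (intro null_in_probability_outer[OF H(3)]) auto
    qed simp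
    ultimately have "\<exists>k. outer_prob_le M (\<lambda>w. \<delta> / 4 < \<bar>LBINT x:{0..T}. (norm (simple_value (H k) x w - B x w))\<^sup>2\<bar>) (\<eta> / 4)
       \<and> (\<forall>i\<in>{..n}. outer_prob_le M
        (\<lambda>w. \<epsilon> / 2 < \<bar>norm (simple_integral ?L (H k) (s i) w - J (s i) w)\<bar>) (\<eta> / 4 / real (Suc n)))"
      using eventually_happens'[OF sequentially_bot eventually_conj] by blast
    then obtain k where
      k1: "outer_prob_le M (\<lambda>w. \<delta> / 4 < \<bar>LBINT x:{0..T}. (norm (simple_value (H k) x w - B x w))\<^sup>2\<bar>) (\<eta> / 4)"
      and "\<forall>i\<in>{..n}. outer_prob_le M
        (\<lambda>w. \<epsilon> / 2 < \<bar>norm (simple_integral ?L (H k) (s i) w - J (s i) w)\<bar>) (\<eta> / 4 / real (Suc n))"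
      by blast
    then have "outer_prob_le M (\<lambda>w. \<exists>i\<in>{..n}. \<epsilon> / 2 < \<bar>norm (simple_integral ?L (H k) (s i) w - J (s i) w)\<bar>)
        (real (card {..n}) * (\<eta> / 4 / real (Suc n)))"
      by (intro outer_prob_le_Bex) auto
    moreover have "real (card {..n}) * (\<eta> / 4 / real (Suc n)) = \<eta> / 4"
      by (simp del: of_nat_Suc)
    ultimately have k2: "outer_prob_le M (\<lambda>w. \<exists>i\<in>{..n}. \<epsilon> / 2 < \<bar>norm (simple_integral ?L (H k) (s i) w - J (s i) w)\<bar>) (\<eta> / 4)"
      by (simp only:)
    obtain N \<tau> h where Hk: "H k = (N, \<tau>, h)" by (cases "H k")
    have \<tau>: "0 \<le> \<tau> 0" "\<And>i. i < N \<Longrightarrow> \<tau> i < \<tau> (Suc i)" "\<And>i. i < N \<Longrightarrow> h i \<in> borel_measurable (F (\<tau> i))"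
      using H(1)[of k] unfolding Hk simple_process_def by auto
    have \<tau>0: "0 \<le> \<tau> i" if "i \<le> N" for i
      using step_mono[of N \<tau> 0 i, OF \<tau>(2)] that \<tau>(1) by (cases "i = 0") force+
    \<comment> \<open>Break points of \<open>H k\<close> beyond T are dropped: they cannot fall
      inside a cell of a grid that ends at T.\<close>
    define S where "S = s ` {..n} \<union> {t \<in> \<tau> ` {..N}. t \<le> T}"
    have S: "finite S" "0 \<in> S" "T \<in> S" "S \<subseteq> {0..T}"
      using s(1,2) s0 \<tau>0 by (auto simp: S_def image_iff)
    obtain g m where g: "g 0 = 0" "g m = T" "\<And>i. i < m \<Longrightarrow> g i < g (Suc i)" "g ` {..m} = S"
      using finite_set_enumeration[OF S] by blast
    have gT: "0 \<le> g i" "g i \<le> T" if "i \<le> m" for i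
      using step_mono[of m g 0 i, OF g(3)] step_mono[of m g i m, OF g(3)] that g(1,2)
      by (cases "i = 0"; cases "i = m"; force)+
    have ref: "x \<le> g j \<or> g (Suc j) \<le> x" if x: "x \<in> S \<or> T \<le> x" and j: "j < m" for x j
    proof (cases "x \<in> S")
      case True
      then obtain i where i: "i \<le> m" "x = g i" using g(4) by auto
      show ?thesis
      proof (cases "i \<le> j")
        case True
        then show ?thesis using step_mono[of m g i j, OF g(3)] i j by (cases "i = j") auto
      next
        case False
        then show ?thesis using step_mono[of m g "Suc j" i, OF g(3)] i j by (cases "Suc j = i") auto
      qed
    next
      case False
      then show ?thesis using x gT(2)[of "Suc j"] j by auto
    qed
    have ref\<tau>: "\<tau> l \<le> g j \<or> g (Suc j) \<le> \<tau> l" if "l \<le> N" "j < m" for l j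
      using that by (intro ref) (auto simp: S_def)
    have refs: "s l \<le> g j \<or> g (Suc j) \<le> s l" if "l \<le> n" "j < m" for l j
      using that by (intro ref) (auto simp: S_def)
    \<comment> \<open>The Riemann sum of B is the formal \<open>simple_integral\<close> of B frozen
      on the cells of s. The values of B may be unbounded, so only the formulas for simple processes
      are applied to it, not the predicate \<open>simple_process\<close>.\<close>
    let ?b = "\<lambda>i. B (s i)"
    define u where "u j w = simple_value (H k) (g (Suc j)) w - simple_value (n, s, ?b) (g (Suc j)) w" for j w
    have mu: "u j \<in> borel_measurable (F (g j))" if "j < m" for j
    proof -
      have "simple_value (H k) (g (Suc j)) \<in> borel_measurable (F (g j))"
        unfolding Hk by (rule simple_value_adapted[OF \<tau>(1,2) ref\<tau> \<tau>(3)]) (use that in auto)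
      moreover have "simple_value (n, s, ?b) (g (Suc j)) \<in> borel_measurable (F (g j))"
        by (rule simple_value_adapted) (use s(1,3) refs that B(1) s0 in auto)
      ultimately show ?thesis unfolding u_def[abs_def] by measurable
    qed
    define Y where "Y i w = (\<Sum>j<i. u j w ** drift_increment 0 (g j) (g (Suc j)) w)" for i w
    have Y: "Y i w = simple_integral ?L (H k) (g i) w - simple_integral ?L (n, s, ?b) (g i) w" if "i \<le> m" for i w
    proof -
      have "simple_integral ?L (H k) (g i) w =
          (\<Sum>j<i. simple_value (H k) (g (Suc j)) w ** (?L (g (Suc j)) w - ?L (g j) w))"
        unfolding Hk by (rule simple_integral_refinement[where \<tau>=\<tau> and g=g and N=N and n=m, OF \<tau>(1,2) g(1,3) ref\<tau> that])
      moreover have "simple_integral ?L (n, s, ?b) (g i) w =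
          (\<Sum>j<i. simple_value (n, s, ?b) (g (Suc j)) w ** (?L (g (Suc j)) w - ?L (g j) w))"
        by (rule simple_integral_refinement[where \<tau>=s and g=g and N=n and n=m, OF s00 s(3) g(1,3) refs that])
      ultimately show ?thesis
        unfolding Y_def u_def drift_increment_def by (simp add: sum_subtractf cmat_mult.diff_left)
    qed
    have RS: "simple_integral ?L (n, s, ?b) (s i) w = (\<Sum>j<i. B (s j) w ** (?L (s (Suc j)) w - ?L (s j) w))"
      if i: "i \<le> n" for i w
    proof -
      have nin: "s l \<le> s j \<or> s (Suc j) \<le> s l" if "l \<le> n" "j < n" for l j
        using step_mono[of n s l j, OF s(3)] step_mono[of n s "Suc j" l, OF s(3)] that
        by (cases l j rule: linorder_cases; cases "l = Suc j") auto
      have "simple_integral ?L (n, s, ?b) (s i) w =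
          (\<Sum>j<i. simple_value (n, s, ?b) (s (Suc j)) w ** (?L (s (Suc j)) w - ?L (s j) w))"
        by (rule simple_integral_refinement[where \<tau>=s and g=s and N=n and n=n, OF s00 s(3) s(1,3) nin i])
      also have "\<dots> = (\<Sum>j<i. B (s j) w ** (?L (s (Suc j)) w - ?L (s j) w))"
        using i s(3) by (intro sum.cong refl arg_cong2[where f="(**)"] simple_value_grid[where g=s and n=n, OF s(3)]) auto
      finally show ?thesis .
    qed
    let ?q = "\<lambda>i w. (\<Sum>j\<le>i. (g (Suc j) - g j) * (norm (u j w))\<^sup>2)"
    \<comment> \<open>Stops the accumulated square of \<open>u\<close>, current cell included, at
      \<delta>. Cut off in this way, each \<phi> i is bounded, and \<open>stopped_sum_le\<close>
      bounds the weighted sum path by path although no moment of \<open>u\<close> is at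
      hand.\<close>
    define a where "a i w \<longleftrightarrow> ?q i w \<le> \<delta>" for i w
    define \<phi> where "\<phi> i w = (if a i w then (norm (u i w))\<^sup>2 else 0)" for i w
    have ma: "{w\<in>space M. a i w} \<in> sets (F (g i))" if i: "i < m" for i
    proof -
      have "(\<lambda>w. ?q i w) \<in> borel_measurable (F (g i))"
      proof (intro borel_measurable_sum)
        fix j assume j: "j \<in> {..i}"
        have "g j \<le> g i" using step_mono[of m g j i, OF g(3)] i j by (cases "j = i") (auto simp: less_imp_le)
        then have [measurable]: "u j \<in> borel_measurable (F (g i))"
          by (rule measurable_F_mono[OF mu, rotated]) (use i j in auto)
        show "(\<lambda>w. (g (Suc j) - g j) * (norm (u j w))\<^sup>2) \<in> borel_measurable (F (g i))" by measurable
      qed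
      then have "{w\<in>space (F (g i)). ?q i w \<le> \<delta>} \<in> sets (F (g i))" by measurable
      then show ?thesis by (simp add: a_def)
    qed
    have q_ge: "(g (Suc i) - g i) * (norm (u i w))\<^sup>2 \<le> ?q i w" if "i < m" for i w
      by (rule member_le_sum) (use that g(3) in \<open>auto simp: less_imp_le\<close>)
    have i\<phi>: "integrable M (\<phi> i)" if i: "i < m" for i
    proof (rule integrable_nonneg_bound)
      show "integrable M (\<lambda>w. \<delta> / (g (Suc i) - g i))" by simp
      have "{w\<in>space M. a i w} \<in> sets M" using ma[OF i] sets_F_subset by blast
      moreover have [measurable]: "u i \<in> borel_measurable M" using measurable_F[OF mu[OF i]] .
      ultimately show "\<phi> i \<in> borel_measurable M"
        unfolding \<phi>_def[abs_def] by (intro measurable_If) auto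
      show "0 \<le> \<phi> i w" for w by (simp add: \<phi>_def)
      show "\<phi> i w \<le> \<delta> / (g (Suc i) - g i)" for w
        using q_ge[OF i, of w] g(3)[OF i] \<delta> by (auto simp: \<phi>_def a_def field_simps)
    qed
    have sum\<phi>: "(\<Sum>j<m. (g (Suc j) - g j) * expectation (\<phi> j)) \<le> \<delta>"
    proof -
      have "(\<Sum>j<m. (g (Suc j) - g j) * expectation (\<phi> j)) = expectation (\<lambda>w. \<Sum>j<m. (g (Suc j) - g j) * \<phi> j w)"
        using i\<phi> by (simp add: Bochner_Integration.integral_sum)
      also have "\<dots> \<le> expectation (\<lambda>w. \<delta>)"
      proof (rule integral_mono)
        show "integrable M (\<lambda>w. \<Sum>j<m. (g (Suc j) - g j) * \<phi> j w)"
          using i\<phi> by (intro Bochner_Integration.integrable_sum integrable_mult_right) auto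
        show "(\<Sum>j<m. (g (Suc j) - g j) * \<phi> j w) \<le> \<delta>" for w
          unfolding \<phi>_def a_def using \<delta> g(3) by (intro stopped_sum_le) (auto simp: less_imp_le)
      qed simp
      finally show ?thesis by (simp add: prob_space)
    qed
    have k3: "outer_prob_le M (\<lambda>w. (\<forall>i<m. a i w) \<and> (\<exists>i\<le>m. \<epsilon> / 2 < norm (Y i w))) (\<eta> / 4)"
    proof -
      have 1: "outer_prob_le M (\<lambda>w. (\<forall>i<m. a i w) \<and> (\<exists>i\<le>m. \<epsilon> / 2 < norm (Y i w)))
          (C * (\<Sum>j<m. (g (Suc j) - g j) * expectation (\<phi> j)) / (\<epsilon> / 2) ^ (2 * 1))"
        unfolding Y_def by (rule C(2)) (use g mu i\<phi> ma \<epsilon> in \<open>auto simp: \<phi>_def\<close>)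
      have 2: "C * (\<Sum>j<m. (g (Suc j) - g j) * expectation (\<phi> j)) / (\<epsilon> / 2) ^ (2 * 1) \<le> \<eta> / 4"
        using order_trans[OF divide_right_mono[OF mult_left_mono[OF sum\<phi> C(1)] zero_le_power2] C\<delta>]
        by (simp only: mult.right_neutral)
      show ?thesis by (rule outer_prob_le_mono[OF 1 _ 2])
    qed
    have "outer_prob_le M (\<lambda>w. \<not> continuous_on {0..} (\<lambda>t. B t w)) 0"
      using B(2) by (intro outer_prob_le_AE) auto
    from outer_prob_le_disj[OF this outer_prob_le_disj[OF outer_prob_le_disj[OF k1 k2] outer_prob_le_disj[OF k3 \<mu>(2)]]]
    show ?thesis
    proof (rule outer_prob_le_mono)
      fix w
      assume ev: "\<exists>k\<le>n. \<epsilon> < norm ((\<Sum>i<k. B (s i) w ** (?L (s (Suc i)) w - ?L (s i) w)) - J (s k) w)"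
      show "\<not> continuous_on {0..} (\<lambda>t. B t w) \<or>
        (\<delta> / 4 < \<bar>LBINT x:{0..T}. (norm (simple_value (H k) x w - B x w))\<^sup>2\<bar> \<or>
         (\<exists>i\<in>{..n}. \<epsilon> / 2 < \<bar>norm (simple_integral ?L (H k) (s i) w - J (s i) w)\<bar>)) \<or>
        ((\<forall>i<m. a i w) \<and> (\<exists>i\<le>m. \<epsilon> / 2 < norm (Y i w))) \<or>
        (\<exists>s\<in>{0..T}. \<exists>r\<in>{0..T}. \<bar>s - r\<bar> \<le> \<mu> \<and> \<kappa> < norm (B s w - B r w))"
        (is "\<not> ?c \<or> (?A \<or> ?B) \<or> ?D \<or> ?O")
      proof (rule ccontr)
        assume "\<not> (\<not> ?c \<or> (?A \<or> ?B) \<or> ?D \<or> ?O)"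
        then have c: ?c and nA: "\<not> ?A" and nB: "\<not> ?B" and nD: "\<not> ?D" and nO: "\<not> ?O" by blast+
        have int: "set_integrable lborel {0..T} (\<lambda>x. (norm (simple_value (H k) x w - B x w))\<^sup>2)"
          by (rule set_integrable_simple_value_diff) (rule continuous_on_subset[OF c], auto)
        have intc: "set_integrable lborel {0..T} (\<lambda>x. 2 * \<kappa>\<^sup>2)"
          by (intro borel_integrable_atLeastAtMost' continuous_intros)
        have "(\<Sum>j<m. (g (Suc j) - g j) * (norm (u j w))\<^sup>2)
            \<le> (LBINT x:{0..g m}. 2 * (norm (simple_value (H k) x w - B x w))\<^sup>2 + 2 * \<kappa>\<^sup>2)"
        proof (rule integral_step_function)
          show "set_integrable lborel {0..g m} (\<lambda>x. 2 * (norm (simple_value (H k) x w - B x w))\<^sup>2 + 2 * \<kappa>\<^sup>2)"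
            unfolding g(2) using int intc by (intro set_integral_add set_integrable_mult_right) auto
          fix j x assume j: "j < m" "g j < x" "x \<le> g (Suc j)"
          have "s 0 < x" "x \<le> s n" using j gT(1)[of j] gT(2)[of "Suc j"] s(1,2) by auto
          then obtain i where i: "i < n" "s i < x" "x \<le> s (Suc i)" by (rule step_fun_cases)
          have "u j w = simple_value (H k) x w - simple_value (n, s, ?b) x w"
            unfolding u_def Hk
            using simple_value_refinement[where \<tau>=\<tau> and g=g and N=N and n=m, OF \<tau>(1,2) g(1,3) ref\<tau> j, of h w]
              simple_value_refinement[where \<tau>=s and g=g and N=n and n=m, OF s00 s(3) g(1,3) refs j, of ?b w]
            by (simp only:)
          also have "simple_value (n, s, ?b) x w = B (s i) w" by (rule simple_value_grid[where g=s and n=n, OF s(3) i])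
          finally have u: "u j w = (simple_value (H k) x w - B x w) + (B x w - B (s i) w)" by simp
          have "norm (B x w - B (s i) w) \<le> \<kappa>"
          proof -
            have "x \<in> {0..T}" "s i \<in> {0..T}" "\<bar>x - s i\<bar> \<le> \<mu>"
              using i s0[of i] s0[of "Suc i"] mesh[OF i(1)] by auto
            then show ?thesis using nO by (auto simp: not_less)
          qed
          then have "norm (u j w) \<le> norm (simple_value (H k) x w - B x w) + \<kappa>"
            unfolding u by (intro norm_triangle_le) simp
          then have "(norm (u j w))\<^sup>2 \<le> (norm (simple_value (H k) x w - B x w) + \<kappa>)\<^sup>2" by (rule power_mono) simp
          also have "\<dots> \<le> 2 * (norm (simple_value (H k) x w - B x w))\<^sup>2 + 2 * \<kappa>\<^sup>2"
            using sum_squares_bound[of "norm (simple_value (H k) x w - B x w)" \<kappa>] by (simp add: power2_sum)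
          finally show "(norm (u j w))\<^sup>2 \<le> 2 * (norm (simple_value (H k) x w - B x w))\<^sup>2 + 2 * \<kappa>\<^sup>2" .
        qed (use g in auto)
        also have "\<dots> = 2 * (LBINT x:{0..T}. (norm (simple_value (H k) x w - B x w))\<^sup>2) + (LBINT x:{0..T}. 2 * \<kappa>\<^sup>2)"
          unfolding g(2) using int intc by (subst set_integral_add) auto
        also have "(LBINT x:{0..T}. 2 * \<kappa>\<^sup>2) = 2 * \<kappa>\<^sup>2 * T"
          using T by (simp add: set_lebesgue_integral_def)
        also have "2 * (LBINT x:{0..T}. (norm (simple_value (H k) x w - B x w))\<^sup>2) + 2 * \<kappa>\<^sup>2 * T \<le> \<delta>"
          using nA unfolding \<kappa>(2) by linarith
        finally have q: "(\<Sum>j<m. (g (Suc j) - g j) * (norm (u j w))\<^sup>2) \<le> \<delta>" .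
        have "a i w" if "i < m" for i
        proof -
          have "?q i w \<le> (\<Sum>j<m. (g (Suc j) - g j) * (norm (u j w))\<^sup>2)"
            using that g(3) by (intro sum_mono2) (auto simp: less_imp_le)
          then show ?thesis using q by (simp add: a_def)
        qed
        then have nY: "norm (Y i w) \<le> \<epsilon> / 2" if "i \<le> m" for i using nD that by (auto simp: not_less)
        obtain l where l: "l \<le> n" "\<epsilon> < norm ((\<Sum>i<l. B (s i) w ** (?L (s (Suc i)) w - ?L (s i) w)) - J (s l) w)"
          using ev by blast
        have "s l \<in> g ` {..m}" unfolding g(4) S_def using l(1) by auto
        then obtain i where i: "i \<le> m" "s l = g i" by auto
        have "norm (simple_integral ?L (H k) (s l) w - simple_integral ?L (n, s, ?b) (s l) w) \<le> \<epsilon> / 2"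
          using nY[OF i(1)] Y[OF i(1)] i(2) by simp
        moreover have "norm (simple_integral ?L (H k) (s l) w - J (s l) w) \<le> \<epsilon> / 2"
          using nB l(1) by (auto simp: not_less)
        moreover have "norm (simple_integral ?L (n, s, ?b) (s l) w - J (s l) w)
            \<le> norm (simple_integral ?L (H k) (s l) w - simple_integral ?L (n, s, ?b) (s l) w)
              + norm (simple_integral ?L (H k) (s l) w - J (s l) w)"
          using norm_triangle_ineq[of "simple_integral ?L (n, s, ?b) (s l) w - simple_integral ?L (H k) (s l) w"
              "simple_integral ?L (H k) (s l) w - J (s l) w"]
          by (simp add: norm_minus_commute)
        ultimately show False using l(2) unfolding RS[OF l(1)] by linarith
      qed
    qed simp
  qed
  then show thesis using \<mu>(1) that by blast
qed

end

section \<open>The Euler scheme\<close>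

lemma ordered_prod_cong:
  assumes "\<And>j. j < n \<Longrightarrow> f j = g j"
  shows "ordered_prod n f = ordered_prod n g"
  using assms by (induction n) auto

lemma ordered_prod_truncate:
  assumes "l \<le> n" "\<And>j. l \<le> j \<Longrightarrow> j < n \<Longrightarrow> f j = mat 1"
  shows "ordered_prod n f = ordered_prod l f"
  using assms
proof (induction n)
  case (Suc n)
  then show ?case by (cases "l = Suc n") auto
qed simp

context brownian_driver
begin

abbreviation "half_Xi \<equiv> (1 / 2) *\<^sub>R Xi \<beta>"

text \<open>By the integral equation of B the defect is the sum of two Riemann errors: that of the
  Ito integral, treated in \<open>riemann_sum_ito_integral\<close>, and that of the drift integral,
  small by the oscillation of B. Each of them gets \<epsilon> / 2 and \<eta> / 2.\<close>

lemma euler_defect: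
  fixes B :: "real \<Rightarrow> 'w \<Rightarrow> 'n cmat"
  assumes bm: "group_brownian_motion M \<beta> W B" and T: "0 < T" and \<epsilon>: "0 < \<epsilon>" and \<eta>: "0 < \<eta>"
  obtains \<mu> where "0 < \<mu>"
    "\<And>s n. s 0 = 0 \<Longrightarrow> s n = T \<Longrightarrow> (\<And>i. i < n \<Longrightarrow> s i < s (Suc i)) \<Longrightarrow>
      (\<And>i. i < n \<Longrightarrow> s (Suc i) - s i \<le> \<mu>) \<Longrightarrow>
      outer_prob_le M (\<lambda>w. \<exists>k\<le>n. \<epsilon> < norm (mat 1 +
        (\<Sum>i<k. B (s i) w ** drift_increment half_Xi (s i) (s (Suc i)) w) - B (s k) w)) \<eta>"
proof -
  let ?L = "driving_process \<beta> W"
  obtain J where B: "\<And>t. 0 \<le> t \<Longrightarrow> B t \<in> borel_measurable (F t)" "AE w in M. continuous_on {0..} (\<lambda>t. B t w)"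
    and ito: "ito_integral M F ?L B J"
    and eq: "AE w in M. \<forall>t\<ge>0. B t w = mat 1 + J t w + (LBINT s:{0..t}. (1/2) *\<^sub>R (B s w ** Xi \<beta>))"
    using bm unfolding group_brownian_motion_def continuous_adapted_def by blast
  \<comment> \<open>The summand 1 keeps the denominator of \<kappa> positive when
    \<open>half_Xi\<close> vanishes.\<close>
  define a where "a = norm half_Xi + 1"
  define \<kappa> where "\<kappa> = \<epsilon> / (2 * T * a)"
  have pos: "0 < a" using norm_ge_zero[of half_Xi] unfolding a_def by linarith
  have \<kappa>: "0 < \<kappa>" unfolding \<kappa>_def using T \<epsilon> pos by (intro divide_pos_pos mult_pos_pos) auto
  have \<kappa>2: "\<kappa> * norm half_Xi * T \<le> \<epsilon> / 2"
  proof -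
    have "\<kappa> * norm half_Xi * T \<le> \<kappa> * a * T"
      unfolding a_def using \<kappa> T by (intro mult_right_mono mult_left_mono) auto
    also have "\<dots> = \<epsilon> / 2" unfolding \<kappa>_def using T pos by (simp add: field_simps)
    finally show ?thesis .
  qed
  obtain \<mu>1 where \<mu>1: "0 < \<mu>1" "\<And>s n. s 0 = 0 \<Longrightarrow> s n = T \<Longrightarrow> (\<And>i. i < n \<Longrightarrow> s i < s (Suc i)) \<Longrightarrow>
      (\<And>i. i < n \<Longrightarrow> s (Suc i) - s i \<le> \<mu>1) \<Longrightarrow>
      outer_prob_le M (\<lambda>w. \<exists>k\<le>n. \<epsilon> / 2 < norm ((\<Sum>i<k. B (s i) w **
        (?L (s (Suc i)) w - ?L (s i) w)) - J (s k) w)) (\<eta> / 2)"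
    using riemann_sum_ito_integral[OF ito T half_gt_zero[OF \<epsilon>] half_gt_zero[OF \<eta>]] by blast
  obtain \<mu>2 where \<mu>2: "0 < \<mu>2"
    "outer_prob_le M (\<lambda>w. \<exists>s\<in>{0..T}. \<exists>r\<in>{0..T}. \<bar>s - r\<bar> \<le> \<mu>2 \<and> \<kappa> < norm (B s w - B r w)) (\<eta> / 2)"
    by (rule continuous_process_oscillation[of B T \<kappa> "\<eta> / 2"])
      (use measurable_F[OF B(1)] B(2) T \<kappa> \<eta> in auto)
  have "outer_prob_le M (\<lambda>w. \<exists>k\<le>n. \<epsilon> < norm (mat 1 +
        (\<Sum>i<k. B (s i) w ** drift_increment half_Xi (s i) (s (Suc i)) w) - B (s k) w)) \<eta>"
    if s: "s 0 = 0" "s n = T" "\<And>i. i < n \<Longrightarrow> s i < s (Suc i)"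
      and mesh: "\<And>i. i < n \<Longrightarrow> s (Suc i) - s i \<le> min \<mu>1 \<mu>2" for s n
  proof -
    have s0: "0 \<le> s i" "s i \<le> T" if "i \<le> n" for i
      using step_mono[of n s 0 i, OF s(3)] step_mono[of n s i n, OF s(3)] that s(1,2)
      by (cases "i = 0"; cases "i = n"; force)+
    have 1: "outer_prob_le M (\<lambda>w. \<exists>k\<le>n. \<epsilon> / 2 < norm ((\<Sum>i<k. B (s i) w **
        (?L (s (Suc i)) w - ?L (s i) w)) - J (s k) w)) (\<eta> / 2)"
      using mesh by (intro \<mu>1(2) s) auto
    have 2: "outer_prob_le M (\<lambda>w. \<not> (continuous_on {0..} (\<lambda>t. B t w) \<and>
        (\<forall>t\<ge>0. B t w = mat 1 + J t w + (LBINT s:{0..t}. (1/2) *\<^sub>R (B s w ** Xi \<beta>))))) 0"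
      using B(2) eq by (intro outer_prob_le_AE) auto
    show ?thesis
    proof (rule outer_prob_le_mono[OF outer_prob_le_disj[OF 2 outer_prob_le_disj[OF 1 \<mu>2(2)]]])
      fix w assume ev: "\<exists>k\<le>n. \<epsilon> < norm (mat 1 +
        (\<Sum>i<k. B (s i) w ** drift_increment half_Xi (s i) (s (Suc i)) w) - B (s k) w)"
      show "\<not> (continuous_on {0..} (\<lambda>t. B t w) \<and>
        (\<forall>t\<ge>0. B t w = mat 1 + J t w + (LBINT s:{0..t}. (1/2) *\<^sub>R (B s w ** Xi \<beta>)))) \<or>
        (\<exists>k\<le>n. \<epsilon> / 2 < norm ((\<Sum>i<k. B (s i) w ** (?L (s (Suc i)) w - ?L (s i) w)) - J (s k) w)) \<or>
        (\<exists>s\<in>{0..T}. \<exists>r\<in>{0..T}. \<bar>s - r\<bar> \<le> \<mu>2 \<and> \<kappa> < norm (B s w - B r w))"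
        (is "\<not> (?c \<and> ?e) \<or> ?R \<or> ?O")
      proof (rule ccontr)
        assume "\<not> (\<not> (?c \<and> ?e) \<or> ?R \<or> ?O)"
        then have c: ?c and e: ?e and nR: "\<not> ?R" and nO: "\<not> ?O" by blast+
        obtain k where k: "k \<le> n" and big: "\<epsilon> < norm (mat 1 +
          (\<Sum>i<k. B (s i) w ** drift_increment half_Xi (s i) (s (Suc i)) w) - B (s k) w)"
          using ev by blast
        define f where "f x = (1 / 2) *\<^sub>R (B x w ** Xi \<beta>)" for x
        have fA: "f x = B x w ** half_Xi" for x by (simp add: f_def cmat_mult.scaleR_right)
        have cf: "continuous_on {0..s n} f"
          unfolding f_def by (intro continuous_intros cmat_mult.continuous_on continuous_on_subset[OF c]) auto
        have f\<kappa>: "norm (f x - f (s i)) \<le> \<kappa> * norm half_Xi" if "i < n" "s i \<le> x" "x \<le> s (Suc i)" for i x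
        proof -
          have "x \<in> {0..T}" "s i \<in> {0..T}" "\<bar>x - s i\<bar> \<le> \<mu>2"
            using that s0[of i] s0[of "Suc i"] mesh[of i] by auto
          then have "norm (B x w - B (s i) w) \<le> \<kappa>" using nO by (auto simp: not_less)
          then have "norm (B x w - B (s i) w) * norm half_Xi \<le> \<kappa> * norm half_Xi"
            by (rule mult_right_mono) simp
          then show ?thesis
            unfolding fA using norm_cmat_mult[of "B x w - B (s i) w" half_Xi]
            by (simp only: cmat_mult.diff_left)
        qed
        have d: "norm ((\<Sum>i<k. (s (Suc i) - s i) *\<^sub>R f (s i)) - (LBINT x:{0..s k}. f x)) \<le> \<kappa> * norm half_Xi * s k"
          by (rule riemann_sum_integral[where n=n]) (use cf s f\<kappa> k in auto)
        have "\<kappa> * norm half_Xi * s k \<le> \<kappa> * norm half_Xi * T"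
          using s0[OF k] \<kappa> by (intro mult_left_mono) auto
        with d \<kappa>2 have d2: "norm ((\<Sum>i<k. (s (Suc i) - s i) *\<^sub>R f (s i)) - (LBINT x:{0..s k}. f x)) \<le> \<epsilon> / 2"
          by linarith
        have r: "norm ((\<Sum>i<k. B (s i) w ** (?L (s (Suc i)) w - ?L (s i) w)) - J (s k) w) \<le> \<epsilon> / 2"
          using nR k by (auto simp: not_less)
        have Bk: "B (s k) w = mat 1 + J (s k) w + (LBINT x:{0..s k}. f x)"
          using e s0[OF k] by (simp add: f_def)
        have "mat 1 + (\<Sum>i<k. B (s i) w ** drift_increment half_Xi (s i) (s (Suc i)) w) - B (s k) w =
          ((\<Sum>i<k. B (s i) w ** (?L (s (Suc i)) w - ?L (s i) w)) - J (s k) w) +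
          ((\<Sum>i<k. (s (Suc i) - s i) *\<^sub>R f (s i)) - (LBINT x:{0..s k}. f x))"
          unfolding Bk drift_increment_def fA
          by (simp only: cmat_mult.add_right cmat_mult.scaleR_right sum.distrib) simp
        then show False using big norm_triangle_le[OF add_mono[OF r d2]] by simp
      qed
    qed simp
  qed
  then show thesis using \<mu>1(1) \<mu>2(1) by (intro that[of "min \<mu>1 \<mu>2"]) auto
qed

section \<open>Recursion and moments of the scheme\<close>

context
  fixes T :: real and p :: "real list" and n :: nat and \<pi> :: "nat \<Rightarrow> real"
  assumes p: "is_partition T p" and T: "0 < T"
  defines "n \<equiv> length p - 1" and "\<pi> \<equiv> (!) p"
begin

lemma partition_grid:
  "\<pi> 0 = 0" "\<pi> n = T" "\<And>i. i < n \<Longrightarrow> \<pi> i < \<pi> (Suc i)" "\<pi> ` {..n} = set p" "0 < n"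
  "\<And>i. i < n \<Longrightarrow> \<pi> (Suc i) - \<pi> i \<le> mesh p" "0 < mesh p"
proof -
  have p': "p \<noteq> []" "hd p = 0" "last p = T" "sorted_wrt (<) p"
    using p by (auto simp: is_partition_def)
  then have len: "length p = Suc n" by (cases p) (auto simp: n_def)
  show 0: "\<pi> 0 = 0" and nT: "\<pi> n = T"
    using p' by (auto simp: \<pi>_def n_def hd_conv_nth last_conv_nth)
  show inc: "\<pi> i < \<pi> (Suc i)" if "i < n" for i
    using sorted_wrt_nth_less[OF p'(4), of i "Suc i"] that len by (simp add: \<pi>_def)
  show "\<pi> ` {..n} = set p"
    using len by (auto simp: \<pi>_def set_conv_nth image_iff less_Suc_eq_le)
  show n: "0 < n" using 0 nT T by (cases n) auto
  show le: "\<pi> (Suc i) - \<pi> i \<le> mesh p" if "i < n" for i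
    unfolding mesh_def \<pi>_def using that by (intro Max_ge) (auto simp: n_def)
  show "0 < mesh p" using le[OF n] inc[OF n] by linarith
qed

lemma partition_mono: "i \<le> j \<Longrightarrow> j \<le> n \<Longrightarrow> \<pi> i \<le> \<pi> j"
  using step_mono[of n \<pi> i j, OF partition_grid(3)] by (cases "i = j") force+

lemma partition_bounds: "i \<le> n \<Longrightarrow> 0 \<le> \<pi> i" "i \<le> n \<Longrightarrow> \<pi> i \<le> T"
  using partition_mono[of 0 i] partition_mono[of i n] partition_grid(1,2) by auto

lemma B_approx_eq:
  "B_approx \<beta> W p t w = ordered_prod n
     (\<lambda>j. mat 1 + drift_increment half_Xi (min (\<pi> j) t) (min (\<pi> (Suc j)) t) w)"
  unfolding B_approx_def drift_increment_def n_def \<pi>_def by (simp add: add.assoc)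

lemma B_approx_at:
  assumes "l \<le> n"
  shows "B_approx \<beta> W p (\<pi> l) w = ordered_prod l (\<lambda>j. mat 1 + drift_increment half_Xi (\<pi> j) (\<pi> (Suc j)) w)"
proof -
  have "B_approx \<beta> W p (\<pi> l) w = ordered_prod l
     (\<lambda>j. mat 1 + drift_increment half_Xi (min (\<pi> j) (\<pi> l)) (min (\<pi> (Suc j)) (\<pi> l)) w)"
    unfolding B_approx_eq
  proof (rule ordered_prod_truncate[OF assms])
    fix j assume "l \<le> j" "j < n"
    then have "min (\<pi> j) (\<pi> l) = \<pi> l" "min (\<pi> (Suc j)) (\<pi> l) = \<pi> l"
      using partition_mono[of l j] partition_mono[of l "Suc j"] by auto
    then show "mat 1 + drift_increment half_Xi (min (\<pi> j) (\<pi> l)) (min (\<pi> (Suc j)) (\<pi> l)) w = mat 1"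
      by (simp add: drift_increment_def)
  qed
  also have "\<dots> = ordered_prod l (\<lambda>j. mat 1 + drift_increment half_Xi (\<pi> j) (\<pi> (Suc j)) w)"
  proof (rule ordered_prod_cong)
    fix j assume "j < l"
    then have "min (\<pi> j) (\<pi> l) = \<pi> j" "min (\<pi> (Suc j)) (\<pi> l) = \<pi> (Suc j)"
      using partition_mono[of j l] partition_mono[of "Suc j" l] assms by auto
    then show "mat 1 + drift_increment half_Xi (min (\<pi> j) (\<pi> l)) (min (\<pi> (Suc j)) (\<pi> l)) w =
        mat 1 + drift_increment half_Xi (\<pi> j) (\<pi> (Suc j)) w" by simp
  qed
  finally show ?thesis .
qed

text \<open>At time t the factors of later cells are the identity and those of earlier cells are
  complete, so only the factor of the cell containing t is partial.\<close>

lemma B_approx_between: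
  assumes l: "l < n" "\<pi> l \<le> t" "t \<le> \<pi> (Suc l)"
  shows "B_approx \<beta> W p t w =
    B_approx \<beta> W p (\<pi> l) w ** (mat 1 + drift_increment half_Xi (\<pi> l) t w)"
proof -
  have "B_approx \<beta> W p t w = ordered_prod (Suc l)
     (\<lambda>j. mat 1 + drift_increment half_Xi (min (\<pi> j) t) (min (\<pi> (Suc j)) t) w)"
    unfolding B_approx_eq
  proof (rule ordered_prod_truncate)
    show "Suc l \<le> n" using l by simp
    fix j assume "Suc l \<le> j" "j < n"
    then have "min (\<pi> j) t = t" "min (\<pi> (Suc j)) t = t"
      using partition_mono[of "Suc l" j] partition_mono[of "Suc l" "Suc j"] l by auto
    then show "mat 1 + drift_increment half_Xi (min (\<pi> j) t) (min (\<pi> (Suc j)) t) w = mat 1"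
      by (simp add: drift_increment_def)
  qed
  also have "\<dots> = ordered_prod l (\<lambda>j. mat 1 + drift_increment half_Xi (min (\<pi> j) t) (min (\<pi> (Suc j)) t) w)
      ** (mat 1 + drift_increment half_Xi (\<pi> l) t w)"
    using l by (simp add: min_absorb1 min_absorb2)
  also have "ordered_prod l (\<lambda>j. mat 1 + drift_increment half_Xi (min (\<pi> j) t) (min (\<pi> (Suc j)) t) w)
      = B_approx \<beta> W p (\<pi> l) w"
    unfolding B_approx_at[OF less_imp_le[OF l(1)]]
  proof (rule ordered_prod_cong)
    fix j assume "j < l"
    then have "min (\<pi> j) t = \<pi> j" "min (\<pi> (Suc j)) t = \<pi> (Suc j)"
      using partition_mono[of j l] partition_mono[of "Suc j" l] l by auto
    then show "mat 1 + drift_increment half_Xi (min (\<pi> j) t) (min (\<pi> (Suc j)) t) w =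
        mat 1 + drift_increment half_Xi (\<pi> j) (\<pi> (Suc j)) w" by simp
  qed
  finally show ?thesis .
qed

text \<open>Within a cell only the current factor moves, and it is affine in the increment. Thus the
  scheme follows the equation for B with the coefficient frozen at the last point of the
  partition.\<close>

lemma B_approx_increment:
  assumes l: "l < n" "\<pi> l \<le> s" "s \<le> t" "t \<le> \<pi> (Suc l)"
  shows "B_approx \<beta> W p t w = B_approx \<beta> W p s w + B_approx \<beta> W p (\<pi> l) w ** drift_increment half_Xi s t w"
proof -
  have "drift_increment half_Xi (\<pi> l) t w = drift_increment half_Xi (\<pi> l) s w + drift_increment half_Xi s t w"
    unfolding drift_increment_def scaleR_left_diff_distrib by simp
  then show ?thesis
    using B_approx_between[of l t w] B_approx_between[of l s w] l
    by (simp add: cmat_mult.add_right add.assoc)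
qed

lemma B_approx_zero: "B_approx \<beta> W p 0 w = mat 1"
  using B_approx_at[of 0 w] partition_grid(1) by simp

lemma B_approx_sum:
  assumes "l \<le> n"
  shows "B_approx \<beta> W p (\<pi> l) w =
    mat 1 + (\<Sum>j<l. B_approx \<beta> W p (\<pi> j) w ** drift_increment half_Xi (\<pi> j) (\<pi> (Suc j)) w)"
  using assms
proof (induction l)
  case 0
  show ?case using B_approx_zero partition_grid(1) by simp
next
  case (Suc l)
  have "B_approx \<beta> W p (\<pi> (Suc l)) w = B_approx \<beta> W p (\<pi> l) w +
      B_approx \<beta> W p (\<pi> l) w ** drift_increment half_Xi (\<pi> l) (\<pi> (Suc l)) w"
    by (rule B_approx_increment) (use Suc partition_grid(3)[of l] in auto)
  then show ?case using Suc by simp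
qed

lemma B_approx_adapted_grid:
  assumes "l \<le> n"
  shows "(\<lambda>w. B_approx \<beta> W p (\<pi> l) w) \<in> borel_measurable (F (\<pi> l))"
  using assms
proof (induction l)
  case 0
  show ?case using B_approx_zero partition_grid(1) by simp
next
  case (Suc l)
  have "(\<lambda>w. B_approx \<beta> W p (\<pi> l) w) \<in> borel_measurable (F (\<pi> (Suc l)))"
    by (rule measurable_F_mono[OF Suc.IH]) (use Suc.prems partition_grid(3)[of l] in auto)
  moreover have "drift_increment half_Xi (\<pi> l) (\<pi> (Suc l)) \<in> borel_measurable (F (\<pi> (Suc l)))"
    by (rule drift_increment_adapted) (use Suc.prems partition_grid(3)[of l] partition_bounds in auto)
  ultimately have "(\<lambda>w. B_approx \<beta> W p (\<pi> l) w +
      B_approx \<beta> W p (\<pi> l) w ** drift_increment half_Xi (\<pi> l) (\<pi> (Suc l)) w) \<in> borel_measurable (F (\<pi> (Suc l)))"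
    by (intro borel_measurable_add borel_measurable_cmat_mult)
  moreover have "B_approx \<beta> W p (\<pi> (Suc l)) w = B_approx \<beta> W p (\<pi> l) w +
      B_approx \<beta> W p (\<pi> l) w ** drift_increment half_Xi (\<pi> l) (\<pi> (Suc l)) w" for w
    by (rule B_approx_increment) (use Suc.prems partition_grid(3)[of l] in auto)
  ultimately show ?case by simp
qed

end

text \<open>The scheme is I plus an adapted sum whose integrand is the scheme itself, so its 2m-th
  power is at most c |Y|^(2m) plus a constant. This is the self-referential hypothesis of
  \<open>ito_sum_moment\<close>, with constant \<phi>.\<close>

lemma B_approx_moment:
  assumes m: "1 \<le> m" and T: "0 < T"
  shows "\<exists>C\<ge>0. \<forall>p l. is_partition T p \<longrightarrow> l < length p \<longrightarrow>
     integrable M (\<lambda>w. norm (B_approx \<beta> W p (p ! l) w) ^ (2 * m)) \<and>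
     expectation (\<lambda>w. norm (B_approx \<beta> W p (p ! l) w) ^ (2 * m)) \<le> C"
proof -
  define b where "b = norm (mat 1 :: 'n cmat) ^ (2 * m)"
  have b: "0 \<le> b" by (simp add: b_def)
  define c where "c = (2::real) ^ (2 * m)"
  have c: "0 \<le> c" by (simp add: c_def)
  obtain C where C: "0 \<le> C" "\<And>g n (u :: nat \<Rightarrow> 'w \<Rightarrow> 'n cmat) \<phi>. 0 \<le> g 0 \<Longrightarrow> g n \<le> T \<Longrightarrow> (\<forall>i<n. g i < g (Suc i)) \<Longrightarrow>
     (\<forall>i<n. u i \<in> borel_measurable (F (g i))) \<Longrightarrow> (\<forall>i<n. integrable M (\<phi> i)) \<Longrightarrow>
     (\<forall>i<n. \<forall>w\<in>space M. 0 \<le> \<phi> i w \<and> norm (u i w) ^ (2 * m) \<le>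
        c * norm (\<Sum>j<i. u j w ** drift_increment half_Xi (g j) (g (Suc j)) w) ^ (2 * m) + \<phi> i w) \<Longrightarrow>
     integrable M (\<lambda>w. norm (\<Sum>j<n. u j w ** drift_increment half_Xi (g j) (g (Suc j)) w) ^ (2 * m)) \<and>
     expectation (\<lambda>w. norm (\<Sum>j<n. u j w ** drift_increment half_Xi (g j) (g (Suc j)) w) ^ (2 * m))
       \<le> C * (\<Sum>j<n. (g (Suc j) - g j) * expectation (\<phi> j))"
    using ito_sum_moment[OF m c, of T half_Xi] by blast
  define D where "D = c * (C * (T * (c * b)) + b)"
  have "integrable M (\<lambda>w. norm (B_approx \<beta> W p (p ! l) w) ^ (2 * m)) \<and>
     expectation (\<lambda>w. norm (B_approx \<beta> W p (p ! l) w) ^ (2 * m)) \<le> D"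
    if p: "is_partition T p" and l: "l < length p" for p l
  proof -
    let ?X = "\<lambda>j w. B_approx \<beta> W p (p ! j) w"
    let ?Z = "\<lambda>j. drift_increment half_Xi (p ! j) (p ! Suc j)"
    note grid = partition_grid[OF p T]
    define Y where "Y j w = (\<Sum>i<j. ?X i w ** ?Z i w)" for j w
    have X: "?X j w = mat 1 + Y j w" if "j \<le> l" for j w
      unfolding Y_def using B_approx_sum[OF p T, of j w] that l by simp
    have Xle: "norm (?X j w) ^ (2 * m) \<le> c * norm (Y j w) ^ (2 * m) + c * b" if "j \<le> l" for j w
    proof -
      have "norm (?X j w) ^ (2 * m) \<le> (norm (Y j w) + norm (mat 1 :: 'n cmat)) ^ (2 * m)"
        unfolding X[OF that] using norm_triangle_ineq[of "mat 1" "Y j w"] by (intro power_mono) auto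
      also have "\<dots> \<le> 2 ^ (2 * m) * (norm (Y j w) ^ (2 * m) + norm (mat 1 :: 'n cmat) ^ (2 * m))"
        by (rule add_power_le) auto
      finally show ?thesis by (simp add: c_def b_def algebra_simps)
    qed
    have mX: "?X j \<in> borel_measurable (F (p ! j))" if "j \<le> l" for j
      using B_approx_adapted_grid[OF p T, of j] that l by simp
    have main: "integrable M (\<lambda>w. norm (\<Sum>j<l. ?X j w ** ?Z j w) ^ (2 * m)) \<and>
       expectation (\<lambda>w. norm (\<Sum>j<l. ?X j w ** ?Z j w) ^ (2 * m))
       \<le> C * (\<Sum>j<l. (p ! Suc j - p ! j) * expectation (\<lambda>w. c * b))"
    proof (rule C(2)[of "(!) p" l ?X "\<lambda>_ _. c * b"])
      show "p ! l \<le> T" using partition_bounds(2)[OF p T, of l] l by simp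
      show "\<forall>i<l. p ! i < p ! Suc i" using grid(3) l by auto
      show "\<forall>i<l. \<forall>w\<in>space M. 0 \<le> c * b \<and> norm (?X i w) ^ (2 * m) \<le>
        c * norm (\<Sum>j<i. ?X j w ** ?Z j w) ^ (2 * m) + c * b"
        using Xle b c unfolding Y_def by auto
    qed (use grid(1) mX in auto)
    have sum_le: "(\<Sum>j<l. (p ! Suc j - p ! j) * expectation (\<lambda>w. c * b)) \<le> T * (c * b)"
    proof -
      have "(\<Sum>j<l. (p ! Suc j - p ! j) * expectation (\<lambda>w. c * b)) = (\<Sum>j<l. p ! Suc j - p ! j) * (c * b)"
        by (simp add: prob_space sum_distrib_right)
      also have "(\<Sum>j<l. p ! Suc j - p ! j) = p ! l - p ! 0" by (rule sum_lessThan_telescope)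
      also have "\<dots> \<le> T" using partition_bounds(2)[OF p T, of l] l grid(1) by simp
      finally show ?thesis using b c by (simp add: mult_right_mono)
    qed
    have iY: "integrable M (\<lambda>w. norm (Y l w) ^ (2 * m))"
      unfolding Y_def by (rule conjunct1[OF main])
    have EY: "expectation (\<lambda>w. norm (Y l w) ^ (2 * m)) \<le> C * (T * (c * b))"
      unfolding Y_def by (rule order_trans[OF conjunct2[OF main] mult_left_mono[OF sum_le C(1)]])
    have ib: "integrable M (\<lambda>w. c * norm (Y l w) ^ (2 * m) + c * b)" using iY by simp
    have i: "integrable M (\<lambda>w. norm (?X l w) ^ (2 * m))"
    proof (rule integrable_nonneg_bound[OF ib])
      show "(\<lambda>w. norm (?X l w) ^ (2 * m)) \<in> borel_measurable M"
        using measurable_F[OF mX[of l]] by measurable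
    qed (use Xle in auto)
    have "expectation (\<lambda>w. norm (?X l w) ^ (2 * m)) \<le> expectation (\<lambda>w. c * norm (Y l w) ^ (2 * m) + c * b)"
      by (rule integral_mono[OF i ib]) (rule Xle, simp)
    also have "\<dots> = c * expectation (\<lambda>w. norm (Y l w) ^ (2 * m)) + c * b"
      using iY by (simp add: prob_space)
    also have "\<dots> \<le> D" unfolding D_def distrib_left using EY c by (intro add_right_mono mult_left_mono)
    finally show ?thesis using i by simp
  qed
  moreover have "0 \<le> D" unfolding D_def using C b c T by simp
  ultimately show ?thesis by blast
qed

end

text \<open>The first dyadic time of level N after \<open>s i\<close> is at distance at most
  \<open>T / 2 ^ N\<close> and is itself a grid point, so the successor of \<open>s i\<close> comes
  no later.\<close>

lemma dyadic_grid_mesh: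
  assumes T: "0 < T" and s: "s 0 = 0" "s n = T" "\<And>i. i < n \<Longrightarrow> s i < s (Suc i)"
    and D: "dyadics T N \<subseteq> s ` {..n}" and i: "i < n"
  shows "s (Suc i) - s i \<le> T / 2 ^ N"
proof -
  have si: "0 \<le> s i" using step_mono[of n s 0 i, OF s(3)] s(1) i by (cases "i = 0") force+
  have siT: "s i < T" using step_mono[of n s i n, OF s(3)] s(2) i by auto
  define j where "j = nat \<lfloor>s i * 2 ^ N / T\<rfloor>"
  have x: "0 \<le> s i * 2 ^ N / T" using T si by simp
  have j: "real j \<le> s i * 2 ^ N / T" "s i * 2 ^ N / T < real j + 1"
    unfolding j_def using x by linarith+
  have "s i * 2 ^ N / T < 2 ^ N" using siT T by (simp add: divide_less_eq mult.commute)
  then have "real j < 2 ^ N" using j(1) by linarith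
  then have "Suc j \<le> 2 ^ N" by (metis Suc_leI of_nat_less_iff of_nat_numeral of_nat_power)
  then have "T * real (Suc j) / 2 ^ N \<in> dyadics T N"
    unfolding dyadics_def by (intro image_eqI[of _ _ "Suc j"]) simp_all
  then obtain k where k: "k \<le> n" "s k = T * real (Suc j) / 2 ^ N" using D by auto
  have lt: "s i < s k" unfolding k(2) using j(2) T by (simp add: field_simps)
  have "i < k"
  proof (rule ccontr)
    assume "\<not> i < k"
    then have "s k \<le> s i" using step_mono[of n s k i, OF s(3)] i by (cases "k = i") force+
    then show False using lt by simp
  qed
  then have "s (Suc i) \<le> s k" using step_mono[of n s "Suc i" k, OF s(3)] k(1) by (cases "Suc i = k") force+
  also have "s k \<le> s i + T / 2 ^ N" unfolding k(2) using j(1) T by (simp add: field_simps)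
  finally show ?thesis by simp
qed

section \<open>Deviation bounds, first on dyadic times and then on [0,T]\<close>

context brownian_driver
begin

lemma AE_continuous_driving_process: "AE w in M. continuous_on {0..} (\<lambda>t. driving_process \<beta> W t w)"
proof -
  have "AE w in M. \<forall>\<xi>\<in>\<beta>. continuous_on {0..} (\<lambda>t. W \<xi> t w)"
    using brownian by (intro AE_finite_allI finite_basis) (auto simp: standard_brownian_motion_def)
  then show ?thesis
  proof eventually_elim
    case (elim w)
    then show ?case unfolding driving_process_def by (intro continuous_intros) auto
  qed
qed

lemma continuous_on_ordered_prod:
  fixes f :: "nat \<Rightarrow> 'x::topological_space \<Rightarrow> 'n cmat"
  assumes "\<And>j. j < n \<Longrightarrow> continuous_on S (f j)"
  shows "continuous_on S (\<lambda>t. ordered_prod n (\<lambda>j. f j t))"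
  using assms by (induction n) (auto intro!: cmat_mult.continuous_on)

lemma continuous_on_B_approx:
  assumes p: "is_partition T p" and T: "0 < T"
    and L: "continuous_on {0..} (\<lambda>t. driving_process \<beta> W t w)"
  shows "continuous_on {0..T} (\<lambda>t. B_approx \<beta> W p t w)"
proof -
  have "continuous_on {0..T} (\<lambda>t. driving_process \<beta> W (min (p ! j) t) w)" if "j < length p" for j
  proof (rule continuous_on_compose2[OF L])
    show "continuous_on {0..T} (\<lambda>t. min (p ! j) t)" by (intro continuous_intros)
    show "(\<lambda>t. min (p ! j) t) ` {0..T} \<subseteq> {0..}"
      using partition_bounds(1)[OF p T, of j] that by (auto simp: min_def)
  qed
  then show ?thesis
    unfolding B_approx_def by (intro continuous_on_ordered_prod continuous_intros) auto
qed

text \<open>K may depend neither on p nor on N; what depends on p is absorbed by N0. The defect is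
  required to stay below \<delta> \<le> sqrt(mesh p) outside an event of probability mesh(p)^m.
  \<open>euler_defect\<close> grants this once the fine grid, made of the points of p and
  \<open>dyadics T N\<close>, has mesh at most some \<mu>, which holds for all large N.\<close>

lemma B_approx_deviation_grid:
  assumes bm: "group_brownian_motion M \<beta> W B" and T: "0 < T" and m: "1 \<le> m" and \<epsilon>: "0 < \<epsilon>"
  shows "\<exists>K\<ge>0. \<forall>p. is_partition T p \<longrightarrow> (\<exists>N0. \<forall>N\<ge>N0.
    outer_prob_le M (\<lambda>w. \<exists>t\<in>dyadics T N. 2 * \<epsilon> < norm (B_approx \<beta> W p t w - B t w)) (K * mesh p ^ m))"
proof -
  have mB: "\<And>t. 0 \<le> t \<Longrightarrow> B t \<in> borel_measurable (F t)"
    using bm unfolding group_brownian_motion_def continuous_adapted_def by blast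
  define c where "c = (2::real) ^ (2 * m)"
  have c: "0 \<le> c" by (simp add: c_def)
  obtain C where C: "0 \<le> C" "\<And>g n (u :: nat \<Rightarrow> 'w \<Rightarrow> 'n cmat) \<phi> a \<epsilon>. 0 \<le> g 0 \<Longrightarrow> g n \<le> T \<Longrightarrow> (\<forall>i<n. g i < g (Suc i)) \<Longrightarrow>
     (\<forall>i<n. u i \<in> borel_measurable (F (g i))) \<Longrightarrow> (\<forall>i<n. integrable M (\<phi> i)) \<Longrightarrow>
     (\<forall>i<n. {w\<in>space M. a i w} \<in> sets (F (g i))) \<Longrightarrow> 0 < \<epsilon> \<Longrightarrow>
     (\<forall>i<n. \<forall>w\<in>space M. 0 \<le> \<phi> i w \<and> ((\<forall>j\<le>i. a j w) \<longrightarrow> norm (u i w) ^ (2 * m) \<le>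
        c * norm (\<Sum>j<i. u j w ** drift_increment half_Xi (g j) (g (Suc j)) w) ^ (2 * m) + \<phi> i w)) \<Longrightarrow>
     outer_prob_le M (\<lambda>w. (\<forall>i<n. a i w) \<and>
         (\<exists>i\<le>n. \<epsilon> < norm (\<Sum>j<i. u j w ** drift_increment half_Xi (g j) (g (Suc j)) w)))
       (C * (\<Sum>j<n. (g (Suc j) - g j) * expectation (\<phi> j)) / \<epsilon> ^ (2 * m))"
    using ito_sum_maximal[OF m c, of T half_Xi] by blast
  obtain C2 where C2: "0 \<le> C2" "\<And>p l. is_partition T p \<Longrightarrow> l < length p \<Longrightarrow>
     integrable M (\<lambda>w. norm (B_approx \<beta> W p (p ! l) w) ^ (2 * m)) \<and>
     expectation (\<lambda>w. norm (B_approx \<beta> W p (p ! l) w) ^ (2 * m)) \<le> C2"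
    using B_approx_moment[OF m T] by blast
  obtain C3 where C3: "0 \<le> C3" "\<And>s t f. 0 \<le> s \<Longrightarrow> s < t \<Longrightarrow> t \<le> T \<Longrightarrow> f \<in> borel_measurable (F s) \<Longrightarrow> integrable M f \<Longrightarrow>
     (\<forall>w\<in>space M. 0 \<le> f w) \<Longrightarrow>
     integrable M (\<lambda>w. f w * norm (drift_increment half_Xi s t w) ^ (2 * m)) \<and>
     expectation (\<lambda>w. f w * norm (drift_increment half_Xi s t w) ^ (2 * m)) \<le> C3 * (t - s) ^ m * expectation f"
    using drift_increment_moment[of T half_Xi m] by blast
  \<comment> \<open>The quotient comes from \<open>ito_sum_maximal\<close>, where
    \<open>T * (c * (c * (1 + C3 * C2)))\<close> times mesh(p)^m bounds the weighted sum of the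
    expectations of \<phi>; the 1 pays for the event that the defect is large.\<close>
  define K where "K = C * (T * (c * (c * (1 + C3 * C2)))) / \<epsilon> ^ (2 * m) + 1"
  have K: "0 \<le> K" unfolding K_def using C(1) C2(1) C3(1) c T \<epsilon> by simp
  have "\<exists>N0. \<forall>N\<ge>N0. outer_prob_le M (\<lambda>w. \<exists>t\<in>dyadics T N. 2 * \<epsilon> < norm (B_approx \<beta> W p t w - B t w)) (K * mesh p ^ m)"
    if p: "is_partition T p" for p
  proof -
    define n where "n = length p - 1"
    let ?E = "B_approx \<beta> W p"
    let ?h = "mesh p ^ m"
    note grid = partition_grid[OF p T, folded n_def]
    note bounds = partition_bounds[OF p T, folded n_def]
    have lenp: "length p = Suc n" using grid(5) by (simp add: n_def)
    have h: "0 < ?h" using grid(7) by simp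
    \<comment> \<open>While |\<rho>| \<le> \<delta> \<le> \<epsilon>, a deviation |Y + \<rho>| > 2
      \<epsilon> forces |Y| > \<epsilon>. The bound by sqrt(mesh p) makes \<delta>^(2m) at most
      mesh(p)^m, the scale of the error from freezing the coefficient.\<close>
    define \<delta> where "\<delta> = min \<epsilon> (sqrt (mesh p))"
    have \<delta>: "0 < \<delta>" "\<delta> \<le> \<epsilon>" using \<epsilon> grid(7) by (auto simp: \<delta>_def)
    have \<delta>h: "\<delta> ^ (2 * m) \<le> ?h"
    proof -
      have "\<delta> ^ (2 * m) \<le> sqrt (mesh p) ^ (2 * m)"
        using \<delta>(1) by (intro power_mono) (auto simp: \<delta>_def)
      also have "\<dots> = ?h" using grid(7) by (simp add: power_mult)
      finally show ?thesis .
    qed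
    obtain \<mu> where \<mu>: "0 < \<mu>" "\<And>s n. s 0 = 0 \<Longrightarrow> s n = T \<Longrightarrow> (\<And>i. i < n \<Longrightarrow> s i < s (Suc i)) \<Longrightarrow>
      (\<And>i. i < n \<Longrightarrow> s (Suc i) - s i \<le> \<mu>) \<Longrightarrow>
      outer_prob_le M (\<lambda>w. \<exists>k\<le>n. \<delta> < norm (mat 1 +
        (\<Sum>i<k. B (s i) w ** drift_increment half_Xi (s i) (s (Suc i)) w) - B (s k) w)) ?h"
      using euler_defect[OF bm T \<delta>(1) h] by blast
    obtain N0 where N0: "T / \<mu> < 2 ^ N0" using real_arch_pow[of 2 "T / \<mu>"] by auto
    have "outer_prob_le M (\<lambda>w. \<exists>t\<in>dyadics T N. 2 * \<epsilon> < norm (?E t w - B t w)) (K * ?h)"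
      if N: "N0 \<le> N" for N
    proof -
      define S where "S = set p \<union> dyadics T N"
      have pS: "set p \<subseteq> {0..T}" unfolding grid(4)[symmetric] using bounds by auto
      have S: "finite S" "0 \<in> S" "T \<in> S" "S \<subseteq> {0..T}"
        using dyadics[OF T, of N] pS by (auto simp: S_def)
      obtain s k where s: "s 0 = 0" "s k = T" "\<And>i. i < k \<Longrightarrow> s i < s (Suc i)" "s ` {..k} = S"
        using finite_set_enumeration[OF S] by blast
      have s0: "0 \<le> s i" "s i \<le> T" if "i \<le> k" for i
      proof -
        have "s i \<in> S" using that unfolding s(4)[symmetric] by (intro imageI) simp
        then show "0 \<le> s i" "s i \<le> T" using S(4) by auto
      qed
      have mesh: "s (Suc i) - s i \<le> \<mu>" if "i < k" for i
      proof -
        have "s (Suc i) - s i \<le> T / 2 ^ N"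
          by (rule dyadic_grid_mesh[where n=k]) (use T s that in \<open>auto simp: S_def\<close>)
        also have "\<dots> \<le> \<mu>"
        proof -
          have "T / \<mu> \<le> 2 ^ N" using N0 power_increasing[OF N, of "2::real"] by linarith
          then show ?thesis using \<mu>(1) by (simp add: field_simps)
        qed
        finally show ?thesis .
      qed
      \<comment> \<open>The fine grid contains all points of p, so each of its cells lies in a
        single cell of p.\<close>
      have "\<exists>l<n. p ! l \<le> s i \<and> s (Suc i) \<le> p ! Suc l" if i: "i < k" for i
      proof -
        have "p ! 0 < s (Suc i)" "s (Suc i) \<le> p ! n"
          using s(3)[OF i] s0[of i] s0[of "Suc i"] i grid(1,2) by auto
        then obtain l where l: "l < n" "p ! l < s (Suc i)" "s (Suc i) \<le> p ! Suc l" by (rule step_fun_cases)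
        have "p ! l \<in> s ` {..k}" unfolding s(4) S_def using l(1) lenp by simp
        then obtain j where j: "j \<le> k" "p ! l = s j" by auto
        have "j \<le> i"
        proof (rule ccontr)
          assume "\<not> j \<le> i"
          then have "s (Suc i) \<le> s j" using step_mono[of k s "Suc i" j, OF s(3)] j(1) by (cases "Suc i = j") force+
          then show False using l(2) j(2) by simp
        qed
        then have "s j \<le> s i" using step_mono[of k s j i, OF s(3)] i by (cases "j = i") force+
        then show ?thesis using l j(2) by auto
      qed
      then obtain l where l: "\<And>i. i < k \<Longrightarrow> l i < n" "\<And>i. i < k \<Longrightarrow> p ! l i \<le> s i"
        "\<And>i. i < k \<Longrightarrow> s (Suc i) \<le> p ! Suc (l i)" by metis
      let ?Z = "\<lambda>i. drift_increment half_Xi (s i) (s (Suc i))"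
      have E: "?E (s j) w = mat 1 + (\<Sum>i<j. ?E (p ! l i) w ** ?Z i w)" if "j \<le> k" for j w
        using that
      proof (induction j)
        case 0
        show ?case using B_approx_zero[OF p T] s(1) by simp
      next
        case (Suc j)
        have "?E (s (Suc j)) w = ?E (s j) w + ?E (p ! l j) w ** ?Z j w"
          by (rule B_approx_increment[OF p T, folded n_def]) (use l[of j] s(3)[of j] Suc.prems in auto)
        then show ?case using Suc by simp
      qed
      define \<rho> where "\<rho> j w = mat 1 + (\<Sum>i<j. B (s i) w ** ?Z i w) - B (s j) w" for j w
      define u where "u i w = ?E (p ! l i) w - B (s i) w" for i w
      define Y where "Y j w = (\<Sum>i<j. u i w ** ?Z i w)" for j w
      have D: "?E (s j) w - B (s j) w = Y j w + \<rho> j w" if "j \<le> k" for j w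
        unfolding E[OF that] Y_def \<rho>_def u_def by (simp add: cmat_mult.diff_left sum_subtractf)
      \<comment> \<open>\<open>R\<close> dominates the 2m-th power of the change of the scheme since
        the last point of p. The two factors c in \<phi> come from separating three summands by two
        uses of \<open>add_power_le\<close>.\<close>
      define R where "R i w = norm (?E (p ! l i) w) ^ (2 * m) * norm (drift_increment half_Xi (p ! l i) (s i) w) ^ (2 * m)" for i w
      define \<phi> where "\<phi> i w = c * (c * (\<delta> ^ (2 * m) + R i w))" for i w
      have mE: "?E (p ! l i) \<in> borel_measurable (F (p ! l i))" if "i < k" for i
        by (rule B_approx_adapted_grid[OF p T, folded n_def]) (use l(1)[OF that] in simp)
      have mu: "u i \<in> borel_measurable (F (s i))" if i: "i < k" for i
      proof -
        have "?E (p ! l i) \<in> borel_measurable (F (s i))" by (rule measurable_F_mono[OF mE[OF i] l(2)[OF i]])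
        moreover have "B (s i) \<in> borel_measurable (F (s i))" using mB s0 i by auto
        ultimately show ?thesis unfolding u_def[abs_def] by measurable
      qed
      have ma: "{w\<in>space M. norm (\<rho> i w) \<le> \<delta>} \<in> sets (F (s i))" if i: "i < k" for i
      proof -
        have [measurable]: "(\<lambda>w. \<Sum>j<i. B (s j) w ** ?Z j w) \<in> borel_measurable (F (s i))"
          by (rule ito_sum_adapted[where n=k]) (use s s0 mB i in auto)
        have [measurable]: "B (s i) \<in> borel_measurable (F (s i))" using mB s0 i by auto
        have "(\<lambda>w. norm (\<rho> i w)) \<in> borel_measurable (F (s i))" unfolding \<rho>_def by measurable
        then have "{w\<in>space (F (s i)). norm (\<rho> i w) \<le> \<delta>} \<in> sets (F (s i))" by measurable
        then show ?thesis by simp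
      qed
      have R: "integrable M (R i)" "expectation (R i) \<le> C3 * C2 * ?h" if i: "i < k" for i
      proof -
        have E2: "integrable M (\<lambda>w. norm (?E (p ! l i) w) ^ (2 * m))"
          "expectation (\<lambda>w. norm (?E (p ! l i) w) ^ (2 * m)) \<le> C2"
          using C2(2)[OF p, of "l i"] l(1)[OF i] lenp by auto
        have "integrable M (R i) \<and> expectation (R i) \<le> C3 * C2 * ?h"
        \<comment> \<open>\<open>drift_increment_moment\<close> is about increments over a positive
          time. At a point of p no time has elapsed, and R vanishes because m \<ge> 1.\<close>
        proof (cases "p ! l i = s i")
          case True
          then have "R i w = 0" for w using m by (simp add: R_def drift_increment_def power_0_left)
          then have "R i = (\<lambda>_. 0)" by auto
          then show ?thesis using C2(1) C3(1) h by simp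
        next
          case False
          then have lt: "p ! l i < s i" using l(2)[OF i] by simp
          have mf: "(\<lambda>w. norm (?E (p ! l i) w) ^ (2 * m)) \<in> borel_measurable (F (p ! l i))"
            using mE[OF i] by measurable
          have 1: "integrable M (R i)" and
            2: "expectation (R i) \<le> C3 * (s i - p ! l i) ^ m * expectation (\<lambda>w. norm (?E (p ! l i) w) ^ (2 * m))"
            using C3(2)[OF bounds(1)[of "l i"] lt s0(2)[of i] mf E2(1)] l(1)[OF i] i unfolding R_def[abs_def] by auto
          have "s i - p ! l i \<le> mesh p"
            using grid(6)[OF l(1)[OF i]] l(3)[OF i] s(3)[OF i] by linarith
          then have "(s i - p ! l i) ^ m \<le> ?h" using lt by (intro power_mono) auto
          then have "C3 * (s i - p ! l i) ^ m * expectation (\<lambda>w. norm (?E (p ! l i) w) ^ (2 * m)) \<le> C3 * ?h * C2"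
            using C3(1) E2(2) lt h by (intro mult_mono mult_left_mono) (auto intro!: integral_nonneg_AE)
          with 1 2 show ?thesis by (simp add: mult_ac)
        qed
        then show "integrable M (R i)" "expectation (R i) \<le> C3 * C2 * ?h" by auto
      qed
      have i\<phi>: "integrable M (\<phi> i)" if "i < k" for i
        unfolding \<phi>_def[abs_def] using R(1)[OF that] by simp
      have E\<phi>: "expectation (\<phi> i) \<le> c * (c * (1 + C3 * C2)) * ?h" if i: "i < k" for i
      proof -
        have "expectation (\<phi> i) = c * (c * (\<delta> ^ (2 * m) + expectation (R i)))"
          unfolding \<phi>_def[abs_def] using R(1)[OF i] by (simp add: prob_space)
        also have "\<dots> \<le> c * (c * (?h + C3 * C2 * ?h))"
          using \<delta>h R(2)[OF i] c by (intro mult_left_mono add_mono) auto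
        finally show ?thesis by (simp add: algebra_simps)
      qed
      have sum: "(\<Sum>j<k. (s (Suc j) - s j) * expectation (\<phi> j)) \<le> T * (c * (c * (1 + C3 * C2))) * ?h"
      proof -
        have "(\<Sum>j<k. (s (Suc j) - s j) * expectation (\<phi> j)) \<le> (\<Sum>j<k. (s (Suc j) - s j) * (c * (c * (1 + C3 * C2)) * ?h))"
          using E\<phi> s(3) by (intro sum_mono mult_left_mono) (auto simp: less_imp_le)
        also have "\<dots> = (\<Sum>j<k. s (Suc j) - s j) * (c * (c * (1 + C3 * C2)) * ?h)"
          by (rule sum_distrib_right[symmetric])
        also have "(\<Sum>j<k. s (Suc j) - s j) = T" using sum_lessThan_telescope[of s k] s(1,2) by simp
        finally show ?thesis by (simp only: mult.assoc)
      qed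
      have bound: "0 \<le> \<phi> i w \<and> ((\<forall>j\<le>i. norm (\<rho> j w) \<le> \<delta>) \<longrightarrow>
          norm (u i w) ^ (2 * m) \<le> c * norm (Y i w) ^ (2 * m) + \<phi> i w)" if i: "i < k" for i w
      proof (intro conjI impI)
        have R0: "0 \<le> R i w" by (simp add: R_def)
        then show "0 \<le> \<phi> i w" unfolding \<phi>_def using c \<delta> by simp
        assume "\<forall>j\<le>i. norm (\<rho> j w) \<le> \<delta>"
        then have \<rho>: "norm (\<rho> i w) \<le> \<delta>" by simp
        define r where "r = ?E (p ! l i) w ** drift_increment half_Xi (p ! l i) (s i) w"
        have r: "norm r ^ (2 * m) \<le> R i w"
          unfolding R_def r_def power_mult_distrib[symmetric] by (intro power_mono norm_cmat_mult norm_ge_zero)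
        have "?E (s i) w = ?E (p ! l i) w + r"
          unfolding r_def by (rule B_approx_increment[OF p T, folded n_def]) (use l[OF i] s(3)[OF i] in auto)
        then have u_eq: "u i w = Y i w + (\<rho> i w - r)"
          unfolding u_def using D[of i w] i by (simp add: algebra_simps)
        have "norm (\<rho> i w - r) \<le> \<delta> + norm r"
          using norm_triangle_ineq4[of "\<rho> i w" r] \<rho> by linarith
        then have "norm (u i w) \<le> norm (Y i w) + (\<delta> + norm r)"
          unfolding u_eq using norm_triangle_ineq[of "Y i w" "\<rho> i w - r"] by linarith
        then have "norm (u i w) ^ (2 * m) \<le> (norm (Y i w) + (\<delta> + norm r)) ^ (2 * m)" by (rule power_mono) simp
        also have "\<dots> \<le> c * (norm (Y i w) ^ (2 * m) + (\<delta> + norm r) ^ (2 * m))"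
          unfolding c_def using \<delta> by (intro add_power_le) auto
        also have "(\<delta> + norm r) ^ (2 * m) \<le> c * (\<delta> ^ (2 * m) + norm r ^ (2 * m))"
          unfolding c_def using \<delta> by (intro add_power_le) auto
        also have "c * (\<delta> ^ (2 * m) + norm r ^ (2 * m)) \<le> c * (\<delta> ^ (2 * m) + R i w)"
          using r c by (intro mult_left_mono) auto
        finally show "norm (u i w) ^ (2 * m) \<le> c * norm (Y i w) ^ (2 * m) + \<phi> i w"
          using c by (simp add: \<phi>_def distrib_left mult_left_mono)
      qed
      have 1: "outer_prob_le M (\<lambda>w. (\<forall>i<k. norm (\<rho> i w) \<le> \<delta>) \<and> (\<exists>i\<le>k. \<epsilon> < norm (Y i w)))
          (C * (\<Sum>j<k. (s (Suc j) - s j) * expectation (\<phi> j)) / \<epsilon> ^ (2 * m))"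
        unfolding Y_def
      proof (rule C(2))
        show "\<forall>i<k. \<forall>w\<in>space M. 0 \<le> \<phi> i w \<and> ((\<forall>j\<le>i. norm (\<rho> j w) \<le> \<delta>) \<longrightarrow> norm (u i w) ^ (2 * m) \<le>
            c * norm (\<Sum>j<i. u j w ** ?Z j w) ^ (2 * m) + \<phi> i w)"
          using bound unfolding Y_def by blast
      qed (use s mu i\<phi> ma \<epsilon> in auto)
      have 2: "outer_prob_le M (\<lambda>w. \<exists>j\<le>k. \<delta> < norm (\<rho> j w)) ?h"
        unfolding \<rho>_def by (rule \<mu>(2)[OF s(1-3) mesh])
      have le: "C * (\<Sum>j<k. (s (Suc j) - s j) * expectation (\<phi> j)) / \<epsilon> ^ (2 * m) + ?h \<le> K * ?h"
      proof -
        have "C * (\<Sum>j<k. (s (Suc j) - s j) * expectation (\<phi> j)) / \<epsilon> ^ (2 * m)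
            \<le> C * (T * (c * (c * (1 + C3 * C2))) * ?h) / \<epsilon> ^ (2 * m)"
          using \<epsilon> by (intro divide_right_mono mult_left_mono sum C(1)) auto
        then show ?thesis by (simp add: K_def distrib_right mult.assoc)
      qed
      show ?thesis
      proof (rule outer_prob_le_mono[OF outer_prob_le_disj[OF 1 2] _ le])
        fix w assume "\<exists>t\<in>dyadics T N. 2 * \<epsilon> < norm (?E t w - B t w)"
        then obtain t where t: "t \<in> dyadics T N" "2 * \<epsilon> < norm (?E t w - B t w)" by blast
        have "t \<in> s ` {..k}" unfolding s(4) S_def using t(1) by simp
        then obtain j where j: "j \<le> k" "t = s j" by auto
        have *: "2 * \<epsilon> < norm (Y j w + \<rho> j w)" using t(2) D[OF j(1)] j(2) by simp
        show "((\<forall>i<k. norm (\<rho> i w) \<le> \<delta>) \<and> (\<exists>i\<le>k. \<epsilon> < norm (Y i w))) \<or> (\<exists>j\<le>k. \<delta> < norm (\<rho> j w))"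
        proof (cases "\<exists>j\<le>k. \<delta> < norm (\<rho> j w)")
          case False
          then have \<rho>: "norm (\<rho> i w) \<le> \<delta>" if "i \<le> k" for i using that by (auto simp: not_less)
          have "\<epsilon> < norm (Y j w)"
            using * norm_triangle_ineq[of "Y j w" "\<rho> j w"] \<rho>[OF j(1)] \<delta>(2) by linarith
          then show ?thesis using \<rho> j(1) by auto
        qed simp
      qed
    qed
    then show ?thesis by blast
  qed
  then show ?thesis using K by blast
qed

text \<open>The dyadic events increase with N and their bound does not depend on N, so it passes to
  the union. By continuity of both paths, a strict deviation at some t persists at a nearby dyadic
  time.\<close>

lemma B_approx_deviation:
  assumes bm: "group_brownian_motion M \<beta> W B" and T: "0 < T" and m: "1 \<le> m" and \<epsilon>: "0 < \<epsilon>"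
  shows "\<exists>K\<ge>0. \<forall>p. is_partition T p \<longrightarrow>
    outer_prob_le M (\<lambda>w. \<exists>t\<in>{0..T}. 2 * \<epsilon> < norm (B_approx \<beta> W p t w - B t w)) (K * mesh p ^ m)"
proof -
  obtain K where K: "0 \<le> K" "\<And>p. is_partition T p \<Longrightarrow> \<exists>N0. \<forall>N\<ge>N0.
    outer_prob_le M (\<lambda>w. \<exists>t\<in>dyadics T N. 2 * \<epsilon> < norm (B_approx \<beta> W p t w - B t w)) (K * mesh p ^ m)"
    using B_approx_deviation_grid[OF assms] by blast
  have cB: "AE w in M. continuous_on {0..} (\<lambda>t. B t w)"
    using bm unfolding group_brownian_motion_def continuous_adapted_def by blast
  have "outer_prob_le M (\<lambda>w. \<exists>t\<in>{0..T}. 2 * \<epsilon> < norm (B_approx \<beta> W p t w - B t w)) (K * mesh p ^ m)"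
    if p: "is_partition T p" for p
  proof -
    define D where "D t w = B_approx \<beta> W p t w - B t w" for t w
    obtain N0 where N0: "\<And>N. N0 \<le> N \<Longrightarrow>
      outer_prob_le M (\<lambda>w. \<exists>t\<in>dyadics T N. 2 * \<epsilon> < norm (D t w)) (K * mesh p ^ m)"
      using K(2)[OF p] unfolding D_def by blast
    \<comment> \<open>Starting at level N0 loses nothing: by nesting, every dyadic time reappears at
      all later levels.\<close>
    have "outer_prob_le M (\<lambda>w. \<exists>N. \<exists>t\<in>dyadics T (N0 + N). 2 * \<epsilon> < norm (D t w)) (K * mesh p ^ m)"
    proof (rule outer_prob_le_Ex_incseq)
      show "\<exists>t\<in>dyadics T (N0 + Suc N). 2 * \<epsilon> < norm (D t w)"
        if "\<exists>t\<in>dyadics T (N0 + N). 2 * \<epsilon> < norm (D t w)" for N w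
        using that dyadics(5)[OF T, of "N0 + N"] by auto
    qed (simp add: N0)
    moreover have "outer_prob_le M (\<lambda>w. \<not> (continuous_on {0..} (\<lambda>t. driving_process \<beta> W t w) \<and>
        continuous_on {0..} (\<lambda>t. B t w))) 0"
      using cB AE_continuous_driving_process by (intro outer_prob_le_AE) auto
    ultimately have "outer_prob_le M (\<lambda>w. (\<exists>N. \<exists>t\<in>dyadics T (N0 + N). 2 * \<epsilon> < norm (D t w)) \<or>
      \<not> (continuous_on {0..} (\<lambda>t. driving_process \<beta> W t w) \<and> continuous_on {0..} (\<lambda>t. B t w))) (K * mesh p ^ m + 0)"
      by (rule outer_prob_le_disj)
    then have "outer_prob_le M (\<lambda>w. \<exists>t\<in>{0..T}. 2 * \<epsilon> < norm (D t w)) (K * mesh p ^ m)"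
    proof (rule outer_prob_le_mono)
      fix w assume "\<exists>t\<in>{0..T}. 2 * \<epsilon> < norm (D t w)"
      then obtain t where t: "t \<in> {0..T}" "2 * \<epsilon> < norm (D t w)" by blast
      show "(\<exists>N. \<exists>t\<in>dyadics T (N0 + N). 2 * \<epsilon> < norm (D t w)) \<or>
        \<not> (continuous_on {0..} (\<lambda>t. driving_process \<beta> W t w) \<and> continuous_on {0..} (\<lambda>t. B t w))"
      proof (rule disjCI)
        assume "\<not> \<not> (continuous_on {0..} (\<lambda>t. driving_process \<beta> W t w) \<and> continuous_on {0..} (\<lambda>t. B t w))"
        then have "continuous_on {0..T} (\<lambda>t. D t w)"
          unfolding D_def
          by (intro continuous_on_diff continuous_on_B_approx[OF p T]) (auto elim: continuous_on_subset)
        moreover have "0 < norm (D t w) - 2 * \<epsilon>" using t(2) by simp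
        ultimately obtain d where d: "0 < d" "\<And>x. x \<in> {0..T} \<Longrightarrow> dist x t < d \<Longrightarrow> dist (D x w) (D t w) < norm (D t w) - 2 * \<epsilon>"
          using t(1) unfolding continuous_on_iff by metis
        obtain N x where x: "x \<in> dyadics T N" "\<bar>x - t\<bar> < d"
          by (rule dyadic_near[of T t d]) (use T t d in auto)
        have "dyadics T N \<subseteq> dyadics T (N + k)" for k
          by (induction k) (use dyadics(5)[OF T] in auto)
        then have "x \<in> dyadics T (N0 + N)" using x(1) by (metis add.commute subsetD)
        moreover have "2 * \<epsilon> < norm (D x w)"
        proof -
          have "dist (D x w) (D t w) < norm (D t w) - 2 * \<epsilon>"
            using d(2)[of x] x dyadics(4)[OF T, of N] by (auto simp: dist_real_def)
          then show ?thesis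
            using norm_triangle_ineq2[of "D t w" "D x w"] by (simp add: dist_norm norm_minus_commute)
        qed
        ultimately show "\<exists>N. \<exists>t\<in>dyadics T (N0 + N). 2 * \<epsilon> < norm (D t w)" by blast
      qed
    qed simp
    then show ?thesis by (simp add: D_def)
  qed
  then show ?thesis using K(1) by blast
qed

end

section \<open>From deviation bounds to almost sure convergence\<close>

lemma normalized_norm_le_norm: "normalized_norm (A :: 'n::finite cmat) \<le> norm A"
proof -
  have cnj: "cnj z * z = complex_of_real ((norm z)\<^sup>2)" for z
    unfolding complex_norm_square by (rule mult.commute)
  have entry: "(conj_transpose A ** A) $ i $ i = (\<Sum>k\<in>UNIV. complex_of_real ((norm (A $ k $ i))\<^sup>2))" for i
    by (simp only: matrix_matrix_mult_def conj_transpose_def vec_lambda_beta cnj)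
  have "Re (trace (conj_transpose A ** A)) = (\<Sum>i\<in>UNIV. \<Sum>k\<in>UNIV. (norm (A $ k $ i))\<^sup>2)"
    unfolding trace_def entry by simp
  also have "\<dots> = (norm A)\<^sup>2" unfolding norm_cmat_power2 by (rule sum.swap)
  \<comment> \<open>The normalized norm is the Frobenius norm divided by the square root of the
    matrix size.\<close>
  finally have "normalized_norm A = sqrt ((norm A)\<^sup>2 / real CARD('n))" by (simp add: normalized_norm_def)
  also have "\<dots> \<le> sqrt ((norm A)\<^sup>2)"
  proof (rule real_sqrt_le_mono)
    have "1 \<le> real CARD('n)" by (simp add: Suc_le_eq)
    then have "(norm A)\<^sup>2 * 1 \<le> (norm A)\<^sup>2 * real CARD('n)" by (intro mult_left_mono) auto
    then show "(norm A)\<^sup>2 / real CARD('n) \<le> (norm A)\<^sup>2" by (simp add: divide_le_eq)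
  qed
  finally show ?thesis by simp
qed

text \<open>Pairing a linear relation with v isolates the coefficient of v, so \<beta> is
  independent and hence finite. The laws of \<open>ip\<close> hold only on V, so all vectors
  involved have to be kept inside V.\<close>

lemma finite_orthonormal_basis:
  fixes \<beta> :: "'a::euclidean_space set"
  assumes ip: "real_inner_product_on V ip" and \<beta>: "orthonormal_basis_of V ip \<beta>"
  shows "finite \<beta>"
proof -
  have \<beta>V: "\<beta> \<subseteq> V" and "span \<beta> = V" using \<beta> by (auto simp: orthonormal_basis_of_def)
  then have V: "subspace V" using subspace_span by metis
  have orth: "ip \<xi> \<eta> = (if \<xi> = \<eta> then 1 else 0)" if "\<xi> \<in> \<beta>" "\<eta> \<in> \<beta>" for \<xi> \<eta>
    using \<beta> that by (auto simp: orthonormal_basis_of_def)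
  have add: "ip (x + y) z = ip x z + ip y z" if "x \<in> V" "y \<in> V" "z \<in> V" for x y z
    using ip that by (auto simp: real_inner_product_on_def)
  have scale: "ip (r *\<^sub>R x) y = r * ip x y" if "x \<in> V" "y \<in> V" for r x y
    using ip that by (auto simp: real_inner_product_on_def)
  have ip_sum: "ip (\<Sum>x\<in>S. u x *\<^sub>R x) v = (\<Sum>x\<in>S. u x * ip x v)"
    if "finite S" "S \<subseteq> V" "v \<in> V" for S u v
    using that
  proof (induction S)
    case empty
    show ?case using scale[of v v 0] empty.prems by simp
  next
    case (insert x S)
    have V': "(\<Sum>x\<in>S. u x *\<^sub>R x) \<in> V" "u x *\<^sub>R x \<in> V" "x \<in> V" "v \<in> V"
      using insert.prems by (auto intro!: subspace_sum[OF V] subspace_scale[OF V])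
    have "ip (\<Sum>x\<in>insert x S. u x *\<^sub>R x) v = ip (u x *\<^sub>R x + (\<Sum>x\<in>S. u x *\<^sub>R x)) v"
      using insert.hyps by simp
    also have "\<dots> = u x * ip x v + ip (\<Sum>x\<in>S. u x *\<^sub>R x) v"
      unfolding add[OF V'(2,1,4)] scale[OF V'(3,4)] ..
    also have "ip (\<Sum>x\<in>S. u x *\<^sub>R x) v = (\<Sum>x\<in>S. u x * ip x v)"
      using insert.IH insert.prems by simp
    finally show ?case using insert.hyps by simp
  qed
  have "independent \<beta>"
    unfolding independent_explicit_module
  proof (intro allI impI)
    fix S u v assume S: "finite S" "S \<subseteq> \<beta>" and 0: "(\<Sum>x\<in>S. u x *\<^sub>R x) = 0" and v: "v \<in> S"
    have "u v = (\<Sum>x\<in>S. if x = v then u x else 0)" using S v by simp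
    also have "\<dots> = (\<Sum>x\<in>S. u x * ip x v)"
    proof (rule sum.cong[OF refl])
      fix x assume "x \<in> S"
      then have "x \<in> \<beta>" "v \<in> \<beta>" using S v by blast+
      then show "(if x = v then u x else 0) = u x * ip x v" by (simp add: orth)
    qed
    also have "\<dots> = ip (\<Sum>x\<in>S. u x *\<^sub>R x) v" using S v \<beta>V by (intro ip_sum[symmetric]) auto
    also have "\<dots> = 0" unfolding 0 using scale[of v v 0] S v \<beta>V by auto
    finally show "u v = 0" .
  qed
  then show ?thesis by (rule independent_imp_finite)
qed

text \<open>Summable terms tend to 0, so eventually x k \<le> 1, and there a larger exponent gives a
  smaller power.\<close>

lemma summable_power_of_summable_powr:
  fixes x :: "nat \<Rightarrow> real"
  assumes summable: "summable (\<lambda>k. x k powr \<alpha>)" and pos: "\<And>k. 0 < x k"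
    and \<alpha>: "0 < \<alpha>" "\<alpha> \<le> real m"
  shows "summable (\<lambda>k. x k ^ m)"
proof (rule summable_comparison_test_ev[OF _ summable])
  have "\<forall>\<^sub>F k in sequentially. x k powr \<alpha> < 1"
    by (rule order_tendstoD(2)[OF summable_LIMSEQ_zero[OF summable] zero_less_one])
  then show "\<forall>\<^sub>F k in sequentially. norm (x k ^ m) \<le> x k powr \<alpha>"
  proof eventually_elim
    case (elim k)
    have "x k \<le> 1"
    proof (rule ccontr)
      assume "\<not> x k \<le> 1"
      then have "1 \<le> x k powr \<alpha>" using \<alpha> by (intro ge_one_powr_ge_zero) auto
      then show False using elim by simp
    qed
    then have "x k powr real m \<le> x k powr \<alpha>" using pos[of k] \<alpha> by (intro powr_mono') auto
    then show ?case using pos[of k] by (simp add: powr_realpow)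
  qed
qed

theorem corollary1p12:
  fixes G :: "'n::finite cmat set"
    and ip :: "'n cmat \<Rightarrow> 'n cmat \<Rightarrow> real"
    and \<beta> :: "'n cmat set"
    and M :: "'w measure"
    and W :: "'n cmat \<Rightarrow> real \<Rightarrow> 'w \<Rightarrow> real"
    and B :: "real \<Rightarrow> 'w \<Rightarrow> 'n cmat"
    and T \<alpha> :: real
    and P :: "nat \<Rightarrow> real list"
  assumes "matrix_lie_group G"
    and "real_inner_product_on (lie_algebra G) ip"
    and "orthonormal_basis_of (lie_algebra G) ip \<beta>"
    and "prob_space M"
    and "iid_brownian_motions M \<beta> W"
    and "group_brownian_motion M \<beta> W B"
    and "0 < T"
    and "\<And>k. is_partition T (P k)"
    and "0 < \<alpha>"
    and "summable (\<lambda>k. mesh (P k) powr \<alpha>)"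
  shows "AE \<omega> in M.
    (\<lambda>k. SUP t\<in>{0..T}. ennreal (normalized_norm (B_approx \<beta> W (P k) t \<omega> - B t \<omega>)))
      \<longlonglongrightarrow> 0"
proof -
  interpret prob_space M by fact
  interpret brownian_driver M \<beta> W
    by standard (use finite_orthonormal_basis[OF assms(2,3)] assms(5) in auto)
  \<comment> \<open>An exponent m \<ge> \<alpha> makes the powers of the mesh summable; m \<ge> 1 is
    what the moment bounds ask for.\<close>
  define m where "m = max 1 (nat \<lceil>\<alpha>\<rceil>)"
  have m: "1 \<le> m" "\<alpha> \<le> real m" unfolding m_def by linarith+
  have mesh_pos: "0 < mesh (P k)" for k by (rule partition_grid(7)[OF assms(8,7)])
  have sm: "summable (\<lambda>k. mesh (P k) ^ m)"
    by (rule summable_power_of_summable_powr[OF assms(10) mesh_pos assms(9) m(2)])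
  \<comment> \<open>One statement for each of the countably many tolerances 2 / (l + 1), so that the
    exceptional null sets can be united afterwards.\<close>
  have "AE \<omega> in M. \<forall>\<^sub>F k in sequentially. \<forall>t\<in>{0..T}.
      norm (B_approx \<beta> W (P k) t \<omega> - B t \<omega>) \<le> 2 * (1 / real (Suc l))" for l
  proof -
    have "0 < 1 / real (Suc l)" by simp
    note dev = B_approx_deviation[OF assms(6,7) m(1) this]
    obtain K where "0 \<le> K" and K: "\<And>p. is_partition T p \<Longrightarrow>
      outer_prob_le M (\<lambda>\<omega>. \<exists>t\<in>{0..T}. 2 * (1 / real (Suc l)) < norm (B_approx \<beta> W p t \<omega> - B t \<omega>)) (K * mesh p ^ m)"
      using dev by blast
    \<comment> \<open>The deviation events themselves are not known to be measurable, so measurable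
      covers are chosen and the Borel-Cantelli lemma is applied to these.\<close>
    have "\<forall>k. \<exists>E. E \<in> sets M \<and>
        {\<omega>\<in>space M. \<exists>t\<in>{0..T}. 2 * (1 / real (Suc l)) < norm (B_approx \<beta> W (P k) t \<omega> - B t \<omega>)} \<subseteq> E \<and>
        prob E \<le> K * mesh (P k) ^ m"
      using K[OF assms(8)] unfolding outer_prob_le_def by blast
    from choice[OF this] obtain E where E: "\<And>k. E k \<in> sets M"
      "\<And>k. {\<omega>\<in>space M. \<exists>t\<in>{0..T}. 2 * (1 / real (Suc l)) < norm (B_approx \<beta> W (P k) t \<omega> - B t \<omega>)} \<subseteq> E k"
      "\<And>k. prob (E k) \<le> K * mesh (P k) ^ m"
      by blast
    have "summable (\<lambda>k. prob (E k))"
      by (rule summable_comparison_test'[OF summable_mult[OF sm, of K]]) (use E(3) in auto)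
    then have "AE \<omega> in M. \<forall>\<^sub>F k in sequentially. \<omega> \<in> space M - E k"
      by (intro borel_cantelli_AE1 E) (simp_all add: emeasure_eq_measure)
    then show ?thesis
    proof eventually_elim
      case (elim \<omega>)
      then show ?case
      proof eventually_elim
        case (elim k)
        then show ?case using E(2)[of k] by (auto simp: not_less[symmetric])
      qed
    qed
  qed
  then have "AE \<omega> in M. \<forall>l. \<forall>\<^sub>F k in sequentially. \<forall>t\<in>{0..T}.
      norm (B_approx \<beta> W (P k) t \<omega> - B t \<omega>) \<le> 2 * (1 / real (Suc l))"
    by (simp add: AE_all_countable)
  then show ?thesis
  proof eventually_elim
    case (elim \<omega>)
    show ?case
    proof (rule order_tendstoI)
      fix a :: ennreal assume "0 < a"
      have "(\<lambda>l. ennreal (2 * (1 / real (Suc l)))) \<longlonglongrightarrow> ennreal (2 * 0)"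
        by (intro tendsto_ennrealI tendsto_mult tendsto_const LIMSEQ_Suc[OF lim_1_over_n])
      then have "\<forall>\<^sub>F l in sequentially. ennreal (2 * (1 / real (Suc l))) < a"
        using \<open>0 < a\<close> by (intro order_tendstoD(2)) auto
      then obtain l where l: "ennreal (2 * (1 / real (Suc l))) < a" by (auto simp: eventually_sequentially)
      show "\<forall>\<^sub>F k in sequentially. (SUP t\<in>{0..T}. ennreal (normalized_norm (B_approx \<beta> W (P k) t \<omega> - B t \<omega>))) < a"
        using elim[rule_format, of l]
      proof eventually_elim
        case (elim k)
        have "(SUP t\<in>{0..T}. ennreal (normalized_norm (B_approx \<beta> W (P k) t \<omega> - B t \<omega>))) \<le> ennreal (2 * (1 / real (Suc l)))"
          using elim by (intro SUP_least ennreal_leI order_trans[OF normalized_norm_le_norm]) auto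
        then show ?case using l by (rule le_less_trans)
      qed
    qed simp
  qed
qed

end
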